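(* Let $c\in \mathbb{C}\setminus \mathbb{Q}(i)$ and let $\varepsilon>0$ be sufficiently small. Then there exists an increasing sequence of natural numbers $(M_k)_{k\in \mathbb{N}}$ such that the following holds. If $0\le P_1<P_2\le M_k$, $\omega_1<\omega_2\le \omega_1+2\pi$ and $M_k^{\varepsilon-1/12}<\delta_k\le 1/2$, then $$\pi^{\ast}(P_1,P_2,\omega_1,\omega_2;\delta_k,c) = 4\delta_k^2\,\pi(P_1,P_2,\omega_1,\omega_2)+o\left(\frac{\delta_k^2 M_k^2}{\log M_k}\right)$$ as $k\to \infty$.
   Context: For $0\le a<b$ and real $\gamma_1<\gamma_2$, $D(a,b,\gamma_1,\gamma_2):=\{Re^{i\theta}: a<R\le b,\ \gamma_1<\theta\le\gamma_2\}$. $\pi(P_1,P_2,\omega_1,\omega_2)$ denotes the number of Gaussian primes (prime elements of $\mathbb{Z}[i]$) in $D(P_1,P_2,\omega_1,\omega_2)$. For $\delta>0$ and $c\in\mathbb{C}$, $\pi^{\ast}(P_1,P_2,\omega_1,\omega_2;\delta,c)$ denotes the number of Gaussian primes $p\in D(P_1,P_2,\omega_1,\omega_2)$ such that $\min_{q\in \mathbb{Z}[i]} \max(|\Re(pc-q)|,|\Im(pc-q)|) \le \delta$. *)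

theory Defs
  imports "HOL-Analysis.Analysis"
begin

definition gauss_ints :: "complex set" where
  "gauss_ints = {z. Re z \<in> \<int> \<and> Im z \<in> \<int>}"

definition gdvd :: "complex \<Rightarrow> complex \<Rightarrow> bool" where
  "gdvd a b \<longleftrightarrow> (\<exists>q\<in>gauss_ints. b = a * q)"

definition gauss_unit :: "complex \<Rightarrow> bool" where
  "gauss_unit u \<longleftrightarrow> u \<in> gauss_ints \<and> gdvd u 1"

definition gauss_prime :: "complex \<Rightarrow> bool" where
  "gauss_prime p \<longleftrightarrow> p \<in> gauss_ints \<and> p \<noteq> 0 \<and> \<not> gauss_unit p \<and>
     (\<forall>a\<in>gauss_ints. \<forall>b\<in>gauss_ints. gdvd p (a * b) \<longrightarrow> gdvd p a \<or> gdvd p b)"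

definition polar_region :: "real \<Rightarrow> real \<Rightarrow> real \<Rightarrow> real \<Rightarrow> complex set" where
  "polar_region a b g1 g2 =
     {z. \<exists>R \<theta>. a < R \<and> R \<le> b \<and> g1 < \<theta> \<and> \<theta> \<le> g2 \<and> z = of_real R * cis \<theta>}"

definition gprime_count :: "real \<Rightarrow> real \<Rightarrow> real \<Rightarrow> real \<Rightarrow> nat" where
  "gprime_count P1 P2 w1 w2 = card {p. gauss_prime p \<and> p \<in> polar_region P1 P2 w1 w2}"

text \<open>min over q in Z[i] of the sup-norm distance of p*c to q is at most delta
  (the minimum is attained, so this is the existence of such a q).\<close>
definition gprime_count_approx ::
  "real \<Rightarrow> real \<Rightarrow> real \<Rightarrow> real \<Rightarrow> real \<Rightarrow> complex \<Rightarrow> nat" where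
  "gprime_count_approx P1 P2 w1 w2 \<delta> c = card {p. gauss_prime p \<and> p \<in> polar_region P1 P2 w1 w2 \<and>
      (\<exists>q\<in>gauss_ints. max \<bar>Re (p * c - q)\<bar> \<bar>Im (p * c - q)\<bar> \<le> \<delta>)}"

end

theory Submission
  imports Defs "HOL-Real_Asymp.Real_Asymp"
begin

text \<open>
  Write \<open>e(z) = exp(2 \<pi> i Re z)\<close>. The records of the distance of \<open>j c\<close> to the Gaussian integers give
  arbitrarily large \<open>N\<close> with \<open>\<bar>j c - z\<bar> \<ge> 1/(2 sqrt N)\<close> for all Gaussian integers \<open>z\<close> and
  \<open>0 < \<bar>j\<bar>^2 < N\<close>. Take \<open>M = N^2\<close> and \<open>t = M powr (1/12)\<close>, so that all exponents become powers of \<open>t\<close>.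

  Majorants and minorants of the box built from powers of the Fejer kernel reduce the theorem to the bound
  \<open>t^22 log^2 t\<close> for the sum of \<open>e(p h c)\<close> over the primes of a convex sector, for \<open>0 < \<bar>h\<bar> \<le> t\<close>.
  A Buchstab decomposition, stopped as soon as the product \<open>d\<close> of the removed primes exceeds \<open>t^5\<close>, turns
  this sum into linear sums over multiples of \<open>d\<close> with \<open>\<bar>d\<bar> \<le> t^5\<close> and bilinear sums with
  \<open>t^5 < \<bar>d\<bar> \<le> t^10\<close>. The linear sums are geometric along rows and columns, and the spacing of the points
  \<open>k h c\<close> modulo the Gaussian integers bounds them on average. Cauchy's inequality reduces the bilinear
  sums to linear ones without separating the conditions on the product, because the intersection of two
  dilates of a convex sector is convex.
\<close>

section \<open>Gaussian integers\<close>

text \<open>The multiples of \<open>c\<close> are known to be well spaced only at the scales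
  \<open>N\<close> of the records, hence the sequence \<open>M_k\<close>. For
  \<open>|h| \<le> t\<close> the points \<open>k h c\<close> are separated by
  \<open>1/(2 t^3)\<close> for \<open>|k| < L = t^3/|h|\<close>, and \<open>L \<ge> t^2\<close> is
  the bottleneck. For divisors of size \<open>D\<close>, Cauchy's inequality leaves
  \<open>M^2\<close> times a sum of \<open>(M/L)^2\<close>, \<open>M^2 |h| / D\<close>,
  \<open>D^2\<close> and a smaller term. The first is at most \<open>t^20\<close>; up to constants,
  the second and third stay below \<open>t^20\<close> for \<open>t^5 \<le> D \<le> t^10\<close>.
  Taking the square root gives \<open>t^22\<close>. The sieve stopped at \<open>t^5\<close> fits
  this window: primes are removed in decreasing order, so the last one is at most the product of the
  others and the product overshoots to at most \<open>t^10\<close>; a single prime is at most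
  \<open>sqrt M = t^6\<close>. A box of side \<open>\<delta>\<close> needs frequencies up to about
  \<open>1/\<delta>\<close>, and the error is measured against \<open>\<delta>^2 t^24\<close>. The
  limits \<open>|h| \<le> t\<close> and \<open>t^22\<close> therefore both stop at
  \<open>\<delta>\<close> of size \<open>1/t\<close>, which is the exponent \<open>-1/12\<close> of
  \<open>M\<close>.\<close>

abbreviation (input) ZI :: "complex set" where
  "ZI \<equiv> gauss_ints"

abbreviation (input) ec :: "real \<Rightarrow> complex" where
  "ec x \<equiv> cis (2 * pi * x)"

lemma gauss_ints_0 [simp]: "0 \<in> ZI" and gauss_ints_1 [simp]: "1 \<in> ZI"
  and gauss_ints_ii [simp]: "\<i> \<in> ZI"
  by (auto simp: gauss_ints_def)

lemma gauss_ints_add [intro]: "a \<in> ZI \<Longrightarrow> b \<in> ZI \<Longrightarrow> a + b \<in> ZI"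
  and gauss_ints_diff [intro]: "a \<in> ZI \<Longrightarrow> b \<in> ZI \<Longrightarrow> a - b \<in> ZI"
  and gauss_ints_mult [intro]: "a \<in> ZI \<Longrightarrow> b \<in> ZI \<Longrightarrow> a * b \<in> ZI"
  and gauss_ints_minus [intro]: "a \<in> ZI \<Longrightarrow> - a \<in> ZI"
  and gauss_ints_cnj [intro]: "a \<in> ZI \<Longrightarrow> cnj a \<in> ZI"
  by (auto simp: gauss_ints_def)

lemma gauss_ints_Complex [simp]: "Complex (of_int a) (of_int b) \<in> ZI"
  by (auto simp: gauss_ints_def)

lemma gauss_intsE:
  assumes "z \<in> ZI"
  obtains a b :: int where "z = Complex (of_int a) (of_int b)"
  using assms by (auto simp: gauss_ints_def elim!: Ints_cases) (metis complex_surj)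

lemma gauss_ints_prod: "(\<And>x. x \<in> A \<Longrightarrow> f x \<in> ZI) \<Longrightarrow> prod f A \<in> ZI"
  by (induction A rule: infinite_finite_induct) auto

lemma gauss_ints_norm_sq:
  assumes "z \<in> ZI"
  obtains n :: nat where "(cmod z)^2 = real n"
proof -
  obtain a b :: int where z: "z = Complex (of_int a) (of_int b)"
    using assms by (rule gauss_intsE)
  have "(cmod z)^2 = of_int (a^2 + b^2)"
    by (simp add: z cmod_power2)
  also have "\<dots> = real (nat (a^2 + b^2))"
    by (simp add: of_nat_nat)
  finally show thesis by (rule that)
qed

text \<open>Squared norms of Gaussian integers are natural numbers, so least elements exist. This
  well-ordering drives Euclidean division, the smallest prime factor and the records of Diophantine
  approximation.\<close>

lemma gauss_ints_norm_minimum: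
  assumes "A \<subseteq> ZI" "A \<noteq> {}"
  shows "\<exists>g\<in>A. \<forall>z\<in>A. cmod g \<le> cmod z"
proof -
  define m where "m z = nat \<lfloor>(cmod z)^2\<rfloor>" for z
  obtain g where g: "g \<in> A" "\<And>z. z \<in> A \<Longrightarrow> m g \<le> m z"
    using ex_has_least_nat[of "\<lambda>z. z \<in> A" _ m] assms(2) by blast
  have m: "(cmod z)^2 = real (m z)" if z: "z \<in> A" for z
  proof -
    obtain n where "(cmod z)^2 = real n" using z assms(1) gauss_ints_norm_sq by blast
    then show ?thesis by (simp add: m_def)
  qed
  have "cmod g \<le> cmod z" if "z \<in> A" for z
    using m[OF that] m[OF g(1)] g(2)[OF that] by (intro power2_le_imp_le[of "cmod g" "cmod z"]) auto
  with g(1) show ?thesis by blast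
qed

lemma gauss_ints_norm_ge_1:
  assumes "z \<in> ZI" "z \<noteq> 0"
  shows "1 \<le> cmod z"
proof -
  obtain n where n: "(cmod z)^2 = real n" using assms(1) by (rule gauss_ints_norm_sq)
  then have "n \<noteq> 0" using assms(2) by (metis of_nat_0 norm_eq_zero power_eq_0_iff)
  then have "1^2 \<le> (cmod z)^2" using n by simp
  then show ?thesis by (rule power2_le_imp_le) simp
qed

definition gauss_near :: "complex \<Rightarrow> complex" where
  "gauss_near z = Complex (of_int (round (Re z))) (of_int (round (Im z)))"

lemma gauss_near_int [simp]: "gauss_near z \<in> ZI"
  by (simp add: gauss_near_def)

text \<open>Each coordinate is off by at most 1/2, so the distance is at most
  \<open>1 / sqrt 2\<close>. Strictness below 1 is what makes division with remainder work.\<close>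

lemma gauss_near_dist: "cmod (z - gauss_near z) < 1"
proof -
  have "\<bar>Re (z - gauss_near z)\<bar> \<le> 1/2" "\<bar>Im (z - gauss_near z)\<bar> \<le> 1/2"
    using of_int_round_abs_le[of "Re z"] of_int_round_abs_le[of "Im z"]
    by (auto simp: gauss_near_def abs_minus_commute)
  then have "\<bar>Re (z - gauss_near z)\<bar>^2 + \<bar>Im (z - gauss_near z)\<bar>^2 \<le> (1/2)^2 + (1/2)^2"
    by (intro add_mono power_mono) auto
  then have "(cmod (z - gauss_near z))^2 \<le> 1/2" unfolding cmod_power2 power2_abs by (simp add: power2_eq_square)
  then have "(cmod (z - gauss_near z))^2 < 1^2" by simp
  then show ?thesis by (rule power2_less_imp_less) simp
qed

definition gball :: "real \<Rightarrow> complex set" where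
  "gball R = {z \<in> ZI. cmod z \<le> R}"

lemma gball_card:
  shows finite_gball [simp]: "finite (gball R)"
    and card_gball: "0 \<le> R \<Longrightarrow> real (card (gball R)) \<le> (2 * R + 1)^2"
proof -
  define I where "I = {-\<lfloor>R\<rfloor>..\<lfloor>R\<rfloor>}"
  define g where "g = (\<lambda>(a, b). Complex (of_int a) (of_int b))"
  have sub: "gball R \<subseteq> g ` (I \<times> I)"
  proof
    fix z assume z: "z \<in> gball R"
    then obtain a b :: int where ab: "z = Complex (of_int a) (of_int b)"
      by (auto simp: gball_def elim: gauss_intsE)
    have "\<bar>of_int a\<bar> \<le> R" "\<bar>of_int b\<bar> \<le> R"
      using z abs_Re_le_cmod[of z] abs_Im_le_cmod[of z] by (auto simp: ab gball_def)
    then have "\<bar>a\<bar> \<le> \<lfloor>R\<rfloor>" "\<bar>b\<bar> \<le> \<lfloor>R\<rfloor>" by (simp_all add: le_floor_iff)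
    then show "z \<in> g ` (I \<times> I)" by (auto simp: ab g_def I_def image_iff)
  qed
  then show "finite (gball R)" by (rule finite_subset) (auto simp: I_def)
  assume R: "0 \<le> R"
  have "card (gball R) \<le> card (g ` (I \<times> I))" by (intro card_mono sub) (auto simp: I_def)
  also have "\<dots> \<le> card (I \<times> I)" by (rule card_image_le) (auto simp: I_def)
  finally have "card (gball R) \<le> (card I)^2"
    by (simp add: card_cartesian_product power2_eq_square)
  then have "real (card (gball R)) \<le> (real (card I))^2"
    by (metis of_nat_le_iff of_nat_power)
  also have "real (card I) = 2 * of_int \<lfloor>R\<rfloor> + 1"
    using R by (simp add: I_def)
  also have "(2 * of_int \<lfloor>R\<rfloor> + 1)^2 \<le> (2 * R + 1)^2"
    using R by (intro power_mono) auto
  finally show "real (card (gball R)) \<le> (2 * R + 1)^2" .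
qed

section \<open>Divisibility, units and prime factors\<close>

lemma gdvd_refl [simp]: "gdvd a a"
  by (auto simp: gdvd_def intro!: bexI[of _ 1])

lemma gdvd_trans: "gdvd a b \<Longrightarrow> gdvd b c \<Longrightarrow> gdvd a c"
  by (auto simp: gdvd_def mult.assoc)

lemma gdvd_mult_left: "gdvd a b \<Longrightarrow> c \<in> ZI \<Longrightarrow> gdvd a (b * c)"
  by (auto simp: gdvd_def mult.assoc)

lemma gauss_unit_iff: "gauss_unit u \<longleftrightarrow> u \<in> ZI \<and> cmod u = 1"
proof (intro iffI conjI)
  assume "gauss_unit u"
  then obtain v where v: "u \<in> ZI" "v \<in> ZI" "u * v = 1"
    by (auto simp: gauss_unit_def gdvd_def)
  then show "u \<in> ZI" by simp
  have "cmod u * cmod v = 1" using v by (metis norm_mult norm_one)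
  moreover have "1 \<le> cmod u" "1 \<le> cmod v"
    using v by (auto intro!: gauss_ints_norm_ge_1)
  ultimately show "cmod u = 1"
    by (smt (verit) mult_left_le mult_cancel_left1 mult_le_cancel_left1)
next
  assume u: "u \<in> ZI \<and> cmod u = 1"
  then have "1 = u * cnj u" by (simp add: complex_norm_square[symmetric])
  then show "gauss_unit u" using u by (auto simp: gauss_unit_def gdvd_def)
qed

lemma gauss_unit_mult_prime:
  assumes "gauss_prime p" "gauss_unit u"
  shows "gauss_prime (p * u)"
proof -
  obtain v where v: "v \<in> ZI" "u * v = 1"
    using assms(2) by (auto simp: gauss_unit_def gdvd_def)
  have u: "u \<in> ZI" "cmod u = 1" using assms(2) by (auto simp: gauss_unit_iff)
  have dv: "gdvd (p * u) x \<longleftrightarrow> gdvd p x" for x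
  proof
    assume "gdvd (p * u) x"
    then show "gdvd p x" using u by (auto simp: gdvd_def mult.assoc)
  next
    assume "gdvd p x"
    then obtain y where y: "y \<in> ZI" "x = p * y" by (auto simp: gdvd_def)
    then have "x = (p * u) * (v * y)" using v by (metis mult.assoc mult.left_neutral)
    then show "gdvd (p * u) x" using v y unfolding gdvd_def by blast
  qed
  have "p * u \<noteq> 0" using assms(1) u by (auto simp: gauss_prime_def)
  then show ?thesis
    using assms u dv by (auto simp: gauss_prime_def gauss_unit_iff norm_mult)
qed

abbreviation (input) primes_in :: "complex set \<Rightarrow> complex set" where
  "primes_in R \<equiv> {p. gauss_prime p \<and> p \<in> R}"

text \<open>The ideal \<open>J\<close> generated by \<open>p\<close> and \<open>a\<close> is
  principal: a nonzero \<open>g\<close> of least norm divides all of it, as a remainder would be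
  smaller. If \<open>g\<close> is a unit, the Bezout identity multiplied by \<open>b\<close> shows
  that \<open>p\<close> divides \<open>b\<close>; otherwise \<open>p\<close> divides
  \<open>g\<close> and hence \<open>a\<close>.\<close>

lemma irreducible_gauss_prime:
  assumes p: "p \<in> ZI" "p \<noteq> 0" "\<not> gauss_unit p"
    and irr: "\<And>x. x \<in> ZI \<Longrightarrow> gdvd x p \<Longrightarrow> gauss_unit x \<or> gdvd p x"
  shows "gauss_prime p"
  unfolding gauss_prime_def
proof (intro conjI ballI impI)
  fix a b assume ab: "a \<in> ZI" "b \<in> ZI" "gdvd p (a * b)"
  define J where "J = {z. \<exists>x\<in>ZI. \<exists>y\<in>ZI. z = x * p + y * a}"
  have JG: "J \<subseteq> ZI" using p ab by (auto simp: J_def)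
  have Jsub: "z - w * g \<in> J" if J: "z \<in> J" "g \<in> J" "w \<in> ZI" for z w g
  proof -
    obtain x y x' y' where *: "x \<in> ZI" "y \<in> ZI" "z = x * p + y * a"
      "x' \<in> ZI" "y' \<in> ZI" "g = x' * p + y' * a"
      using J unfolding J_def by blast
    then have "z - w * g = (x - w * x') * p + (y - w * y') * a" by (simp add: algebra_simps)
    moreover have "x - w * x' \<in> ZI" "y - w * y' \<in> ZI" using * J by auto
    ultimately show ?thesis unfolding J_def by blast
  qed
  have "p = 1 * p + 0 * a" "a = 0 * p + 1 * a" by simp_all
  then have pJ: "p \<in> J" and aJ: "a \<in> J"
    unfolding J_def using gauss_ints_0 gauss_ints_1 by blast+
  obtain g where g: "g \<in> J" "g \<noteq> 0" and g_min: "\<And>z. z \<in> J \<Longrightarrow> z \<noteq> 0 \<Longrightarrow> cmod g \<le> cmod z"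
  proof -
    have "J - {0} \<subseteq> ZI" "J - {0} \<noteq> {}" using JG pJ p(2) by auto
    from gauss_ints_norm_minimum[OF this] show ?thesis using that by blast
  qed
  have gdv: "gdvd g z" if z: "z \<in> J" for z
  proof -
    obtain w where w: "w \<in> ZI" "cmod (z / g - w) < 1"
      using gauss_near_int gauss_near_dist by blast
    have rJ: "z - w * g \<in> J" using Jsub[OF z g(1) w(1)] .
    have "z - w * g = 0"
    proof (rule ccontr)
      assume nz: "z - w * g \<noteq> 0"
      have "cmod g \<le> cmod (z - w * g)" by (rule g_min[OF rJ nz])
      also have "z - w * g = (z / g - w) * g" using g(2) by (simp add: algebra_simps)
      also have "cmod \<dots> < 1 * cmod g"
        unfolding norm_mult using w g by (intro mult_strict_right_mono) auto
      finally show False by simp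
    qed
    then show ?thesis using w by (auto simp: gdvd_def mult.commute)
  qed
  consider "gauss_unit g" | "gdvd p g"
    using irr[of g] gdv[OF pJ] g JG by blast
  then show "gdvd p a \<or> gdvd p b"
  proof cases
    case 1
    then obtain v where v: "v \<in> ZI" "g * v = 1"
      by (auto simp: gauss_unit_def gdvd_def)
    obtain x y where xy: "x \<in> ZI" "y \<in> ZI" "g = x * p + y * a"
      using g by (auto simp: J_def)
    obtain w where w: "w \<in> ZI" "a * b = p * w" using ab by (auto simp: gdvd_def)
    have "b = (g * v) * b" using v by simp
    also have "\<dots> = p * (x * v * b) + (a * b) * (y * v)"
      by (simp add: xy algebra_simps)
    also have "\<dots> = p * (x * v * b + w * (y * v))" by (simp add: w algebra_simps)
    finally have "gdvd p b" unfolding gdvd_def using xy w v ab by blast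
    then show ?thesis ..
  next
    case 2
    then show ?thesis using gdv[OF aJ] gdvd_trans by blast
  qed
qed (use p in auto)

text \<open>A nonunit divisor \<open>p\<close> of least norm is irreducible. Its cofactor is again a
  nonunit divisor and so no smaller than \<open>p\<close>, which gives the square root bound on
  which the sieve relies.\<close>

lemma gauss_prime_small_factor:
  assumes n: "n \<in> ZI" "n \<noteq> 0" "\<not> gauss_unit n" "\<not> gauss_prime n"
  obtains p where "gauss_prime p" "gdvd p n" "(cmod p)^2 \<le> cmod n"
proof -
  define A where "A = {z \<in> ZI. gdvd z n \<and> \<not> gauss_unit z}"
  have A: "A \<subseteq> ZI" "A \<noteq> {}" using n gdvd_refl[of n] by (auto simp: A_def simp del: gdvd_refl)
  obtain p where "p \<in> A" and min': "\<And>z. z \<in> A \<Longrightarrow> cmod p \<le> cmod z"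
    using gauss_ints_norm_minimum[OF A] by blast
  then have p: "p \<in> ZI" "gdvd p n" "\<not> gauss_unit p"
    and min: "\<And>z. z \<in> ZI \<Longrightarrow> gdvd z n \<Longrightarrow> \<not> gauss_unit z \<Longrightarrow> cmod p \<le> cmod z"
    by (auto simp: A_def)
  obtain m where m: "m \<in> ZI" "n = p * m" using p by (auto simp: gdvd_def)
  have p0: "p \<noteq> 0" using m n by auto
  have prime: "gauss_prime p"
  proof (rule irreducible_gauss_prime)
    fix x assume x: "x \<in> ZI" "gdvd x p"
    show "gauss_unit x \<or> gdvd p x"
    proof (rule disjCI)
      assume "\<not> gdvd p x"
      obtain y where y: "y \<in> ZI" "p = x * y" using x by (auto simp: gdvd_def)
      show "gauss_unit x"
      proof (rule ccontr)
        assume nu: "\<not> gauss_unit x"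
        have "cmod p \<le> cmod x" using min[of x] x p nu gdvd_trans by blast
        moreover have "cmod p = cmod x * cmod y" by (simp add: y norm_mult)
        moreover have "x \<noteq> 0" "y \<noteq> 0" using y p0 by auto
        moreover have "1 \<le> cmod y" using y \<open>y \<noteq> 0\<close> by (intro gauss_ints_norm_ge_1)
        ultimately have "cmod y = 1" by (smt (verit) mult_le_cancel_left1 norm_le_zero_iff mult_le_cancel_left2 norm_ge_zero)
        then have "gauss_unit y" using y by (simp add: gauss_unit_iff)
        then obtain v where "v \<in> ZI" "y * v = 1" by (auto simp: gauss_unit_def gdvd_def)
        then have "x = p * v" using y by (simp add: mult.assoc)
        then show False using \<open>\<not> gdvd p x\<close> \<open>v \<in> ZI\<close> by (auto simp: gdvd_def)
      qed
    qed
  qed (use p p0 in auto)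
  \<comment> \<open>Were \<open>m\<close> a unit, \<open>n\<close> would be an associate of the
    prime \<open>p\<close> and itself prime.\<close>
  have "\<not> gauss_unit m" using gauss_unit_mult_prime[OF prime] m n by blast
  moreover have "gdvd m n" using m p by (auto simp: gdvd_def mult.commute)
  ultimately have "cmod p \<le> cmod m" using min m by blast
  then have "cmod p * cmod p \<le> cmod p * cmod m" by (intro mult_left_mono) auto
  then have "(cmod p)^2 \<le> cmod n" by (simp add: m norm_mult power2_eq_square)
  with prime p show thesis by (intro that) auto
qed

text \<open>The half-open first quadrant contains exactly one associate of every prime, so sets of
  such primes correspond to their products without ambiguity by units.\<close>

definition cprime :: "complex \<Rightarrow> bool" where
  "cprime p \<longleftrightarrow> gauss_prime p \<and> 0 < Re p \<and> 0 \<le> Im p"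

lemma cprime_associate:
  assumes "gauss_prime p"
  obtains q where "cprime q" "gdvd q p" "cmod q = cmod p"
proof -
  have p0: "p \<noteq> 0" using assms by (auto simp: gauss_prime_def)
  have *: "\<exists>u\<in>{1, -1, \<i>, -\<i>}. 0 < Re (p * u) \<and> 0 \<le> Im (p * u)"
  proof -
    have "Re p \<noteq> 0 \<or> Im p \<noteq> 0" using p0 complex_eqI[of p 0] by auto
    then consider "Re p > 0" "Im p \<ge> 0" | "Re p < 0" "Im p \<le> 0" | "Im p < 0" "Re p \<ge> 0"
      | "Im p > 0" "Re p \<le> 0" by linarith
    then show ?thesis by cases auto
  qed
  then obtain u where u: "u \<in> {1, -1, \<i>, -\<i>}" "0 < Re (p * u)" "0 \<le> Im (p * u)" by blast
  have uu: "gauss_unit u" using u(1) by (auto simp: gauss_unit_iff)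
  then obtain v where v: "v \<in> ZI" "u * v = 1" by (auto simp: gauss_unit_def gdvd_def)
  have "p = (p * u) * v" using v by (simp add: mult.assoc)
  then have "gdvd (p * u) p" using v by (auto simp: gdvd_def)
  moreover have "cprime (p * u)" using u gauss_unit_mult_prime[OF assms uu] by (auto simp: cprime_def)
  moreover have "cmod (p * u) = cmod p" using uu by (simp add: gauss_unit_iff norm_mult)
  ultimately show thesis using that by blast
qed

lemma gauss_prime_norm_gt_1: "gauss_prime p \<Longrightarrow> 1 < cmod p"
  using gauss_ints_norm_ge_1[of p] by (fastforce simp: gauss_prime_def gauss_unit_iff)

lemma gauss_prime_gdvd_unit:
  assumes P: "gauss_prime p" "gauss_prime q" "gdvd p q"
  obtains u where "gauss_unit u" "q = p * u"
proof -
  obtain u where u: "u \<in> ZI" "q = p * u" using assms by (auto simp: gdvd_def)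
  have pG: "p \<in> ZI" "p \<noteq> 0" "\<not> gauss_unit p" using P by (auto simp: gauss_prime_def)
  have q0: "q \<noteq> 0" using P by (auto simp: gauss_prime_def)
  have "gdvd q p \<or> gdvd q u"
    using P(2) u pG unfolding gauss_prime_def by (metis gdvd_refl)
  moreover have "\<not> gdvd q u"
  proof
    assume "gdvd q u"
    then obtain w where w: "w \<in> ZI" "u = q * w" by (auto simp: gdvd_def)
    then have "q * (p * w) = q * 1" using u by (simp add: algebra_simps)
    then have "1 = p * w" using q0 by (metis mult_cancel_left)
    then have "gauss_unit p" using w pG unfolding gauss_unit_def gdvd_def by blast
    then show False using pG by simp
  qed
  ultimately obtain v where v: "v \<in> ZI" "p = q * v" by (auto simp: gdvd_def)
  have "p * (u * v) = p * 1" using u v by (metis mult.assoc mult.right_neutral)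
  then have uv: "u * v = 1" using pG by (metis mult_cancel_left)
  then have "gauss_unit u" using u v by (auto simp: gauss_unit_def gdvd_def)
  then show thesis using u(2) by (rule that)
qed

text \<open>The primes differ by a unit, and among the four units only 1 maps a point of the
  half-open quadrant into that quadrant.\<close>

lemma cprime_gdvd_eq:
  assumes "cprime p" "cprime q" "gdvd p q"
  shows "p = q"
proof -
  obtain u where u: "gauss_unit u" "q = p * u"
    using gauss_prime_gdvd_unit assms unfolding cprime_def by blast
  then have cu: "u \<in> ZI" "cmod u = 1" by (auto simp: gauss_unit_iff)
  obtain a b :: int where ab: "u = Complex (of_int a) (of_int b)" using cu(1) by (rule gauss_intsE)
  have "real_of_int (a^2 + b^2) = 1"
    using cu(2) cmod_power2[of u] by (simp add: ab)
  then have ab1: "a^2 + b^2 = 1" by linarith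
  have "a^2 \<le> 1" "b^2 \<le> 1" using ab1 by (smt (verit) zero_le_power2)+
  then have "\<bar>a\<bar> \<le> 1" "\<bar>b\<bar> \<le> 1" by (simp_all add: abs_square_le_1)
  then have "a \<in> {-1, 0, 1}" "b \<in> {-1, 0, 1}" by auto
  with ab1 have cases: "(a, b) \<in> {(1, 0), (-1, 0), (0, 1), (0, -1)}" by auto
  have "0 < Re q" "0 \<le> Im q" "0 < Re p" "0 \<le> Im p" using assms by (auto simp: cprime_def)
  then have "(a, b) = (1, 0)" using cases u(2) by (auto simp: ab)
  then show ?thesis using u(2) by (simp add: ab complex_eq_iff)
qed

lemma gauss_prime_dvd_prod:
  assumes "gauss_prime p" "finite A" "\<And>x. x \<in> A \<Longrightarrow> f x \<in> ZI" "gdvd p (prod f A)"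
  shows "\<exists>x\<in>A. gdvd p (f x)"
  using assms(2-)
proof (induction A rule: finite_induct)
  case empty
  then show ?case using assms(1) by (auto simp: gauss_prime_def gauss_unit_def)
next
  case (insert x A)
  have "f x \<in> ZI" "prod f A \<in> ZI" using insert by (auto intro: gauss_ints_prod)
  then have "gdvd p (f x) \<or> gdvd p (prod f A)"
    using insert assms(1) by (simp add: gauss_prime_def)
  then show ?case using insert by auto
qed

lemma cprime_gauss_int: "cprime p \<Longrightarrow> p \<in> ZI"
  by (simp add: cprime_def gauss_prime_def)

lemma cprime_dvd_Prod_iff:
  assumes "cprime p" "finite A" "\<And>x. x \<in> A \<Longrightarrow> cprime x"
  shows "gdvd p (\<Prod>A) \<longleftrightarrow> p \<in> A"
proof
  assume "gdvd p (\<Prod>A)"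
  then obtain x where "x \<in> A" "gdvd p x"
    using gauss_prime_dvd_prod[of p A "\<lambda>x. x"] assms by (auto simp: cprime_def cprime_gauss_int)
  then show "p \<in> A" using cprime_gdvd_eq assms by blast
next
  assume "p \<in> A"
  then have "\<Prod>A = p * \<Prod>(A - {p})" using assms by (simp add: prod.remove)
  moreover have "\<Prod>(A - {p}) \<in> ZI" using assms by (intro gauss_ints_prod) (auto simp: cprime_gauss_int)
  ultimately show "gdvd p (\<Prod>A)" by (auto simp: gdvd_def)
qed

text \<open>The squarefree case of unique factorisation: a prime outside \<open>A\<close> does not
  divide \<open>\<Prod>A\<close>, so as a divisor of \<open>n\<close> it must divide the remaining
  cofactor.\<close>

lemma Prod_cprime_dvd_iff:
  assumes "finite A" "\<And>x. x \<in> A \<Longrightarrow> cprime x" "n \<in> ZI"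
  shows "gdvd (\<Prod>A) n \<longleftrightarrow> (\<forall>p\<in>A. gdvd p n)"
proof
  assume "gdvd (\<Prod>A) n"
  then show "\<forall>p\<in>A. gdvd p n"
    using cprime_dvd_Prod_iff[OF _ assms(1,2)] assms(2) gdvd_trans[of _ "\<Prod>A" n] by blast
next
  assume "\<forall>p\<in>A. gdvd p n"
  with assms show "gdvd (\<Prod>A) n"
  proof (induction A rule: finite_induct)
    case empty
    then show ?case by (auto simp: gdvd_def)
  next
    case (insert p A)
    then have "gdvd (\<Prod>A) n" by blast
    then obtain m where m: "m \<in> ZI" "n = \<Prod>A * m" by (auto simp: gdvd_def)
    have pr: "\<Prod>A \<in> ZI" using insert by (intro gauss_ints_prod) (auto simp: cprime_gauss_int)
    have "cprime p" using insert by simp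
    have "\<not> gdvd p (\<Prod>A)" using cprime_dvd_Prod_iff[of p A] insert by simp
    moreover have "gdvd p (\<Prod>A * m)" using insert.prems m by simp
    ultimately have "gdvd p m"
      using \<open>cprime p\<close> m pr unfolding cprime_def gauss_prime_def by blast
    then obtain k where "k \<in> ZI" "m = p * k" by (auto simp: gdvd_def)
    then have "n = \<Prod>(insert p A) * k" using m insert.hyps by (simp add: algebra_simps)
    then show ?case using \<open>k \<in> ZI\<close> unfolding gdvd_def by blast
  qed
qed

section \<open>Exponential sums over convex sets\<close>

text \<open>Since \<open>Re (z * b) = Re z * Re b - Im z * Im b\<close>, the functions
  \<open>ee (z * b)\<close> of \<open>z\<close> are all the unitary characters of the lattice of
  Gaussian integers.\<close>

definition ee :: "complex \<Rightarrow> complex" where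
  "ee z = cis (2 * pi * Re z)"

lemma ee_add: "ee (a + b) = ee a * ee b"
  by (simp add: ee_def cis_mult distrib_left)

lemma ee_0 [simp]: "ee 0 = 1"
  by (simp add: ee_def)

lemma cnj_ee: "cnj (ee a) = ee (- a)"
  by (simp add: ee_def cis_cnj)

lemma norm_ee [simp]: "cmod (ee a) = 1"
  by (simp add: ee_def)

definition dint :: "real \<Rightarrow> real" where
  "dint x = \<bar>x - of_int (round x)\<bar>"

lemma dint_nonneg [simp]: "0 \<le> dint x"
  by (simp add: dint_def)

lemma dint_le: "dint x \<le> \<bar>x - of_int m\<bar>"
  unfolding dint_def by (rule round_diff_minimal)

lemma dint_minus: "dint (- x) = dint x"
proof -
  have "dint (- x) \<le> dint x" for x
    using dint_le[of "- x" "- round x"] by (simp add: dint_def)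
  from this[of x] this[of "- x"] show ?thesis by simp
qed

text \<open>Jordan's inequality: sine is concave on \<open>[0, pi/2]\<close> and lies above its
  chord.\<close>

lemma sin_pi_ge:
  assumes "0 \<le> y" "y \<le> 1/2"
  shows "2 * y \<le> sin (pi * y)"
proof -
  have "convex_on {0..pi/2} (\<lambda>x. - sin x)"
  proof (rule f''_ge0_imp_convex)
    show "((\<lambda>x. - sin x) has_real_derivative - cos x) (at x)" for x
      by (auto intro!: derivative_eq_intros)
    show "((\<lambda>x. - cos x) has_real_derivative sin x) (at x)" for x
      by (auto intro!: derivative_eq_intros)
  qed (auto intro!: sin_ge_zero)
  then have "- sin ((1 - 2 * y) *\<^sub>R 0 + (2 * y) *\<^sub>R (pi / 2)) \<le> (1 - 2 * y) * (- sin 0) + (2 * y) * (- sin (pi / 2))"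
    by (rule convex_onD) (use assms in auto)
  then show ?thesis by (simp add: mult.commute)
qed

lemma abs_sin_pi_ge: "2 * dint x \<le> \<bar>sin (pi * x)\<bar>"
proof -
  define y where "y = x - of_int (round x)"
  have "\<bar>sin (pi * x)\<bar> = \<bar>sin (pi * y + pi * of_int (round x))\<bar>"
    by (simp add: y_def algebra_simps)
  also have "\<dots> = \<bar>sin (pi * y)\<bar>"
  proof -
    have 0: "sin (pi * of_int (round x)) = 0" by (simp add: sin_zero_iff_int2 mult.commute)
    then have "\<bar>cos (pi * of_int (round x))\<bar> = 1" by (rule sin_zero_abs_cos_one)
    with 0 show ?thesis by (simp add: sin_add abs_mult)
  qed
  also have "\<bar>sin (pi * y)\<bar> = \<bar>sin (pi * \<bar>y\<bar>)\<bar>"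
    by (cases "0 \<le> y") auto
  also have "\<dots> \<ge> 2 * \<bar>y\<bar>"
    using sin_pi_ge[of "\<bar>y\<bar>"] of_int_round_abs_le[of x] by (auto simp: y_def abs_minus_commute)
  finally show ?thesis by (simp add: dint_def y_def)
qed

lemma norm_cis_minus_1: "cmod (cis t - 1) = 2 * \<bar>sin (t / 2)\<bar>"
proof -
  have "(cmod (cis t - 1))^2 = (cos t - 1)^2 + (sin t)^2"
    by (simp add: cmod_power2)
  also have "\<dots> = 2 - 2 * cos (2 * (t / 2))"
    using sin_cos_squared_add[of t] by (simp add: power2_eq_square algebra_simps)
  also have "\<dots> = (2 * \<bar>sin (t / 2)\<bar>)^2"
    unfolding cos_double_sin by (simp add: power_mult_distrib)
  finally show ?thesis by (subst (asm) power2_eq_iff_nonneg) auto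
qed

lemma geometric_cis_telescope:
  fixes a b :: int
  assumes "a - 1 \<le> b"
  shows "(cis t - 1) * (\<Sum>k\<in>{a..b}. cis (t * of_int k)) = cis (t * of_int (b + 1)) - cis (t * of_int a)"
  using assms
proof (induction b rule: int_ge_induct)
  case base
  then show ?case by simp
next
  case (step b)
  have "{a..b + 1} = insert (b + 1) {a..b}" using step by auto
  then have "(cis t - 1) * (\<Sum>k\<in>{a..b + 1}. cis (t * of_int k))
    = (cis t - 1) * cis (t * of_int (b + 1)) + (cis (t * of_int (b + 1)) - cis (t * of_int a))"
    using step by (simp add: distrib_left)
  also have "\<dots> = cis (t * of_int (b + 1 + 1)) - cis (t * of_int a)"
    by (simp add: algebra_simps cis_mult)
  finally show ?case .
qed

lemma int_interval:
  fixes X :: "int set"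
  assumes "finite X" "\<And>a b c. a \<in> X \<Longrightarrow> b \<in> X \<Longrightarrow> a \<le> c \<Longrightarrow> c \<le> b \<Longrightarrow> c \<in> X"
  obtains a b where "X = {a..b}" "a - 1 \<le> b"
proof (cases "X = {}")
  case True
  then show thesis using that[of 0 "-1"] by auto
next
  case False
  then have "Min X \<in> X" "Max X \<in> X" "X \<subseteq> {Min X..Max X}" using assms(1) by auto
  moreover have "{Min X..Max X} \<subseteq> X" using assms(2)[OF calculation(1,2)] by auto
  ultimately have "X = {Min X..Max X}" by blast
  moreover have "Min X \<le> Max X" using False assms by simp
  ultimately show thesis using that[of "Min X" "Max X"] by auto
qed

text \<open>The second hypothesis makes \<open>X\<close> an interval, so the sum telescopes against
  \<open>ec x - 1\<close>, whose modulus is at least \<open>4 * dint x\<close>. The product form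
  covers integral \<open>x\<close>, where the usual quotient breaks down.\<close>

lemma geometric_cis_bound:
  assumes "finite X" "\<And>a b c. a \<in> X \<Longrightarrow> b \<in> X \<Longrightarrow> a \<le> c \<Longrightarrow> c \<le> b \<Longrightarrow> c \<in> X"
  shows "cmod (\<Sum>k\<in>X. ec (of_int k * x)) * dint x \<le> 1/2"
proof -
  obtain a b where X: "X = {a..b}" "a - 1 \<le> b" using int_interval assms by blast
  let ?S = "\<Sum>k\<in>X. ec (of_int k * x)"
  have "4 * dint x * cmod ?S \<le> cmod (ec x - 1) * cmod ?S"
    using abs_sin_pi_ge[of x] by (intro mult_right_mono) (simp_all add: norm_cis_minus_1)
  also have "\<dots> = cmod ((ec x - 1) * ?S)" by (simp add: norm_mult)
  also have "(ec x - 1) * ?S = cis (2 * pi * x * of_int (b + 1)) - cis (2 * pi * x * of_int a)"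
    using geometric_cis_telescope[OF X(2), of "2 * pi * x"] by (simp add: X(1) mult_ac)
  also have "cmod \<dots> \<le> 2" by (rule order_trans[OF norm_triangle_ineq4]) simp
  finally show ?thesis by (simp add: mult_ac)
qed

text \<open>A convex set meets each horizontal lattice line in consecutive points. Every row is
  therefore a geometric progression of ratio \<open>ec (Re b)\<close>, and there are at most
  \<open>2 * R + 1\<close> rows.\<close>

lemma convex_ee_sum_row:
  assumes C: "convex C" and R: "0 \<le> R"
  shows "cmod (\<Sum>z\<in>C \<inter> gball R. ee (z * b)) * dint (Re b) \<le> (2 * R + 1) / 2"
proof -
  define S where "S = C \<inter> gball R"
  define I where "I = {-\<lfloor>R\<rfloor>..\<lfloor>R\<rfloor>}"
  let ?row = "\<lambda>y. \<Sum>z\<in>{z \<in> S. \<lfloor>Im z\<rfloor> = y}. ee (z * b)"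
  have finS: "finite S" by (simp add: S_def)
  have "(\<lambda>z. \<lfloor>Im z\<rfloor>) ` S \<subseteq> I"
  proof safe
    fix z assume z: "z \<in> S"
    then obtain a b :: int where ab: "z = Complex (of_int a) (of_int b)"
      by (auto simp: S_def gball_def elim: gauss_intsE)
    have "\<bar>of_int b\<bar> \<le> R"
      using z abs_Im_le_cmod[of z] by (auto simp: ab gball_def S_def)
    then have "\<bar>b\<bar> \<le> \<lfloor>R\<rfloor>" by (simp add: le_floor_iff)
    then show "\<lfloor>Im z\<rfloor> \<in> I" by (auto simp: ab I_def)
  qed
  then have "(\<Sum>z\<in>S. ee (z * b)) = (\<Sum>y\<in>I. ?row y)"
    using finS by (intro sum.group[symmetric]) (auto simp: I_def)
  then have "cmod (\<Sum>z\<in>S. ee (z * b)) * dint (Re b)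
      \<le> (\<Sum>y\<in>I. cmod (?row y)) * dint (Re b)"
    by (intro mult_right_mono) (auto intro: norm_sum)
  also have "\<dots> = (\<Sum>y\<in>I. cmod (?row y) * dint (Re b))"
    by (simp add: sum_distrib_right)
  also have "\<dots> \<le> (\<Sum>y\<in>I. 1/2)"
  proof (rule sum_mono)
    fix y
    define X where "X = {x. Complex (of_int x) (of_int y) \<in> S}"
    define g where "g x = Complex (of_int x) (of_int y)" for x :: int
    have inj: "inj_on g X" by (auto simp: inj_on_def g_def)
    have im: "{z \<in> S. \<lfloor>Im z\<rfloor> = y} = g ` X"
    proof safe
      fix z assume z: "z \<in> S" "y = \<lfloor>Im z\<rfloor>"
      then obtain a b :: int where ab: "z = Complex (of_int a) (of_int b)"
        by (auto simp: S_def gball_def elim: gauss_intsE)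
      then show "z \<in> g ` X" using z by (auto simp: g_def X_def)
    qed (auto simp: X_def g_def)
    have finX: "finite X" using finS im inj by (metis (no_types, lifting) finite_imageD finite_subset mem_Collect_eq subsetI)
    have conv: "c \<in> X" if abc: "a \<in> X" "b \<in> X" "a \<le> c" "c \<le> b" for a b c
    proof (cases "a = b")
      case False
      define u where "u = (of_int (c - a) / of_int (b - a) :: real)"
      have ab: "a < b" using abc False by linarith
      then have u: "0 \<le> u" "u \<le> 1" using abc by (auto simp: u_def)
      have "of_int a + u * (of_int b - of_int a) = (of_int c :: real)"
        using ab by (simp add: u_def)
      then have eq: "(1 - u) *\<^sub>R g a + u *\<^sub>R g b = g c"
        by (simp add: g_def complex_eq_iff algebra_simps)
      have "convex (C \<inter> cball 0 R)" using C by (intro convex_Int) auto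
      moreover have "g a \<in> C \<inter> cball 0 R" "g b \<in> C \<inter> cball 0 R"
        using abc by (auto simp: X_def S_def g_def gball_def)
      ultimately have "(1 - u) *\<^sub>R g a + u *\<^sub>R g b \<in> C \<inter> cball 0 R"
        using u unfolding convex_alt by blast
      then show "c \<in> X" unfolding eq by (auto simp: X_def S_def gball_def g_def)
    qed (use abc in auto)
    have "(?row y) = (\<Sum>x\<in>X. ee (g x * b))"
      unfolding im by (simp add: sum.reindex[OF inj])
    also have "\<dots> = (\<Sum>x\<in>X. ec (of_int x * Re b) * cis (- 2 * pi * of_int y * Im b))"
      by (intro sum.cong) (auto simp: ee_def g_def cis_mult algebra_simps)
    also have "\<dots> = (\<Sum>x\<in>X. ec (of_int x * Re b)) * cis (- 2 * pi * of_int y * Im b)"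
      by (simp add: sum_distrib_right)
    finally have "cmod (?row y) = cmod (\<Sum>x\<in>X. ec (of_int x * Re b))"
      by (simp add: norm_mult)
    moreover have "cmod (\<Sum>x\<in>X. ec (of_int x * Re b)) * dint (Re b) \<le> 1/2"
      by (rule geometric_cis_bound[OF finX]) (rule conv)
    ultimately show "cmod (?row y) * dint (Re b) \<le> 1/2"
      by (simp only:)
  qed
  also have "\<dots> = real (card I) / 2" by simp
  also have "\<dots> = (2 * of_int \<lfloor>R\<rfloor> + 1) / 2" using R by (simp add: I_def)
  also have "\<dots> \<le> (2 * R + 1) / 2" by simp
  finally show ?thesis by (simp add: S_def)
qed

text \<open>The sup-norm distance from \<open>b\<close> to the Gaussian integers, see
  \<open>sup_gauss_near\<close>.\<close>

definition nrm :: "complex \<Rightarrow> real" where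
  "nrm b = max (dint (Re b)) (dint (Im b))"

lemma nrm_nonneg [simp]: "0 \<le> nrm b"
  by (simp add: nrm_def le_max_iff_disj)

text \<open>Summing along columns is summing along rows after a rotation by \<open>- \<i>\<close>,
  which replaces \<open>b\<close> by \<open>\<i> * b\<close> and hence \<open>dint (Re b)\<close> by
  \<open>dint (Im b)\<close>. The better of the two bounds yields \<open>nrm b\<close>.\<close>

lemma convex_ee_sum:
  assumes C: "convex C" and R: "0 \<le> R"
  shows "cmod (\<Sum>z\<in>C \<inter> gball R. ee (z * b)) * nrm b \<le> (2 * R + 1) / 2"
    and "cmod (\<Sum>z\<in>C \<inter> gball R. ee (z * b)) \<le> (2 * R + 1)^2"
proof -
  let ?s = "\<Sum>z\<in>C \<inter> gball R. ee (z * b)"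
  define C' where "C' = (*) (- \<i>) ` C"
  have "linear ((*) (- \<i>) :: complex \<Rightarrow> complex)"
    by (simp add: bounded_linear.linear bounded_linear_mult_right)
  then have C': "convex C'"
    unfolding C'_def by (intro convex_linear_image C)
  have bij: "C \<inter> gball R = (*) \<i> ` (C' \<inter> gball R)"
  proof safe
    fix z assume z: "z \<in> C" "z \<in> gball R"
    have "z = \<i> * (- \<i> * z)" by simp
    moreover have "- \<i> * z \<in> C'" "- \<i> * z \<in> gball R"
      using z by (auto simp: C'_def gball_def norm_mult intro!: gauss_ints_mult gauss_ints_minus)
    ultimately show "z \<in> (*) \<i> ` (C' \<inter> gball R)" by blast
  next
    fix w assume w: "w \<in> C'" "w \<in> gball R"
    show "\<i> * w \<in> gball R"
      using w by (auto simp: gball_def norm_mult)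
    show "\<i> * w \<in> C"
      using w by (auto simp: C'_def mult.assoc[symmetric])
  qed
  have "?s = (\<Sum>z\<in>C' \<inter> gball R. ee (z * (\<i> * b)))"
    unfolding bij by (subst sum.reindex) (auto simp: inj_on_def mult_ac)
  moreover have "cmod (\<Sum>z\<in>C' \<inter> gball R. ee (z * (\<i> * b))) * dint (Re (\<i> * b)) \<le> (2 * R + 1) / 2"
    by (rule convex_ee_sum_row[OF C' R])
  ultimately have "cmod ?s * dint (Im b) \<le> (2 * R + 1) / 2"
    by (simp add: dint_minus)
  with convex_ee_sum_row[OF C R, of b]
  show "cmod ?s * nrm b \<le> (2 * R + 1) / 2"
    by (simp add: nrm_def max_def)
  have "cmod ?s \<le> (\<Sum>z\<in>C \<inter> gball R. 1)"
    by (rule order_trans[OF norm_sum]) simp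
  also have "\<dots> \<le> real (card (gball R))" by (simp add: card_mono)
  also have "\<dots> \<le> (2 * R + 1)^2" using R by (rule card_gball)
  finally show "cmod ?s \<le> (2 * R + 1)^2" .
qed

section \<open>Spacing modulo the Gaussian integers\<close>

text \<open>By subtraction this separates \<open>k * \<xi>\<close> and \<open>k' * \<xi>\<close> by
  \<open>s\<close> modulo the Gaussian integers whenever \<open>k\<close> and \<open>k'\<close> are
  distinct and less than \<open>L\<close> apart.\<close>

definition spaced :: "complex \<Rightarrow> real \<Rightarrow> real \<Rightarrow> bool" where
  "spaced \<xi> L s \<longleftrightarrow> (\<forall>k\<in>ZI. k \<noteq> 0 \<longrightarrow> cmod k < L \<longrightarrow> (\<forall>z\<in>ZI. s \<le> cmod (k * \<xi> - z)))"

text \<open>The cell \<open>[a, a + 1)\<close> has distance \<open>absz a\<close> from 0.\<close>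

definition absz :: "int \<Rightarrow> int" where "absz a = (if 0 \<le> a then a else - a - 1)"

lemma absz_nonneg [simp]: "0 \<le> absz a"
  by (simp add: absz_def)

lemma absz_floor_le: "of_int (absz \<lfloor>x\<rfloor>) \<le> \<bar>x\<bar>" for x :: real
  by (auto simp: absz_def) linarith+

abbreviation (input) shell :: "int \<Rightarrow> (int \<times> int) set" where
  "shell j \<equiv> {(a, b). max (absz a) (absz b) = j}"

lemma floor_divide_eq_imp_dist:
  fixes x y r :: real
  assumes "0 < r" "\<lfloor>x / r\<rfloor> = \<lfloor>y / r\<rfloor>"
  shows "\<bar>x - y\<bar> < r"
proof -
  have "\<bar>x / r - y / r\<bar> < 1" using assms(2) by linarith
  then have "\<bar>(x - y) / r\<bar> < 1" by (simp add: diff_divide_distrib)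
  then show ?thesis using assms(1) by (simp add: abs_divide divide_simps)
qed

text \<open>As cells are half-open, \<open>absz a \<le> j\<close> means
  \<open>- j - 1 \<le> a \<le> j\<close>, which is \<open>2 * j + 2\<close> values; the shell is a
  difference of two such squares. For \<open>j = 0\<close> it consists of the four cells that touch
  the origin.\<close>

lemma card_square_shell:
  assumes "0 \<le> j"
  shows "card (shell j) = nat (8 * j + 4)"
    and "finite (shell j)"
proof -
  define I where "I j = {-j - 1..j}" for j :: int
  have absz_le: "absz a \<le> j \<longleftrightarrow> a \<in> I j" for a j
    by (auto simp: absz_def I_def)
  have eq: "shell j = I j \<times> I j - I (j - 1) \<times> I (j - 1)"
  proof -
    have "max (absz a) (absz b) = j \<longleftrightarrow> (a \<in> I j \<and> b \<in> I j) \<and> \<not> (a \<in> I (j - 1) \<and> b \<in> I (j - 1))" for a b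
      unfolding absz_le[symmetric] by linarith
    then show ?thesis by auto
  qed
  have fin: "finite (I j)" for j by (simp add: I_def)
  show "finite (shell j)" unfolding eq using fin by auto
  have "card (I j \<times> I j - I (j - 1) \<times> I (j - 1)) = card (I j \<times> I j) - card (I (j - 1) \<times> I (j - 1))"
    using fin by (intro card_Diff_subset) (auto simp: I_def)
  also have "\<dots> = nat (2 * j + 2) * nat (2 * j + 2) - nat (2 * j) * nat (2 * j)"
    by (simp add: card_cartesian_product I_def algebra_simps)
  also have "\<dots> = nat (8 * j + 4)"
  proof -
    obtain n where "j = int n" using assms by (metis nonneg_int_cases)
    moreover have "nat (2 * int n + 2) = 2 * n + 2" "nat (2 * int n) = 2 * n" "nat (8 * int n + 4) = 8 * n + 4"
      by linarith+
    ultimately show ?thesis by (simp add: algebra_simps)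
  qed
  finally show "card (shell j) = nat (8 * j + 4)" unfolding eq .
qed

text \<open>A square of side \<open>s / 2\<close> contains at most one of the points. For
  \<open>j \<ge> 1\<close> the shell at distance \<open>j * s / 2\<close> has at most
  \<open>12 * j\<close> squares, and there \<open>f\<close> is at most
  \<open>2 * W / (s * j)\<close>. The growth of the shells cancels the decay of \<open>f\<close>,
  each shell costs \<open>24 * W / s\<close>, and the sum is linear in \<open>T\<close>.\<close>

lemma spaced_points_sum:
  fixes v :: "'a \<Rightarrow> complex" and f :: "'a \<Rightarrow> real"
  assumes B: "finite B" "card B \<le> T^2" "1 \<le> T"
    and s: "0 < s" and W: "0 \<le> W" and V: "0 \<le> V"
    and sep: "\<And>k k'. k \<in> B \<Longrightarrow> k' \<in> B \<Longrightarrow> k \<noteq> k' \<Longrightarrow> s \<le> cmod (v k - v k')"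
    and fV: "\<And>k. k \<in> B \<Longrightarrow> f k \<le> V"
    and fW: "\<And>k. k \<in> B \<Longrightarrow> f k * max \<bar>Re (v k)\<bar> \<bar>Im (v k)\<bar> \<le> W"
    and f0: "\<And>k. k \<in> B \<Longrightarrow> 0 \<le> f k"
  shows "sum f B \<le> 4 * V + 26 * W * real T / s"
proof -
  define g where "g k = (\<lfloor>Re (v k) / (s / 2)\<rfloor>, \<lfloor>Im (v k) / (s / 2)\<rfloor>)" for k
  define m where "m k = max (absz (fst (g k))) (absz (snd (g k)))" for k
  have inj: "inj_on g B"
  proof (rule inj_onI, rule ccontr)
    fix k k' assume k: "k \<in> B" "k' \<in> B" "g k = g k'" "k \<noteq> k'"
    then have "\<bar>Re (v k) - Re (v k')\<bar> < s / 2" "\<bar>Im (v k) - Im (v k')\<bar> < s / 2"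
      using s by (intro floor_divide_eq_imp_dist; simp add: g_def)+
    then have "cmod (v k - v k') < s"
      using cmod_le[of "v k - v k'"] by simp
    then show False using sep k by fastforce
  qed
  have m0: "0 \<le> m k" for k by (simp add: m_def le_max_iff_disj)
  have msup: "s / 2 * of_int (m k) \<le> max \<bar>Re (v k)\<bar> \<bar>Im (v k)\<bar>" for k
  proof -
    have *: "s / 2 * of_int (absz \<lfloor>x / (s / 2)\<rfloor>) \<le> \<bar>x\<bar>" for x
      using mult_left_mono[OF absz_floor_le[of "x / (s / 2)"], of "s / 2"] s
      by (simp add: abs_mult)
    show ?thesis using *[of "Re (v k)"] *[of "Im (v k)"]
      by (auto simp: m_def g_def max_def)
  qed
  have fm: "f k \<le> 2 * W / (s * j)" if k: "k \<in> B" "1 \<le> j" "j \<le> real_of_int (m k)" for k j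
  proof -
    have "f k * (s / 2 * j) \<le> f k * max \<bar>Re (v k)\<bar> \<bar>Im (v k)\<bar>"
      using k s f0[of k] msup[of k]
      by (intro mult_left_mono order_trans[OF _ msup]) auto
    also have "\<dots> \<le> W" using k fW by blast
    finally show ?thesis using s k by (simp add: field_simps)
  qed
  \<comment> \<open>Shell 0 is left to the trivial bound \<open>V\<close>. Beyond shell
    \<open>T\<close> the at most \<open>T^2\<close> remaining points are taken together, with the
    bound for \<open>f\<close> at shell \<open>T\<close>.\<close>
  define B0 B1 B2 where "B0 = {k \<in> B. m k = 0}" and "B1 = {k \<in> B. m k \<in> {1..int T}}"
    and "B2 = {k \<in> B. int T < m k}"
  have fin: "finite B0" "finite B1" "finite B2" using B by (auto simp: B0_def B1_def B2_def)
  have "m k = 0 \<or> m k \<in> {1..int T} \<or> int T < m k" for k using m0[of k] by auto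
  then have "B = B0 \<union> (B1 \<union> B2)" by (auto simp: B0_def B1_def B2_def)
  moreover have "B0 \<inter> (B1 \<union> B2) = {}" "B1 \<inter> B2 = {}" by (auto simp: B0_def B1_def B2_def)
  ultimately have split: "sum f B = sum f B0 + (sum f B1 + sum f B2)"
    using fin by (simp add: sum.union_disjoint)
  have shell_le: "real (card {k \<in> B. m k = j}) \<le> 8 * j + 4" if j: "0 \<le> j" for j
  proof -
    have "card {k \<in> B. m k = j} = card (g ` {k \<in> B. m k = j})"
      using inj by (intro card_image[symmetric]) (auto simp: inj_on_def)
    also have "\<dots> \<le> card (shell j)"
      using j by (intro card_mono card_square_shell image_subsetI) (auto simp: m_def case_prod_beta)
    also have "\<dots> = nat (8 * j + 4)" by (rule card_square_shell[OF j])
    finally have "int (card {k \<in> B. m k = j}) \<le> 8 * j + 4" using j by (subst (asm) le_nat_iff) auto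
    then show ?thesis by linarith
  qed
  have "card B0 \<le> 4" using shell_le[of 0] by (simp add: B0_def)
  then have "sum f B0 \<le> 4 * V"
    using sum_bounded_above[of B0 f V] fV V by (auto simp: B0_def intro: order_trans[OF _ mult_right_mono])
  moreover have "sum f B1 \<le> 24 * W * real T / s"
  proof -
    have "sum f B1 = (\<Sum>j\<in>{1..int T}. \<Sum>k\<in>{k \<in> B1. m k = j}. f k)"
      using fin by (intro sum.group[symmetric]) (auto simp: B1_def)
    also have "\<dots> \<le> (\<Sum>j\<in>{1..int T}. 24 * W / s)"
    proof (rule sum_mono)
      fix j assume j: "j \<in> {1..int T}"
      have "{k \<in> B1. m k = j} = {k \<in> B. m k = j}" using j by (auto simp: B1_def)
      then have cd: "real (card {k \<in> B1. m k = j}) \<le> 12 * j" using shell_le[of j] j by simp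
      have "(\<Sum>k\<in>{k \<in> B1. m k = j}. f k) \<le> real (card {k \<in> B1. m k = j}) * (2 * W / (s * j))"
        using j by (intro sum_bounded_above fm) (auto simp: B1_def)
      also have "\<dots> \<le> (12 * j) * (2 * W / (s * j))"
        using cd j s W by (intro mult_right_mono) auto
      also have "\<dots> = 24 * W / s" using j by (simp add: field_simps)
      finally show "(\<Sum>k\<in>{k \<in> B1. m k = j}. f k) \<le> 24 * W / s" .
    qed
    finally show ?thesis by (simp add: mult_ac)
  qed
  moreover have "sum f B2 \<le> 2 * W * real T / s"
  proof -
    have "card B2 \<le> card B" using B by (intro card_mono) (auto simp: B2_def)
    then have c: "real (card B2) \<le> (real T)^2" using B(2) by (metis of_nat_le_iff of_nat_power order_trans)
    have "sum f B2 \<le> real (card B2) * (2 * W / (s * real T))"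
      using B by (intro sum_bounded_above fm) (auto simp: B2_def)
    also have "\<dots> \<le> (real T)^2 * (2 * W / (s * real T))"
      using c s W B by (intro mult_right_mono) auto
    also have "\<dots> = 2 * W * real T / s" using B s by (simp add: power2_eq_square)
    finally show ?thesis .
  qed
  ultimately have "sum f B \<le> 4 * V + (24 * W * real T / s + 2 * W * real T / s)"
    unfolding split by linarith
  also have "24 * W * real T / s + 2 * W * real T / s = 26 * W * real T / s"
    by (simp add: add_divide_distrib[symmetric])
  finally show ?thesis .
qed

lemma sup_gauss_near: "max \<bar>Re (b - gauss_near b)\<bar> \<bar>Im (b - gauss_near b)\<bar> = nrm b"
  by (simp add: nrm_def dint_def gauss_near_def)

lemma cmod_le_sup: "cmod v \<le> 2 * max \<bar>Re v\<bar> \<bar>Im v\<bar>"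
  using cmod_le[of v] by linarith

text \<open>The ball is cut into squares so small that two points of one square differ by less than
  \<open>L\<close>; the separation then holds inside each square, and
  \<open>spaced_points_sum\<close> bounds its share.\<close>

lemma spaced_block_sum:
  fixes f :: "complex \<Rightarrow> real"
  assumes sp: "spaced \<xi> L s" and s: "0 < s" and L: "2 \<le> L" and K: "0 \<le> K"
    and W: "0 \<le> W" and V: "0 \<le> V"
    and X: "X \<subseteq> gball K"
    and fV: "\<And>k. k \<in> X \<Longrightarrow> f k \<le> V"
    and fW: "\<And>k. k \<in> X \<Longrightarrow> f k * nrm (k * \<xi>) \<le> W"
    and f0: "\<And>k. k \<in> X \<Longrightarrow> 0 \<le> f k"
  shows "sum f X \<le> (8 * K / L + 2)^2 * (4 * V + 13 * W * L / s)"
proof -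
  \<comment> \<open>An integral side bounds the lattice points of a square by \<open>l^2\<close>.
    Half of \<open>L\<close> leaves room for the diagonal \<open>sqrt 2 * l\<close>, and
    \<open>2 \<le> L\<close> gives \<open>1 \<le> l\<close>.\<close>
  define l where "l = \<lfloor>L / 2\<rfloor>"
  have l: "1 \<le> l" "of_int l \<le> L / 2" using L unfolding l_def by linarith+
  then have "1 \<le> real_of_int l" "L / 2 < of_int l + 1" unfolding l_def by linarith+
  then have l4: "L / 4 \<le> of_int l" by linarith
  define h where "h k = (\<lfloor>Re k / of_int l\<rfloor>, \<lfloor>Im k / of_int l\<rfloor>)" for k
  define I where "I = {\<lfloor>- K / of_int l\<rfloor>..\<lfloor>K / of_int l\<rfloor>}"
  have finX: "finite X" using X finite_gball finite_subset by blast
  have hI: "h ` X \<subseteq> I \<times> I"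
  proof safe
    fix a b k assume "(a, b) = h k" "k \<in> X"
    then have "\<bar>Re k\<bar> \<le> K" "\<bar>Im k\<bar> \<le> K"
      using X abs_Re_le_cmod[of k] abs_Im_le_cmod[of k] by (auto simp: gball_def)
    then have "- K \<le> Re k" "Re k \<le> K" "- K \<le> Im k" "Im k \<le> K" by linarith+
    then have "- K / of_int l \<le> Re k / of_int l" "Re k / of_int l \<le> K / of_int l"
      "- K / of_int l \<le> Im k / of_int l" "Im k / of_int l \<le> K / of_int l"
      using l(1) by (intro divide_right_mono; simp)+
    then show "a \<in> I" "b \<in> I"
      using \<open>(a, b) = h k\<close> by (auto simp: h_def I_def intro!: floor_mono)
  qed
  have "sum f X = (\<Sum>w\<in>I \<times> I. \<Sum>k\<in>{k \<in> X. h k = w}. f k)"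
    using finX hI by (intro sum.group[symmetric]) (auto simp: I_def)
  also have "\<dots> \<le> (\<Sum>w\<in>I \<times> I. 4 * V + 13 * W * L / s)"
  proof (rule sum_mono)
    fix w
    define B where "B = {k \<in> X. h k = w}"
    define v where "v k = k * \<xi> - gauss_near (k * \<xi>)" for k
    have v: "max \<bar>Re (v k)\<bar> \<bar>Im (v k)\<bar> = nrm (k * \<xi>)" for k
      unfolding v_def by (rule sup_gauss_near)
    have BG: "B \<subseteq> ZI" using X by (auto simp: B_def gball_def)
    have near: "\<bar>Re k - Re k'\<bar> < of_int l \<and> \<bar>Im k - Im k'\<bar> < of_int l" if "k \<in> B" "k' \<in> B" for k k'
    proof -
      show ?thesis using that l(1) by (auto simp: B_def h_def intro!: floor_divide_eq_imp_dist)
    qed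
    have "card B \<le> (nat l)^2"
    proof (cases "B = {}")
      case False
      define r where "r k = (\<lfloor>Re k\<rfloor> - l * fst w, \<lfloor>Im k\<rfloor> - l * snd w)" for k
      have "inj_on r B"
      proof (rule inj_onI)
        fix x y assume "x \<in> B" "y \<in> B" "r x = r y"
        moreover obtain a b :: int where "x = Complex (of_int a) (of_int b)" using BG \<open>x \<in> B\<close> gauss_intsE by blast
        moreover obtain c d :: int where "y = Complex (of_int c) (of_int d)" using BG \<open>y \<in> B\<close> gauss_intsE by blast
        ultimately show "x = y" by (simp add: r_def)
      qed
      moreover have "r ` B \<subseteq> {0..<l} \<times> {0..<l}"
      proof (rule image_subsetI)
        fix x assume x: "x \<in> B"
        obtain a b :: int where ab: "x = Complex (of_int a) (of_int b)" using BG x gauss_intsE by blast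
        have "\<lfloor>real_of_int a / of_int l\<rfloor> = fst w" "\<lfloor>real_of_int b / of_int l\<rfloor> = snd w"
          using x by (auto simp: B_def h_def ab)
        then have "a div l = fst w" "b div l = snd w" by (simp_all add: floor_divide_of_int_eq)
        then show "r x \<in> {0..<l} \<times> {0..<l}"
          using l(1) pos_mod_bound[of l a] pos_mod_bound[of l b] pos_mod_sign[of l a] pos_mod_sign[of l b]
            minus_mult_div_eq_mod[of a l] minus_mult_div_eq_mod[of b l]
          by (auto simp: r_def ab)
      qed
      ultimately have "card B \<le> card ({0..<l} \<times> {0..<l})" by (intro card_inj_on_le) auto
      then show ?thesis by (simp add: card_cartesian_product power2_eq_square)
    qed simp
    then have "sum f B \<le> 4 * V + 26 * W * real (nat l) / s"
    proof (rule spaced_points_sum[where v = v, rotated])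
      fix k k' assume k: "k \<in> B" "k' \<in> B" "k \<noteq> k'"
      have "(cmod (k - k'))^2 = \<bar>Re k - Re k'\<bar>^2 + \<bar>Im k - Im k'\<bar>^2" by (simp add: cmod_power2)
      also have "\<dots> < (of_int l)^2 + (of_int l)^2"
        using near[OF k(1,2)] by (intro add_strict_mono power_strict_mono) auto
      also have "\<dots> \<le> (L / 2)^2 + (L / 2)^2"
        using l by (intro add_mono power_mono) auto
      also have "\<dots> \<le> L^2" by (simp add: power2_eq_square)
      finally have "cmod (k - k') < L" by (rule power2_less_imp_less) (use L in auto)
      moreover have "k - k' \<in> ZI" using k BG by blast
      moreover have "gauss_near (k * \<xi>) - gauss_near (k' * \<xi>) \<in> ZI"
        by (intro gauss_ints_diff) auto
      ultimately have "s \<le> cmod ((k - k') * \<xi> - (gauss_near (k * \<xi>) - gauss_near (k' * \<xi>)))"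
        using sp k unfolding spaced_def by auto
      also have "(k - k') * \<xi> - (gauss_near (k * \<xi>) - gauss_near (k' * \<xi>)) = v k - v k'"
        by (simp add: v_def algebra_simps)
      finally show "s \<le> cmod (v k - v k')" .
    qed (use finX l W V s fV fW f0 v in \<open>auto simp: B_def\<close>)
    also have "26 * W * real (nat l) / s \<le> 26 * W * (L / 2) / s"
      using l s W by (intro divide_right_mono mult_left_mono) auto
    finally show "(\<Sum>k\<in>{k \<in> X. h k = w}. f k) \<le> 4 * V + 13 * W * L / s" by (simp add: B_def mult_ac)
  qed
  also have "\<dots> = (real (card I))^2 * (4 * V + 13 * W * L / s)"
    by (simp add: card_cartesian_product power2_eq_square)
  also have "\<dots> \<le> (8 * K / L + 2)^2 * (4 * V + 13 * W * L / s)"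
  proof (intro mult_right_mono power_mono)
    have "K / of_int l \<le> K / (L / 4)" using l l4 L K by (intro divide_left_mono) auto
    then have "2 * (K / of_int l) \<le> 8 * K / L" by simp
    moreover have "\<lfloor>- K / of_int l\<rfloor> \<le> \<lfloor>K / of_int l\<rfloor>" using K l by (intro floor_mono divide_right_mono) auto
    then have "real (card I) = of_int (\<lfloor>K / of_int l\<rfloor> - \<lfloor>- K / of_int l\<rfloor> + 1)"
      by (simp add: I_def)
    moreover have "of_int (\<lfloor>K / of_int l\<rfloor> - \<lfloor>- K / of_int l\<rfloor> + 1) \<le> 2 * (K / of_int l) + 2"
      by (simp) linarith
    ultimately show "real (card I) \<le> 8 * K / L + 2" by linarith
  qed (use V W L s in auto)
  finally show ?thesis .
qed

text \<open>The gain over \<open>spaced_block_sum\<close> is the factor \<open>(K / L)^2\<close> at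
  the trivial bound \<open>V\<close>. If \<open>L \<le> K\<close>, this is the number of squares up
  to a constant. If \<open>K < L\<close>, every \<open>k\<close> is nonzero and shorter than
  \<open>L\<close>, so \<open>k * \<xi>\<close> stays \<open>s\<close> away from the Gaussian
  integers and \<open>2 * W / s\<close> replaces \<open>V\<close>.\<close>

lemma spaced_sum_nonzero:
  fixes f :: "complex \<Rightarrow> real"
  assumes sp: "spaced \<xi> L s" and s: "0 < s" and L: "2 \<le> L" and K: "0 \<le> K"
    and W: "0 \<le> W" and V: "0 \<le> V"
    and X: "X \<subseteq> gball K - {0}"
    and fV: "\<And>k. k \<in> X \<Longrightarrow> f k \<le> V"
    and fW: "\<And>k. k \<in> X \<Longrightarrow> f k * nrm (k * \<xi>) \<le> W"
    and f0: "\<And>k. k \<in> X \<Longrightarrow> 0 \<le> f k"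
  shows "sum f X \<le> 400 * (K / L)^2 * V + 1700 * (K / L + 1)^2 * (W * L / s)"
proof -
  have X': "X \<subseteq> gball K" using X by auto
  have WL: "0 \<le> W * L / s" using W L s by simp
  show ?thesis
  proof (cases "K < L")
    case False
    have "sum f X \<le> (8 * K / L + 2)^2 * (4 * V + 13 * W * L / s)"
      by (rule spaced_block_sum[OF sp s L K W V X' fV fW f0])
    also have "\<dots> \<le> (10 * (K / L))^2 * (4 * V + 13 * W * L / s)"
      using False L K V W s by (intro mult_right_mono power_mono) (auto simp: field_simps)
    also have "\<dots> = 400 * (K / L)^2 * V + 1300 * (K / L)^2 * (W * L / s)"
      by (simp add: power2_eq_square algebra_simps)
    also have "1300 * (K / L)^2 * (W * L / s) \<le> 1700 * (K / L + 1)^2 * (W * L / s)"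
      using WL K L by (intro mult_right_mono mult_mono power_mono) auto
    finally show ?thesis by simp
  next
    case True
    have fs: "f k \<le> 2 * W / s" if k: "k \<in> X" for k
    proof -
      have "k \<in> ZI" "k \<noteq> 0" "cmod k < L" using k X True by (auto simp: gball_def)
      then have "s \<le> cmod (k * \<xi> - gauss_near (k * \<xi>))"
        using sp unfolding spaced_def by simp
      also have "\<dots> \<le> 2 * nrm (k * \<xi>)" using cmod_le_sup sup_gauss_near by metis
      finally have "s \<le> 2 * nrm (k * \<xi>)" .
      then have "f k * s \<le> f k * (2 * nrm (k * \<xi>))" using f0 k by (intro mult_left_mono) auto
      also have "\<dots> \<le> 2 * W" using fW[OF k] by simp
      finally show ?thesis using s by (simp add: field_simps)
    qed
    have 1: "sum f X \<le> (8 * K / L + 2)^2 * (4 * (2 * W / s) + 13 * W * L / s)"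
      by (rule spaced_block_sum[OF sp s L K W _ X' fs fW f0]) (use W s in auto)
    define q where "q = K / L"
    define e where "e = W * L / s"
    have "W * 2 / s \<le> W * L / s" using W L s by (intro divide_right_mono mult_left_mono) auto
    then have e: "2 * W / s \<le> e" "0 \<le> e" "13 * W * L / s = 13 * e"
      using W L s by (auto simp: e_def mult.commute)
    have q: "0 \<le> q" "8 * K / L = 8 * q" using K L by (auto simp: q_def)
    have "(8 * q + 2)^2 * (4 * (2 * W / s) + 13 * e) \<le> (10 * (q + 1))^2 * (17 * e)"
    proof (rule mult_mono)
      show "(8 * q + 2)^2 \<le> (10 * (q + 1))^2" using q(1) by (intro power_mono) auto
      show "4 * (2 * W / s) + 13 * e \<le> 17 * e" using e(1) by linarith
      show "0 \<le> 4 * (2 * W / s) + 13 * e" using e(2) W s by simp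
    qed simp
    then have 2: "(8 * K / L + 2)^2 * (4 * (2 * W / s) + 13 * W * L / s) \<le> (10 * (K / L + 1))^2 * (17 * (W * L / s))"
      unfolding q(2) e(3) e_def q_def .
    note 1
    also note 2
    also have "\<dots> = 1700 * (K / L + 1)^2 * (W * L / s)"
      unfolding power_mult_distrib by simp
    also have "\<dots> \<le> 400 * (K / L)^2 * V + 1700 * (K / L + 1)^2 * (W * L / s)" using V by simp
    finally show ?thesis .
  qed
qed

section \<open>Moduli from Diophantine approximation\<close>

text \<open>Compactness plays the part of the pigeonhole principle: the bounded remainders of
  \<open>n * c\<close> have a Cauchy subsequence, and two close remainders are subtracted.\<close>

lemma close_multiples:
  assumes "0 < \<rho>"
  obtains q a where "q \<in> ZI" "a \<in> ZI" "q \<noteq> 0" "cmod (q * c - a) < \<rho>"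
proof -
  define r where "r n = gauss_near (of_nat n * c)" for n :: nat
  have r: "r n \<in> ZI" "cmod (of_nat n * c - r n) < 1" for n
    using gauss_near_dist by (auto simp: r_def)
  define u where "u n = of_nat n * c - r n" for n
  have "\<forall>n. u n \<in> cball 0 1" using r by (simp add: u_def less_imp_le)
  then obtain l s where s: "strict_mono s" "(u \<circ> s) \<longlonglongrightarrow> l"
    using compact_imp_seq_compact[of "cball 0 1 :: complex set"] unfolding seq_compact_def by force
  then have "Cauchy (u \<circ> s)" by (intro LIMSEQ_imp_Cauchy)
  then obtain M where M: "\<And>m n. M \<le> m \<Longrightarrow> M \<le> n \<Longrightarrow> dist ((u \<circ> s) m) ((u \<circ> s) n) < \<rho>"
    using assms unfolding Cauchy_def by metis
  define q where "q = (of_nat (s (Suc M)) - of_nat (s M) :: complex)"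
  define a where "a = r (s (Suc M)) - r (s M)"
  have "s M < s (Suc M)" using s by (simp add: strict_mono_def)
  then have "q \<noteq> 0" by (simp add: q_def)
  moreover have "q \<in> ZI" by (auto simp: q_def gauss_ints_def)
  moreover have "a \<in> ZI" using r by (auto simp: a_def)
  moreover have "q * c - a = u (s (Suc M)) - u (s M)"
    by (simp add: q_def a_def u_def algebra_simps)
  then have "cmod (q * c - a) < \<rho>" using M[of "Suc M" M] by (simp add: dist_norm)
  ultimately show thesis using that by blast
qed

lemma gauss_ratio_rational:
  assumes "j \<in> ZI" "z \<in> ZI" "j \<noteq> 0" "j * c = z"
  shows "Re c \<in> \<rat> \<and> Im c \<in> \<rat>"
proof -
  obtain n where n: "(cmod j)^2 = real n" using assms(1) by (rule gauss_ints_norm_sq)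
  have "of_real (real n) * c = z * cnj j"
    unfolding n[symmetric] complex_norm_square using assms(4) by (simp add: mult_ac)
  then have "Re (of_real (real n) * c) = Re (z * cnj j)" "Im (of_real (real n) * c) = Im (z * cnj j)"
    by simp_all
  moreover have "Re (z * cnj j) \<in> \<int>" "Im (z * cnj j) \<in> \<int>"
    using gauss_ints_mult[OF assms(2) gauss_ints_cnj[OF assms(1)]] unfolding gauss_ints_def by blast+
  ultimately have *: "real n * Re c \<in> \<int>" "real n * Im c \<in> \<int>" by simp_all
  have "real n \<noteq> 0" using n assms(3) by (metis norm_eq_zero power_eq_0_iff)
  moreover have "real n * Re c / real n \<in> \<rat>" "real n * Im c / real n \<in> \<rat>"
    using * Ints_subset_Rats by (intro Rats_divide; auto)+
  ultimately show ?thesis by simp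
qed

lemma gauss_near_minimal:
  assumes "z \<in> ZI"
  shows "cmod (w - gauss_near w) \<le> cmod (w - z)"
proof -
  obtain x y :: int where z: "z = Complex (of_int x) (of_int y)" using assms by (rule gauss_intsE)
  have "\<bar>Re (w - gauss_near w)\<bar> \<le> \<bar>Re (w - z)\<bar>" "\<bar>Im (w - gauss_near w)\<bar> \<le> \<bar>Im (w - z)\<bar>"
    using round_diff_minimal[of "Re w" x] round_diff_minimal[of "Im w" y] by (auto simp: gauss_near_def z)
  then have "(cmod (w - gauss_near w))^2 \<le> (cmod (w - z))^2"
    unfolding cmod_power2 by (intro add_mono) (simp_all only: abs_le_square_iff)
  then show ?thesis by (rule power2_le_imp_le) simp
qed

text \<open>Let \<open>\<rho>\<close> be the best error among multipliers up to
  \<open>B + 1\<close>, attained at \<open>j0\<close>, and \<open>q\<close> a shortest multiplier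
  that improves on it. Multipliers shorter than \<open>q\<close> have error at least
  \<open>\<rho>\<close>. The determinant of the approximations for \<open>j0\<close> and
  \<open>q\<close> is a nonzero Gaussian integer of modulus at most \<open>2 * |q| * \<rho>\<close>,
  so \<open>\<rho> \<ge> 1 / (2 * |q|)\<close>, and \<open>N = |q|^2\<close>.\<close>

lemma badly_approximated_range:
  assumes c: "\<not> (Re c \<in> \<rat> \<and> Im c \<in> \<rat>)"
  obtains N :: nat where "B \<le> N" "\<And>j z. j \<in> ZI \<Longrightarrow> j \<noteq> 0 \<Longrightarrow> (cmod j)^2 < real N \<Longrightarrow>
    z \<in> ZI \<Longrightarrow> 1 / (2 * sqrt (real N)) \<le> cmod (j * c - z)"
proof -
  define D where "D j = cmod (j * c - gauss_near (j * c))" for j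
  have D_le: "D j \<le> cmod (j * c - z)" if "z \<in> ZI" for j z
    unfolding D_def using that by (rule gauss_near_minimal)
  \<comment> \<open>The summand 1 keeps a nonzero multiplier in the ball when
    \<open>B = 0\<close>.\<close>
  define B' where "B' = real B + 1"
  have fin: "finite (D ` (gball B' - {0}))" "1 \<in> gball B' - {0}" by simp (simp add: gball_def B'_def)
  define \<rho> where "\<rho> = Min (D ` (gball B' - {0}))"
  have "\<rho> \<in> D ` (gball B' - {0})" unfolding \<rho>_def using fin by (intro Min_in) auto
  then obtain j0 where j0: "j0 \<in> ZI" "j0 \<noteq> 0" "cmod j0 \<le> B'" "\<rho> = D j0"
    by (auto simp: gball_def)
  have \<rho>B: "\<rho> \<le> D j" if "j \<in> ZI" "j \<noteq> 0" "cmod j \<le> B'" for j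
    unfolding \<rho>_def using fin that by (intro Min_le) (auto simp: gball_def)
  have "j0 * c \<noteq> gauss_near (j0 * c)"
    using gauss_ratio_rational[OF j0(1) gauss_near_int j0(2)] c by blast
  then have "\<rho> > 0" by (simp add: j0(4) D_def)
  define A where "A = {q \<in> ZI. q \<noteq> 0 \<and> D q < \<rho>}"
  obtain q' a' where "q' \<in> ZI" "a' \<in> ZI" "q' \<noteq> 0" "cmod (q' * c - a') < \<rho>"
    using \<open>\<rho> > 0\<close> by (rule close_multiples)
  then have "q' \<in> A" using D_le[of a' q'] by (simp add: A_def)
  then have A: "A \<subseteq> ZI" "A \<noteq> {}" by (auto simp: A_def)
  obtain q where "q \<in> A" and q_min: "\<And>z. z \<in> A \<Longrightarrow> cmod q \<le> cmod z"
    using gauss_ints_norm_minimum[OF A] by blast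
  then have q: "q \<in> ZI" "q \<noteq> 0" "D q < \<rho>" by (auto simp: A_def)
  obtain N where N: "(cmod q)^2 = real N" using q(1) by (rule gauss_ints_norm_sq)
  have sqN: "cmod q = sqrt (real N)" using N by (metis norm_ge_zero real_sqrt_abs2 real_sqrt_unique)
  have qB: "B' < cmod q" using \<rho>B[of q] q by (meson not_le)
  have "real B \<le> B'^2" by (simp add: B'_def power2_eq_square algebra_simps)
  also have "\<dots> \<le> (cmod q)^2" using qB by (intro power_mono) (auto simp: B'_def)
  finally have BN: "B \<le> N" using N by simp
  define z0 a where "z0 = gauss_near (j0 * c)" and "a = gauss_near (q * c)"
  define x where "x = j0 * a - q * z0"
  \<comment> \<open>Vanishing would make the two errors proportional to \<open>|j0|\<close> and
    \<open>|q|\<close>, but the longer multiplier \<open>q\<close> has the smaller error.\<close>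
  have "x \<noteq> 0"
  proof
    assume "x = 0"
    then have "j0 * (q * c - a) = q * (j0 * c - z0)"
      by (simp add: x_def algebra_simps)
    then have "cmod j0 * D q = cmod q * \<rho>" unfolding D_def j0(4) z0_def a_def by (metis norm_mult)
    moreover have "cmod j0 * D q < cmod q * \<rho>"
      using j0 q qB \<open>\<rho> > 0\<close> by (intro mult_le_less_imp_less) (auto simp: D_def)
    ultimately show False by simp
  qed
  moreover have "x \<in> ZI"
    unfolding x_def z0_def a_def by (rule gauss_ints_diff[OF gauss_ints_mult[OF j0(1) gauss_near_int] gauss_ints_mult[OF q(1) gauss_near_int]])
  ultimately have "1 \<le> cmod x" by (intro gauss_ints_norm_ge_1)
  also have "x = q * (j0 * c - z0) - j0 * (q * c - a)"
    by (simp add: x_def algebra_simps)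
  also have "cmod \<dots> \<le> cmod q * \<rho> + cmod j0 * D q"
    unfolding D_def j0(4) norm_mult[symmetric] z0_def a_def by (rule norm_triangle_ineq4)
  also have "cmod j0 * D q \<le> cmod q * \<rho>"
    using j0 q qB by (intro mult_mono) (auto simp: D_def)
  finally have "1 \<le> 2 * cmod q * \<rho>" by (simp add: mult_ac)
  then have \<rho>N: "1 / (2 * sqrt (real N)) \<le> \<rho>"
    using q(2) unfolding sqN[symmetric] by (simp add: field_simps)
  show thesis
  proof (rule that[OF BN])
    fix j z assume j: "j \<in> ZI" "j \<noteq> 0" "(cmod j)^2 < real N" "z \<in> ZI"
    then have "cmod j < cmod q" using N by (metis norm_ge_zero power2_less_imp_less)
    then have "j \<notin> A" using q_min by fastforce
    then have "\<rho> \<le> D j" using j by (auto simp: A_def not_less)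
    then show "1 / (2 * sqrt (real N)) \<le> cmod (j * c - z)" using \<rho>N D_le[OF j(4), of j] by linarith
  qed
qed

section \<open>Sieve identity and separation of variables\<close>

text \<open>The sets whose product exceeds \<open>Y\<close> only because of their element of least index. In the
  alternating sum over all subsets of \<open>S\<close>, adding or removing the element of \<open>S\<close> of least index
  cancels all other sets.\<close>

definition crit :: "('a \<Rightarrow> nat) \<Rightarrow> ('a \<Rightarrow> real) \<Rightarrow> real \<Rightarrow> 'a set \<Rightarrow> bool" where
  "crit idx w Y A \<longleftrightarrow> (\<exists>p\<in>A. (\<forall>x\<in>A. idx p \<le> idx x) \<and> Y < prod w A \<and> prod w (A - {p}) \<le> Y)"

lemma sieve_identity:
  fixes w :: "'a \<Rightarrow> real"
  assumes S: "finite S" "inj_on idx S" and w: "\<And>p. p \<in> S \<Longrightarrow> 1 \<le> w p" and Y: "1 \<le> Y"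
  shows "(if S = {} then 1 else 0 :: complex) =
    (\<Sum>A\<in>{A \<in> Pow S. prod w A \<le> Y}. (-1) ^ card A) +
    (\<Sum>A\<in>{A \<in> Pow S. crit idx w Y A \<and> (\<forall>p\<in>S. Min (idx ` A) \<le> idx p)}. (-1) ^ card A)"
proof (cases "S = {}")
  case True
  have "{A \<in> Pow S. prod w A \<le> Y} = {{}}" using True Y by auto
  moreover have "{A \<in> Pow S. crit idx w Y A \<and> (\<forall>p\<in>S. Min (idx ` A) \<le> idx p)} = {}"
    using True by (auto simp: crit_def)
  ultimately show ?thesis using True by simp
next
  case False
  define p0 where "p0 = arg_min_on idx S"
  have p0: "p0 \<in> S" "\<And>x. x \<in> S \<Longrightarrow> idx p0 \<le> idx x"
    unfolding p0_def using arg_min_if_finite[OF S(1) False, of idx] by (auto simp: not_less)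
  define S' where "S' = S - {p0}"
  have S': "finite S'" "p0 \<notin> S'" "S = insert p0 S'" "S' \<subseteq> S" using S p0 by (auto simp: S'_def)
  have finA: "finite A" if "A \<subseteq> S'" for A using that S' finite_subset by blast
  have W: "prod w (insert p0 A) = w p0 * prod w A" if "A \<subseteq> S'" for A
    using that finA[OF that] S' by (subst prod.insert) auto
  have Cd: "card (insert p0 A) = Suc (card A)" if "A \<subseteq> S'" for A
    using that finA[OF that] S' by (subst card_insert_disjoint) auto
  have Wmono: "prod w A \<le> prod w (insert p0 A)" if A: "A \<subseteq> S'" for A
  proof -
    have "0 \<le> prod w A" using A w S' by (intro prod_nonneg ballI order_trans[OF zero_le_one w]) auto
    then have "1 * prod w A \<le> w p0 * prod w A" using w p0 by (intro mult_right_mono) auto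
    then show ?thesis using W[OF A] by simp
  qed
  have inj: "inj_on (insert p0) X" if "X \<subseteq> Pow S'" for X
  proof (rule inj_onI)
    fix A B assume "A \<in> X" "B \<in> X" "insert p0 A = insert p0 B"
    moreover have "p0 \<notin> A" "p0 \<notin> B" using that S'(2) calculation(1,2) by auto
    ultimately show "A = B" by (metis insert_ident)
  qed
  have e1: "{A \<in> Pow S. prod w A \<le> Y} = {A \<in> Pow S'. prod w A \<le> Y} \<union>
    insert p0 ` {A \<in> Pow S'. prod w (insert p0 A) \<le> Y}"
    unfolding S'(3) Pow_insert by auto
  \<comment> \<open>The condition on \<open>Min\<close> forces the least element of \<open>A\<close>
    to be \<open>p0\<close>. The critical sets therefore belong to those pairs \<open>A'\<close>,
    \<open>insert p0 A'\<close> of which only \<open>A'\<close> has product at most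
    \<open>Y\<close>, that is, to the pairs that do not cancel in the first sum.\<close>
  have e2: "{A \<in> Pow S. crit idx w Y A \<and> (\<forall>p\<in>S. Min (idx ` A) \<le> idx p)} =
     insert p0 ` {A \<in> Pow S'. prod w A \<le> Y \<and> Y < prod w (insert p0 A)}" (is "?L = ?R")
  proof (intro set_eqI iffI)
    fix A assume "A \<in> ?L"
    then have A: "A \<subseteq> S" "crit idx w Y A" "Min (idx ` A) \<le> idx p0" using p0 by auto
    then obtain p where p: "p \<in> A" "\<And>x. x \<in> A \<Longrightarrow> idx p \<le> idx x" "Y < prod w A" "prod w (A - {p}) \<le> Y"
      by (auto simp: crit_def)
    have "finite A" using A S finite_subset by blast
    then have "Min (idx ` A) = idx p" using p by (intro Min_eqI) auto
    then have "idx p = idx p0" using A p p0(2)[of p] by auto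
    then have "p = p0" using S(2) A p p0 by (auto simp: inj_on_def)
    then have "A = insert p0 (A - {p0})" "A - {p0} \<in> Pow S'" using p A by (auto simp: S'_def)
    then show "A \<in> ?R" using p \<open>p = p0\<close> by (intro image_eqI[of _ _ "A - {p0}"]) auto
  next
    fix A assume "A \<in> ?R"
    then obtain A' where A': "A' \<subseteq> S'" "prod w A' \<le> Y" "Y < prod w (insert p0 A')" "A = insert p0 A'"
      by auto
    have sub: "A \<subseteq> S" using A' S' by auto
    have "Min (idx ` A) = idx p0" using finA[OF A'(1)] sub A' p0 by (intro Min_eqI) auto
    moreover have "A - {p0} = A'" using A' S' by auto
    ultimately show "A \<in> ?L" using A' sub p0 unfolding crit_def by auto
  qed
  define g where "g A = ((-1) ^ card A :: complex)" for A :: "'a set"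
  have fin: "finite {A \<in> Pow S'. Q A}" for Q using S' by auto
  have gi: "sum g (insert p0 ` {A \<in> Pow S'. Q A}) = - sum g {A \<in> Pow S'. Q A}" for Q
  proof -
    have "sum g (insert p0 ` {A \<in> Pow S'. Q A}) = (\<Sum>A\<in>{A \<in> Pow S'. Q A}. g (insert p0 A))"
      by (subst sum.reindex) (auto intro!: inj)
    also have "\<dots> = (\<Sum>A\<in>{A \<in> Pow S'. Q A}. - g A)"
      by (intro sum.cong) (auto simp: g_def Cd)
    finally show ?thesis by (simp add: sum_negf)
  qed
  have "sum g {A \<in> Pow S. prod w A \<le> Y} + sum g {A \<in> Pow S. crit idx w Y A \<and> (\<forall>p\<in>S. Min (idx ` A) \<le> idx p)}
    = sum g {A \<in> Pow S'. prod w A \<le> Y} - sum g {A \<in> Pow S'. prod w (insert p0 A) \<le> Y}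
      - sum g {A \<in> Pow S'. prod w A \<le> Y \<and> Y < prod w (insert p0 A)}"
  proof -
    have "sum g {A \<in> Pow S. prod w A \<le> Y} = sum g {A \<in> Pow S'. prod w A \<le> Y} +
      sum g (insert p0 ` {A \<in> Pow S'. prod w (insert p0 A) \<le> Y})"
      unfolding e1 using fin S' by (intro sum.union_disjoint) auto
    then show ?thesis unfolding e2 gi by simp
  qed
  also have "{A \<in> Pow S'. prod w A \<le> Y} = {A \<in> Pow S'. prod w (insert p0 A) \<le> Y} \<union>
     {A \<in> Pow S'. prod w A \<le> Y \<and> Y < prod w (insert p0 A)}"
    using Wmono by (auto simp del: prod.insert) (meson order_trans not_le)+
  also have "sum g \<dots> = sum g {A \<in> Pow S'. prod w (insert p0 A) \<le> Y} +
      sum g {A \<in> Pow S'. prod w A \<le> Y \<and> Y < prod w (insert p0 A)}"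
    using fin by (intro sum.union_disjoint) auto
  finally show ?thesis using False by (simp add: g_def)
qed

section \<open>Detecting an order relation by characters\<close>

lemma cis_eq_1_dint:
  assumes "ec x = 1"
  shows "dint x = 0"
proof -
  have "cmod (ec x - 1) = 0" using assms by simp
  then have "\<bar>sin (pi * x)\<bar> = 0" unfolding norm_cis_minus_1 by simp
  then show ?thesis using abs_sin_pi_ge[of x] dint_nonneg[of x] by linarith
qed

lemma sum_cis_orthogonal:
  fixes m :: int and n :: nat
  assumes "0 < n"
  shows "(\<Sum>t<n. ec (real t * of_int m / real n)) = (if int n dvd m then of_nat n else 0)"
proof (cases "int n dvd m")
  case True
  then obtain k where "m = int n * k" by blast
  then have "ec (real t * of_int m / real n) = 1" for t
    using assms by (intro cis_multiple_2pi) auto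
  then show ?thesis using True by simp
next
  case False
  define x where "x = of_int m / real n"
  let ?S = "\<Sum>t<n. ec (real t * of_int m / real n)"
  have p: "ec (real t * of_int m / real n) = ec x ^ t" for t :: nat
  proof -
    have "ec x ^ t = cis (real t * (2 * pi * x))" by (rule Complex.DeMoivre)
    then show ?thesis by (simp add: x_def mult_ac)
  qed
  have "ec x ^ n = cis (2 * pi * of_int m)"
    using assms by (simp add: Complex.DeMoivre x_def)
  also have "\<dots> = 1" by (intro cis_multiple_2pi) auto
  finally have "(ec x - 1) * ?S = 0"
    unfolding p using power_diff_1_eq[of "ec x" n] by simp
  moreover have "ec x \<noteq> 1"
  proof
    assume "ec x = 1"
    then have "dint x = 0" by (rule cis_eq_1_dint)
    then have "x = of_int (round x)" by (simp add: dint_def)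
    then have "of_int m = (of_int (int n * round x) :: real)"
      using assms by (simp add: x_def field_simps)
    then have "m = int n * round x" by linarith
    then show False using False by simp
  qed
  ultimately show ?thesis using False by simp
qed

lemma harmonic_sum_le:
  assumes "1 \<le> n"
  shows "(\<Sum>t\<in>{1..n}. 1 / real t) \<le> 1 + ln (real n)"
  using assms
proof (induction n rule: dec_induct)
  case base
  then show ?case by simp
next
  case (step n)
  have "ln (real n / real (Suc n)) \<le> real n / real (Suc n) - 1"
    using step by (intro ln_le_minus_one) auto
  also have "\<dots> = - 1 / real (Suc n)" by (simp add: field_simps)
  finally have "1 / real (Suc n) \<le> ln (real (Suc n)) - ln (real n)"
    using step by (simp add: ln_div)
  then show ?case using step by simp
qed

text \<open>The coupling \<open>i \<le> j\<close> between the variables of a bilinear sum is expanded into characters modulo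
  \<open>2 K\<close>, at the cost of a logarithm.\<close>

lemma order_separation:
  assumes K: "1 \<le> K"
  obtains k :: "nat \<Rightarrow> complex" where
    "\<And>i j. i < K \<Longrightarrow> j < K \<Longrightarrow> (if i \<le> j then 1 else 0) =
       (\<Sum>t<2 * K. k t * (cis (- 2 * pi * (real t * real i / real (2 * K))) * ec (real t * real j / real (2 * K))))"
    "(\<Sum>t<2 * K. cmod (k t)) \<le> 3 + ln (real (2 * K))"
proof -
  \<comment> \<open>The differences \<open>j - i - u\<close> lie strictly between
    \<open>- 2 * K\<close> and \<open>2 * K\<close>, so this modulus divides such a difference only
    if it is 0.\<close>
  define n where "n = 2 * K"
  have n: "0 < n" using K by (simp add: n_def)
  \<comment> \<open>Fourier coefficients of the interval \<open>{0..<K}\<close>: for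
    \<open>i, j < K\<close> the relation \<open>i \<le> j\<close> says that \<open>j - i\<close>
    equals some \<open>u < K\<close>.\<close>
  define k where "k t = (\<Sum>u<K. ec (real t * of_int (- int u) / real n)) / of_nat n" for t
  show thesis
  proof (rule that[of k])
    fix i j assume ij: "i < K" "j < K"
    have "(\<Sum>t<n. k t * (cis (- 2 * pi * (real t * real i / real n)) * ec (real t * real j / real n)))
       = (\<Sum>t<n. \<Sum>u<K. ec (real t * of_int (int j - int i - int u) / real n) / of_nat n)"
      by (intro sum.cong refl)
        (simp add: k_def sum_divide_distrib sum_distrib_right cis_mult algebra_simps diff_divide_distrib add_divide_distrib)
    also have "\<dots> = (\<Sum>u<K. (\<Sum>t<n. ec (real t * of_int (int j - int i - int u) / real n)) / of_nat n)"
      by (subst sum.swap) (simp add: sum_divide_distrib)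
    also have "\<dots> = (\<Sum>u<K. if int n dvd (int j - int i - int u) then 1 else 0)"
      using n by (intro sum.cong refl) (subst sum_cis_orthogonal, auto)
    also have "\<dots> = (\<Sum>u<K. if i \<le> j \<and> u = j - i then 1 else 0)"
    proof (intro sum.cong refl)
      fix u assume u: "u \<in> {..<K}"
      have "\<bar>int j - int i - int u\<bar> < int n" using ij u by (auto simp: n_def)
      then have "int n dvd (int j - int i - int u) \<longleftrightarrow> int j - int i - int u = 0"
        using zdvd_imp_le[of "int n" "\<bar>int j - int i - int u\<bar>"] by auto
      also have "\<dots> \<longleftrightarrow> i \<le> j \<and> u = j - i" by auto
      finally show "(if int n dvd (int j - int i - int u) then 1 else 0) = (if i \<le> j \<and> u = j - i then 1 else (0 :: complex))"
        by simp
    qed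
    also have "\<dots> = (if i \<le> j then 1 else 0)" using ij by (auto simp: sum.delta)
    finally show "(if i \<le> j then 1 else 0) = (\<Sum>t<2 * K. k t * (cis (- 2 * pi * (real t * real i / real (2 * K))) * ec (real t * real j / real (2 * K))))"
      unfolding n_def by simp
  next
    have k0: "cmod (k 0) \<le> 1" using K by (simp add: k_def n_def norm_divide)
    \<comment> \<open>The interval sum is geometric, so the coefficients decay like the reciprocal
      of the distance from \<open>t\<close> to the multiples of \<open>n\<close>, and their total is
      harmonic.\<close>
    have kt: "cmod (k t) \<le> (1 / real t + 1 / real (n - t)) / 2" if t: "t \<in> {1..<n}" for t
    proof -
      define d where "d = dint (real t / real n)"
      have dge: "min (real t) (real (n - t)) / real n \<le> d"
      proof -
        have nt: "real (n - t) = real n - real t" using t by auto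
        have "min (real t) (real (n - t)) / real n \<le> \<bar>real t / real n - of_int m\<bar>" for m
        proof (cases "m \<le> 0")
          case True
          then have "real t / real n \<le> \<bar>real t / real n - of_int m\<bar>" by linarith
          moreover have "min (real t) (real (n - t)) / real n \<le> real t / real n"
            using n by (intro divide_right_mono) auto
          ultimately show ?thesis by linarith
        next
          case False
          have "real (n - t) / real n = 1 - real t / real n" using n t nt by (simp add: field_simps)
          moreover have "1 - real t / real n \<le> \<bar>real t / real n - of_int m\<bar>" using False by linarith
          moreover have "min (real t) (real (n - t)) / real n \<le> real (n - t) / real n"
            using n by (intro divide_right_mono) auto
          ultimately show ?thesis by linarith
        qed
        then show ?thesis by (simp add: d_def dint_def)
      qed
      have mpos: "0 < min (real t) (real (n - t))" using t by auto
      have dpos: "0 < d" using dge mpos n by (smt (verit) divide_pos_pos of_nat_0_less_iff)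
      have "(\<Sum>u<K. ec (real t * of_int (- int u) / real n)) =
        (\<Sum>u\<in>(\<lambda>u. - int u) ` {..<K}. ec (of_int u * (real t / real n)))"
        by (subst sum.reindex) (auto simp: inj_on_def mult_ac)
      moreover have "cmod (\<Sum>u\<in>(\<lambda>u. - int u) ` {..<K}. ec (of_int u * (real t / real n))) * d \<le> 1/2"
        unfolding d_def
      proof (rule geometric_cis_bound)
        fix a b c :: int
        assume "a \<in> (\<lambda>u. - int u) ` {..<K}" "b \<in> (\<lambda>u. - int u) ` {..<K}" "a \<le> c" "c \<le> b"
        then have "c = - int (nat (- c))" "nat (- c) < K" by auto
        then show "c \<in> (\<lambda>u. - int u) ` {..<K}" by blast
      qed auto
      ultimately have "cmod (of_nat n * k t) * d \<le> 1/2" using n by (simp add: k_def)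
      then have "real n * cmod (k t) * d \<le> 1/2" by (simp add: norm_mult)
      moreover have "real n * cmod (k t) * (min (real t) (real (n - t)) / real n) \<le> real n * cmod (k t) * d"
        using dge by (intro mult_left_mono) auto
      ultimately have "cmod (k t) * min (real t) (real (n - t)) \<le> 1/2" using n by simp
      then have "cmod (k t) \<le> 1 / 2 / min (real t) (real (n - t))" using mpos by (simp add: field_simps)
      also have "\<dots> \<le> (1 / real t + 1 / real (n - t)) / 2" using t by (auto simp: min_def)
      finally show ?thesis .
    qed
    have hs: "(\<Sum>t\<in>{1..<n}. 1 / real t) \<le> 1 + ln (real n)"
    proof -
      have "{1..<n} = {1..n - 1}" using n by auto
      moreover have "1 \<le> n - 1" using K by (simp add: n_def)
      then have "(\<Sum>t\<in>{1..n - 1}. 1 / real t) \<le> 1 + ln (real (n - 1))" by (rule harmonic_sum_le)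
      moreover have "ln (real (n - 1)) \<le> ln (real n)" using K by (simp add: n_def)
      ultimately show ?thesis by simp
    qed
    have hr: "(\<Sum>t\<in>{1..<n}. 1 / real (n - t)) = (\<Sum>t\<in>{1..<n}. 1 / real t)"
      by (rule sum.reindex_bij_witness[of _ "\<lambda>t. n - t" "\<lambda>t. n - t"]) (auto simp del: of_nat_diff)
    have "{..<n} = insert 0 {1..<n}" using n by auto
    then have "(\<Sum>t<n. cmod (k t)) = cmod (k 0) + (\<Sum>t\<in>{1..<n}. cmod (k t))" by simp
    also have "\<dots> \<le> 1 + (\<Sum>t\<in>{1..<n}. (1 / real t + 1 / real (n - t)) / 2)"
      using k0 kt by (intro add_mono sum_mono) auto
    also have "\<dots> = 1 + (\<Sum>t\<in>{1..<n}. 1 / real t)"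
      unfolding sum_divide_distrib[symmetric] sum.distrib hr by simp
    also have "\<dots> \<le> 3 + ln (real n)" using hs by simp
    finally show "(\<Sum>t<2 * K. cmod (k t)) \<le> 3 + ln (real (2 * K))" by (simp add: n_def)
  qed
qed

section \<open>Linear and bilinear sums\<close>

lemma dyadic_bound:
  fixes f :: "'a \<Rightarrow> 'b :: real_normed_vector" and w :: "'a \<Rightarrow> real"
  assumes "finite X" "\<And>d. d \<in> X \<Longrightarrow> 1 \<le> w d \<and> w d < 2 ^ n"
    and "\<And>j. norm (\<Sum>d\<in>{d \<in> X. 2 ^ j \<le> w d \<and> w d < 2 * 2 ^ j}. f d) \<le> B"
  shows "norm (sum f X) \<le> real n * B"
  using assms
proof (induction n arbitrary: X)
  case 0
  then have "X = {}" by fastforce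
  then show ?case by simp
next
  case (Suc n)
  define X1 where "X1 = {d \<in> X. w d < 2 ^ n}"
  define X2 where "X2 = {d \<in> X. 2 ^ n \<le> w d \<and> w d < 2 * 2 ^ n}"
  have "X = X1 \<union> X2" using Suc.prems by (auto simp: X1_def X2_def)
  moreover have fin: "finite X1" "finite X2" "X1 \<inter> X2 = {}" using Suc.prems(1) by (auto simp: X1_def X2_def)
  ultimately have eq: "sum f X = sum f X1 + sum f X2" by (simp add: sum.union_disjoint)
  have B0: "0 \<le> B" using Suc.prems(3)[of 0] by (rule order_trans[OF norm_ge_zero])
  have "norm (sum f X1) \<le> real n * B"
  proof (rule Suc.IH)
    fix j
    show "norm (\<Sum>d\<in>{d \<in> X1. 2 ^ j \<le> w d \<and> w d < 2 * 2 ^ j}. f d) \<le> B"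
    proof (cases "j < n")
      case True
      have "(2 :: real) * 2 ^ j \<le> 2 ^ n"
        using True power_increasing[of "Suc j" n "2 :: real"] by simp
      then have "{d \<in> X1. 2 ^ j \<le> w d \<and> w d < 2 * 2 ^ j} = {d \<in> X. 2 ^ j \<le> w d \<and> w d < 2 * 2 ^ j}"
        by (auto simp: X1_def)
      then show ?thesis using Suc.prems(3) by simp
    next
      case False
      then have pow: "(2 :: real) ^ n \<le> 2 ^ j" by (intro power_increasing) auto
      have "w d < 2 ^ j" if "d \<in> X1" for d
      proof -
        have "w d < 2 ^ n" using that by (simp add: X1_def)
        then show ?thesis using pow by (rule order.strict_trans2)
      qed
      then have "{d \<in> X1. 2 ^ j \<le> w d \<and> w d < 2 * 2 ^ j} = {}" by (auto simp: not_le)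
      then show ?thesis using B0 by (simp only: sum.empty norm_zero)
    qed
  qed (use fin Suc.prems(2) in \<open>auto simp: X1_def\<close>)
  moreover have "norm (sum f X2) \<le> B" unfolding X2_def by (rule Suc.prems(3))
  ultimately show ?case unfolding eq by (auto simp: algebra_simps intro: norm_triangle_le)
qed

lemma convex_mult_vimage: "convex C \<Longrightarrow> convex {m :: complex. d * m \<in> C}"
  using convex_linear_vimage[of "(*) d" C]
  by (simp add: vimage_def bounded_linear.linear bounded_linear_mult_right)

text \<open>Applied with \<open>\<xi> = h * c\<close> and \<open>L = t ^ 3 / |h|\<close>; the bounds
  on \<open>L\<close> then say \<open>1 \<le> |h| \<le> t\<close>. \<open>M\<close> bounds the
  modulus, so \<open>\<Omega>\<close> has on the order of \<open>M^2 = t ^ 24\<close> lattice points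
  at most.\<close>

locale sum_setup =
  fixes \<xi> :: complex and t L s M :: real and \<Omega> :: "complex set"
  assumes t2: "2 \<le> t" and sp: "spaced \<xi> L s" and L: "t^2 \<le> L" "L \<le> t ^ 3" and s: "s = 1 / (2 * t ^ 3)"
    and M: "M = t ^ 12" and conv: "convex \<Omega>" and \<Omega>: "\<And>z. z \<in> \<Omega> \<Longrightarrow> z \<noteq> 0 \<and> cmod z \<le> M"
begin

lemma L2: "2 \<le> L"
proof -
  have "2 \<le> t^2" using t2 mult_mono[of 2 t 1 t] by (simp add: power2_eq_square)
  then show ?thesis using L by linarith
qed

lemma s_pos: "0 < s" using t2 by (simp add: s)

definition slice :: "complex \<Rightarrow> complex set" where
  "slice d = {m \<in> ZI. d * m \<in> \<Omega>}"

lemma slice_bound: "d \<noteq> 0 \<Longrightarrow> 0 < D \<Longrightarrow> D \<le> cmod d \<Longrightarrow> m \<in> slice d \<Longrightarrow> cmod m \<le> M / D"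
proof -
  assume d: "d \<noteq> 0" "0 < D" "D \<le> cmod d" "m \<in> slice d"
  have "D * cmod m \<le> cmod d * cmod m" using d by (intro mult_right_mono) auto
  also have "\<dots> \<le> M" using d \<Omega>[of "d * m"] by (simp add: slice_def norm_mult)
  finally show "cmod m \<le> M / D" using d by (simp add: field_simps)
qed

lemma quotient_sq: "(M / L)^2 \<le> t ^ 20"
proof -
  have "M / L \<le> M / t^2" using L t2 M L2 by (intro divide_left_mono) auto
  also have "\<dots> = t ^ 10" using t2 by (simp add: M power_diff[symmetric])
  finally have "(M / L)^2 \<le> (t ^ 10)^2" using L2 M t2 by (intro power_mono) auto
  then show ?thesis by (simp add: power_mult[symmetric])
qed

text \<open>The inner sum runs over the lattice points of a convex set of radius
  \<open>R = M / D\<close>, whence the bounds \<open>R^2\<close> and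
  \<open>R / nrm (d * \<xi>)\<close> up to constants. Averaging by \<open>spaced_sum_nonzero\<close>
  with \<open>K = 2 * D\<close> turns the first into \<open>(M / L)^2\<close>, at most
  \<open>t ^ 20\<close>; \<open>D \<le> t ^ 5\<close> keeps the rest at order
  \<open>t ^ 18\<close>.\<close>

lemma type_I_block:
  assumes D: "1 \<le> D" "D \<le> t ^ 5" and X: "X \<subseteq> {d \<in> ZI. D \<le> cmod d \<and> cmod d < 2 * D}"
  shows "(\<Sum>d\<in>X. cmod (\<Sum>m\<in>slice d. ee (d * m * \<xi>))) \<le> 65400 * t ^ 22"
proof -
  define R where "R = M / D"
  define f where "f d = cmod (\<Sum>m\<in>slice d. ee (d * m * \<xi>))" for d
  have "t ^ 5 \<le> t ^ 12" using t2 by (intro power_increasing) auto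
  then have R1: "1 \<le> R" using D by (simp add: R_def M field_simps)
  have Xd: "d \<noteq> 0" "D \<le> cmod d" if "d \<in> X" for d using that X D by auto
  have *: "f d * nrm (d * \<xi>) \<le> 3 * R / 2" "f d \<le> 9 * R^2" if d: "d \<in> X" for d
  proof -
    have sl: "slice d = {m. d * m \<in> \<Omega>} \<inter> gball R"
      using slice_bound[OF Xd(1)[OF d] _ Xd(2)[OF d]] D by (auto simp: slice_def gball_def R_def)
    have f: "f d = cmod (\<Sum>m\<in>{m. d * m \<in> \<Omega>} \<inter> gball R. ee (m * (d * \<xi>)))"
      unfolding f_def sl by (simp add: mult_ac)
    have "f d * nrm (d * \<xi>) \<le> (2 * R + 1) / 2" "f d \<le> (2 * R + 1)^2"
      unfolding f using R1 by (intro convex_ee_sum convex_mult_vimage conv; simp)+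
    moreover have "(2 * R + 1)^2 \<le> (3 * R)^2" using R1 by (intro power_mono) auto
    ultimately show "f d * nrm (d * \<xi>) \<le> 3 * R / 2" "f d \<le> 9 * R^2"
      using R1 by (auto simp: power_mult_distrib)
  qed
  have "sum f X \<le> 400 * (2 * D / L)^2 * (9 * R^2) + 1700 * (2 * D / L + 1)^2 * (3 * R / 2 * L / s)"
    by (rule spaced_sum_nonzero[OF sp s_pos L2])
       (use D R1 X * in \<open>auto simp: gball_def f_def\<close>)
  also have "400 * (2 * D / L)^2 * (9 * R^2) = 14400 * (M / L)^2"
    using D L2 by (simp add: R_def power_divide power_mult_distrib)
  also have "(M / L)^2 \<le> t ^ 20" by (rule quotient_sq)
  also have "1700 * (2 * D / L + 1)^2 * (3 * R / 2 * L / s) = 5100 * t ^ 15 * ((4 * D / L + 4) + L / D)"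
    using D L2 t2 by (simp add: R_def M s power2_eq_square field_simps power_numeral_reduce)
  also have "\<dots> \<le> 5100 * t ^ 15 * (10 * t ^ 3)"
  proof (intro mult_left_mono)
    have "D / L \<le> t ^ 5 / t^2" using D L t2 L2 by (intro frac_le) auto
    also have "\<dots> = t ^ 3" using t2 by (simp add: power_diff[symmetric])
    finally have 1: "D / L \<le> t ^ 3" .
    have "L / D \<le> t ^ 3 / 1" using D L t2 by (intro frac_le) auto
    moreover have "1 ^ 3 \<le> t ^ 3" using t2 by (intro power_mono) auto
    ultimately show "4 * D / L + 4 + L / D \<le> 10 * t ^ 3" using 1 by simp
  qed (use t2 in auto)
  also have "14400 * t ^ 20 + 5100 * t ^ 15 * (10 * t ^ 3) = 14400 * t ^ 20 + 51000 * t ^ 18"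
    by (simp add: power_mult[symmetric] power_add[symmetric])
  also have "\<dots> \<le> 14400 * t ^ 22 + 51000 * t ^ 22"
    using t2 by (intro add_mono mult_left_mono power_increasing) auto
  finally show ?thesis by (simp add: f_def)
qed

text \<open>For fixed \<open>m1\<close> the spacing is applied to \<open>k = m1 - m2\<close>. The
  sum over \<open>d\<close> runs over an intersection of two dilates of \<open>\<Omega>\<close>,
  still convex, with frequency \<open>k * \<xi>\<close>. As the diagonal \<open>k = 0\<close> is
  present, it is \<open>spaced_block_sum\<close> with its trivial bound \<open>25 * D^2\<close> that
  applies.\<close>

lemma type_II_correlation:
  assumes D: "1 \<le> D" and m1: "m1 \<in> gball (M / D)" and MD: "1 \<le> M / D"
  shows "(\<Sum>m2\<in>gball (M / D). cmod (\<Sum>d\<in>{d \<in> gball (2 * D). d * m1 \<in> \<Omega> \<and> d * m2 \<in> \<Omega>}. ee (d * ((m1 - m2) * \<xi>))))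
    \<le> (16 * (M / D) / L + 2)^2 * (100 * D^2 + 13 * (5 * D / 2) * L / s)"
proof -
  define h where "h k = cmod (\<Sum>d\<in>{d \<in> gball (2 * D). d * m1 \<in> \<Omega> \<and> d * (m1 - k) \<in> \<Omega>}. ee (d * (k * \<xi>)))" for k
  define X where "X = (\<lambda>m2. m1 - m2) ` gball (M / D)"
  have inj: "inj_on (\<lambda>m2. m1 - m2) (gball (M / D))" by (auto simp: inj_on_def)
  have eq: "(\<Sum>m2\<in>gball (M / D). cmod (\<Sum>d\<in>{d \<in> gball (2 * D). d * m1 \<in> \<Omega> \<and> d * m2 \<in> \<Omega>}. ee (d * ((m1 - m2) * \<xi>)))) = sum h X"
    unfolding X_def by (subst sum.reindex[OF inj]) (simp add: h_def o_def)
  have "sum h X \<le> (8 * (2 * (M / D)) / L + 2)^2 * (4 * (25 * D^2) + 13 * (5 * D / 2) * L / s)"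
  proof (rule spaced_block_sum[OF sp s_pos L2])
    show "X \<subseteq> gball (2 * (M / D))"
    proof
      fix k assume "k \<in> X"
      then obtain m2 where m2: "m2 \<in> gball (M / D)" "k = m1 - m2" by (auto simp: X_def)
      then show "k \<in> gball (2 * (M / D))"
        using m1 norm_triangle_ineq4[of m1 m2] by (auto simp: gball_def)
    qed
    fix k assume "k \<in> X"
    have cv: "convex ({d. m1 * d \<in> \<Omega>} \<inter> {d. (m1 - k) * d \<in> \<Omega>})"
      by (intro convex_Int convex_mult_vimage conv)
    have h: "h k = cmod (\<Sum>d\<in>({d. m1 * d \<in> \<Omega>} \<inter> {d. (m1 - k) * d \<in> \<Omega>}) \<inter> gball (2 * D). ee (d * (k * \<xi>)))"
      unfolding h_def by (intro arg_cong[where f = cmod] sum.cong) (auto simp: mult.commute)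
    have "h k \<le> (2 * (2 * D) + 1)^2" "h k * nrm (k * \<xi>) \<le> (2 * (2 * D) + 1) / 2"
      unfolding h using D by (intro convex_ee_sum cv; simp)+
    moreover have "(2 * (2 * D) + 1)^2 \<le> (5 * D)^2" using D by (intro power_mono) auto
    ultimately show "h k \<le> 25 * D^2" "h k * nrm (k * \<xi>) \<le> 5 * D / 2"
      using D by (auto simp: power_mult_distrib)
    show "0 \<le> h k" by (simp add: h_def)
  qed (use D MD in auto)
  then show ?thesis unfolding eq by simp
qed

text \<open>Cauchy's inequality over \<open>d\<close> removes the coefficients \<open>a\<close>, and
  the expanded square leaves the correlations just bounded. The factor 2 in
  \<open>t ^ 5 \<le> 2 * D\<close> admits the dyadic block that begins below
  \<open>t ^ 5\<close>.\<close>

lemma type_II_block: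
  assumes D: "t ^ 5 \<le> 2 * D" "D \<le> t ^ 10" and X: "X \<subseteq> {d \<in> ZI. D \<le> cmod d \<and> cmod d < 2 * D}"
    and a: "\<And>d. cmod (a d) \<le> 1" and b: "\<And>m. cmod (b m) \<le> 1"
  shows "cmod (\<Sum>d\<in>X. a d * (\<Sum>m\<in>slice d. b m * ee (d * m * \<xi>))) \<le> 5200 * t ^ 22"
proof -
  have "2 ^ 5 \<le> t ^ 5" using t2 by (intro power_mono) auto
  then have D1: "1 \<le> D" using D by simp
  have "t ^ 10 \<le> t ^ 12" using t2 by (intro power_increasing) auto
  then have MD: "1 \<le> M / D" using D D1 by (simp add: M field_simps)
  define Y where "Y = gball (M / D)"
  \<comment> \<open>The sum of squares is enlarged from \<open>X\<close> to a full disc, so that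
    after squaring the inner sum over \<open>d\<close> ranges over a convex set.\<close>
  define X' where "X' = gball (2 * D)"
  define g where "g d = (\<Sum>m\<in>Y. if d * m \<in> \<Omega> then b m * ee (d * m * \<xi>) else 0)" for d
  let ?h = "\<lambda>m1 m2. \<Sum>d\<in>{d \<in> X'. d * m1 \<in> \<Omega> \<and> d * m2 \<in> \<Omega>}. ee (d * ((m1 - m2) * \<xi>))"
  let ?c = "\<lambda>d m1 m2. if d * m1 \<in> \<Omega> \<and> d * m2 \<in> \<Omega> then ee (d * ((m1 - m2) * \<xi>)) else 0"
  have XX': "X \<subseteq> X'" using X by (auto simp: X'_def gball_def)
  then have finX: "finite X" by (rule finite_subset) (simp add: X'_def)
  have g: "(\<Sum>m\<in>slice d. b m * ee (d * m * \<xi>)) = g d" if d: "d \<in> X" for d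
  proof -
    have "d \<noteq> 0" "D \<le> cmod d" using d X D1 by auto
    then have "slice d = {m \<in> Y. d * m \<in> \<Omega>}"
      using slice_bound[of d D] D1 by (auto simp: slice_def Y_def gball_def)
    then show ?thesis unfolding g_def by (simp add: sum.inter_filter Y_def)
  qed
  define Z where "Z = (\<Sum>d\<in>X. a d * (\<Sum>m\<in>slice d. b m * ee (d * m * \<xi>)))"
  have "cmod Z \<le> (\<Sum>d\<in>X. cmod (g d))"
    unfolding Z_def
  proof (rule sum_norm_le)
    fix d assume "d \<in> X"
    then show "cmod (a d * (\<Sum>m\<in>slice d. b m * ee (d * m * \<xi>))) \<le> cmod (g d)"
      using a[of d] by (simp add: g norm_mult mult_left_le_one_le)
  qed
  then have "(cmod Z)^2 \<le> (\<Sum>d\<in>X. cmod (g d))^2" by (intro power_mono) auto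
  also have "\<dots> \<le> (\<Sum>d\<in>X. (cmod (g d))^2) * real (card X)"
    by (rule sum_squared_le_sum_of_squares)
  also have "\<dots> \<le> (\<Sum>d\<in>X'. (cmod (g d))^2) * (25 * D^2)"
  proof (intro mult_mono sum_mono2)
    have "real (card X) \<le> real (card X')" using XX' by (simp add: card_mono X'_def)
    also have "\<dots> \<le> (2 * (2 * D) + 1)^2" unfolding X'_def using D1 by (intro card_gball) auto
    also have "\<dots> \<le> (5 * D)^2" using D1 by (intro power_mono) auto
    finally show "real (card X) \<le> 25 * D^2" by (simp add: power_mult_distrib)
  qed (use XX' in \<open>auto simp: X'_def intro!: sum_nonneg\<close>)
  finally have Zg: "(cmod Z)^2 \<le> (\<Sum>d\<in>X'. (cmod (g d))^2) * (25 * D^2)" .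
  define q where "q = (16 * (M / D) / L + 2)^2 * (100 * D^2 + 13 * (5 * D / 2) * L / s)"
  have q0: "0 \<le> q" using D1 L2 s_pos by (auto simp: q_def)
  have "complex_of_real (\<Sum>d\<in>X'. (cmod (g d))^2) = (\<Sum>d\<in>X'. g d * cnj (g d))"
    by (simp add: complex_norm_square[symmetric] del: of_real_power)
  also have "\<dots> = (\<Sum>d\<in>X'. \<Sum>m1\<in>Y. \<Sum>m2\<in>Y. b m1 * cnj (b m2) * ?c d m1 m2)"
  proof (intro sum.cong refl)
    fix d
    have e: "ee (d * m1 * \<xi>) * cnj (ee (d * m2 * \<xi>)) = ee (d * ((m1 - m2) * \<xi>))" for m1 m2
      by (simp add: cnj_ee ee_add[symmetric] algebra_simps)
    have "g d * cnj (g d) = (\<Sum>m1\<in>Y. \<Sum>m2\<in>Y. (if d * m1 \<in> \<Omega> then b m1 * ee (d * m1 * \<xi>) else 0) *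
        cnj (if d * m2 \<in> \<Omega> then b m2 * ee (d * m2 * \<xi>) else 0))"
      unfolding g_def by (simp only: cnj_sum sum_product)
    also have "\<dots> = (\<Sum>m1\<in>Y. \<Sum>m2\<in>Y. b m1 * cnj (b m2) * ?c d m1 m2)"
      by (intro sum.cong refl) (simp add: e[symmetric])
    finally show "g d * cnj (g d) = (\<Sum>m1\<in>Y. \<Sum>m2\<in>Y. b m1 * cnj (b m2) * ?c d m1 m2)" .
  qed
  also have "\<dots> = (\<Sum>m1\<in>Y. \<Sum>m2\<in>Y. \<Sum>d\<in>X'. b m1 * cnj (b m2) * ?c d m1 m2)"
    by (rule trans[OF sum.swap]) (rule sum.cong[OF refl], rule sum.swap)
  also have "\<dots> = (\<Sum>m1\<in>Y. \<Sum>m2\<in>Y. b m1 * cnj (b m2) * ?h m1 m2)"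
    by (intro sum.cong refl) (simp add: sum_distrib_left[symmetric] sum.inter_filter X'_def)
  finally have e: "complex_of_real (\<Sum>d\<in>X'. (cmod (g d))^2) = (\<Sum>m1\<in>Y. \<Sum>m2\<in>Y. b m1 * cnj (b m2) *
      ?h m1 m2)" .
  have "(\<Sum>d\<in>X'. (cmod (g d))^2) = cmod (complex_of_real (\<Sum>d\<in>X'. (cmod (g d))^2))"
    unfolding norm_of_real by (simp add: sum_nonneg)
  also have "\<dots> = cmod (\<Sum>m1\<in>Y. \<Sum>m2\<in>Y. b m1 * cnj (b m2) *
      ?h m1 m2)"
    by (simp only: e)
  also have "\<dots> \<le> (\<Sum>m1\<in>Y. \<Sum>m2\<in>Y. cmod (?h m1 m2))"
  proof (intro sum_norm_le)
    fix m1 m2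
    have "cmod (b m1) * cmod (b m2) \<le> 1 * 1" using b by (intro mult_mono) auto
    then show "cmod (b m1 * cnj (b m2) * ?h m1 m2)
      \<le> cmod (?h m1 m2)"
      by (simp add: norm_mult mult_left_le_one_le)
  qed
  also have "\<dots> \<le> (\<Sum>m1\<in>Y. q)"
    unfolding q_def X'_def Y_def using D1 MD by (intro sum_mono type_II_correlation) auto
  also have "\<dots> \<le> 9 * (M / D)^2 * q"
  proof -
    have "real (card Y) \<le> (2 * (M / D) + 1)^2" unfolding Y_def using MD by (intro card_gball) auto
    also have "\<dots> \<le> (3 * (M / D))^2" using MD by (intro power_mono) auto
    also have "\<dots> = 9 * (M / D)^2" unfolding power_mult_distrib by simp
    finally have "real (card Y) \<le> 9 * (M / D)^2" .
    then show ?thesis using q0 by (simp add: mult_right_mono)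
  qed
  finally have "(cmod Z)^2 \<le> 9 * (M / D)^2 * q * (25 * D^2)"
    by (intro order_trans[OF Zg] mult_right_mono) auto
  also have "\<dots> = 225 * t ^ 24 * q"
    using D1 by (simp add: power_divide M power_mult[symmetric])
  also have "q \<le> 119080 * t ^ 20"
  proof -
    have "q \<le> (512 * (M / D / L)^2 + 8) * (100 * D^2 + 65 * t ^ 3 * D * L)"
      unfolding q_def
    proof (intro mult_mono)
      \<comment> \<open>This is \<open>(x + y)^2 \<le> 2 * x^2 + 2 * y^2\<close> for
        \<open>x = 16 * u\<close> and \<open>y = 2\<close>.\<close>
      define u where "u = M / D / L"
      have "(16 * u + 2)^2 + (16 * u - 2)^2 = 512 * u^2 + 8"
        by (simp add: power2_eq_square algebra_simps)
      moreover have "0 \<le> (16 * u - 2)^2" by simp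
      ultimately have "(16 * u + 2)^2 \<le> 512 * u^2 + 8" by linarith
      then show "(16 * (M / D) / L + 2)^2 \<le> 512 * (M / D / L)^2 + 8" by (simp add: u_def)
    qed (use D1 L2 s_pos t2 in \<open>auto simp: s mult_ac\<close>)
    also have "\<dots> = 51200 * (M / L)^2 + 33280 * (t ^ 27 / (D * L)) + 800 * D^2 + 520 * (t ^ 3 * (D * L))"
      using D1 L2 by (simp add: M power2_eq_square field_simps)
    \<comment> \<open>The first three terms can reach the order \<open>t ^ 20\<close>: for
      \<open>L = t^2\<close>, for \<open>D * L\<close> of size \<open>t ^ 7\<close>, and for
      \<open>D = t ^ 10\<close>. They fix the bilinear range; the last term is at most of order
      \<open>t ^ 16\<close>.\<close>
    also have "\<dots> \<le> 51200 * t ^ 20 + 33280 * (2 * t ^ 20) + 800 * t ^ 20 + 520 * t ^ 20"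
    proof (intro add_mono mult_left_mono)
      show "(M / L)^2 \<le> t ^ 20" by (rule quotient_sq)
      have "t ^ 5 / 2 * t^2 \<le> D * L" using D D1 L t2 by (intro mult_mono) auto
      then have "t ^ 27 / (D * L) \<le> t ^ 27 / (t ^ 5 / 2 * t^2)"
        using D1 L2 t2 by (intro divide_left_mono) auto
      also have "\<dots> = 2 * (t ^ 27 / t ^ 7)" by (simp add: power_add[symmetric])
      also have "t ^ 27 / t ^ 7 = t ^ 20" using t2 by (simp add: power_diff[symmetric])
      finally show "t ^ 27 / (D * L) \<le> 2 * t ^ 20" .
      have "D^2 \<le> (t ^ 10)^2" using D D1 by (intro power_mono) auto
      then show "D^2 \<le> t ^ 20" by (simp add: power_mult[symmetric])
      have "t ^ 3 * (D * L) \<le> t ^ 3 * (t ^ 10 * t ^ 3)"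
        using D D1 L L2 t2 by (intro mult_left_mono mult_mono) auto
      also have "\<dots> = t ^ 16" by (simp add: power_add[symmetric])
      also have "\<dots> \<le> t ^ 20" using t2 by (intro power_increasing) auto
      finally show "t ^ 3 * (D * L) \<le> t ^ 20" .
    qed auto
    finally show ?thesis by simp
  qed
  then have "225 * t ^ 24 * q \<le> 225 * t ^ 24 * (119080 * t ^ 20)"
    using t2 by (intro mult_left_mono) auto
  also have "\<dots> = 26793000 * (t ^ 22)^2" by (simp add: power_add[symmetric] power_mult[symmetric])
  also have "\<dots> \<le> (5200 * t ^ 22)^2" by (simp add: power_mult_distrib)
  finally have "(cmod Z)^2 \<le> (5200 * t ^ 22)^2" .
  then have "cmod Z \<le> 5200 * t ^ 22" by (rule power2_le_imp_le) (use t2 in auto)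
  then show ?thesis by (simp add: Z_def)
qed

end

section \<open>Sieving by the primes of modulus up to the square root of M\<close>

context sum_setup
begin

definition CP :: "complex set" where
  "CP = {p. cprime p \<and> (cmod p)^2 \<le> M}"

definition sprimes :: "complex \<Rightarrow> complex set" where
  "sprimes n = {p \<in> CP. gdvd p n}"

definition T :: nat where "T = nat \<lfloor>M\<rfloor>"

text \<open>Any injective indexing that is monotone in the norm would do.\<close>

definition idx :: "complex \<Rightarrow> nat" where
  "idx p = nat \<lfloor>(cmod p)^2\<rfloor> * (T + 1) + nat \<lfloor>Re p\<rfloor>"

lemma t_pow_ge_1: "1 \<le> t ^ k"
  using t2 by (intro one_le_power) auto

lemma M_sq: "M = (t ^ 6)^2"
  by (simp add: M power_mult[symmetric])

lemma finite_CP: "finite CP"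
proof (rule finite_subset)
  show "CP \<subseteq> gball (t ^ 6)"
  proof
    fix p assume "p \<in> CP"
    then have "p \<in> ZI" "(cmod p)^2 \<le> (t ^ 6)^2"
      unfolding M_sq[symmetric] by (auto simp: CP_def cprime_gauss_int)
    then show "p \<in> gball (t ^ 6)" using t2 by (auto simp: gball_def intro: power2_le_imp_le)
  qed
qed auto

lemma CP_norm:
  assumes "p \<in> CP"
  shows "1 \<le> cmod p" "cmod p \<le> t ^ 6"
proof -
  show "1 \<le> cmod p" using assms gauss_prime_norm_gt_1[of p] by (auto simp: CP_def cprime_def)
  have "(cmod p)^2 \<le> (t ^ 6)^2" using assms unfolding M_sq[symmetric] by (simp add: CP_def)
  then show "cmod p \<le> t ^ 6" by (rule power2_le_imp_le) (use t2 in auto)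
qed

lemma idx_coords:
  assumes "p \<in> CP"
  obtains k a where "idx p = k * (T + 1) + a" "a < T + 1" "k \<le> T" "(cmod p)^2 = real k" "Re p = real a"
proof -
  have p: "p \<in> ZI" "0 < Re p" "0 \<le> Im p" "(cmod p)^2 \<le> M"
    using assms by (auto simp: CP_def cprime_def gauss_prime_def)
  obtain x y :: int where xy: "p = Complex (of_int x) (of_int y)" using p(1) by (rule gauss_intsE)
  define a b where "a = nat x" and "b = nat y"
  have ab: "p = Complex (real a) (real b)" using p xy by (simp add: a_def b_def)
  have sq: "(cmod p)^2 = real (a^2 + b^2)" by (simp add: ab cmod_power2)
  have "a \<le> a * a" by (cases a) auto
  then have "a \<le> a^2 + b^2" by (simp add: power2_eq_square trans_le_add1)
  moreover have "real (a^2 + b^2) \<le> M" using p sq by simp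
  then have le: "a^2 + b^2 \<le> T" unfolding T_def by (simp add: le_nat_floor)
  ultimately have "a < T + 1" by simp
  moreover have "idx p = (a^2 + b^2) * (T + 1) + a"
    unfolding idx_def sq floor_of_nat nat_int by (simp add: ab)
  ultimately show thesis using that le sq by (simp add: ab)
qed

text \<open>The index has the digits \<open>|p|^2\<close> and \<open>Re p\<close> in base
  \<open>T + 1\<close>. They determine \<open>(Im p)^2\<close>, and the sign is fixed by
  \<open>0 \<le> Im p\<close>.\<close>

lemma inj_idx: "inj_on idx CP"
proof (rule inj_onI)
  fix p q assume pq: "p \<in> CP" "q \<in> CP" "idx p = idx q"
  obtain k a where p: "idx p = k * (T + 1) + a" "a < T + 1" "(cmod p)^2 = real k" "Re p = real a"
    using idx_coords[OF pq(1)] by metis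
  obtain l b where q: "idx q = l * (T + 1) + b" "b < T + 1" "(cmod q)^2 = real l" "Re q = real b"
    using idx_coords[OF pq(2)] by metis
  have "k = (k * (T + 1) + a) div (T + 1)" "l = (l * (T + 1) + b) div (T + 1)"
    using div_mult_self3[of "T + 1" k a] div_mult_self3[of "T + 1" l b] p(2) q(2) by auto
  then have "k = l" using pq(3) p(1) q(1) by metis
  then have "a = b" using pq(3) p(1) q(1) by simp
  have "(Im p)^2 = (Im q)^2"
    using p q \<open>k = l\<close> \<open>a = b\<close> cmod_power2[of p] cmod_power2[of q] by simp
  moreover have "0 \<le> Im p" "0 \<le> Im q" using pq by (auto simp: CP_def cprime_def)
  ultimately show "p = q" using p q \<open>a = b\<close> by (simp add: complex_eq_iff)
qed

lemma idx_mono: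
  assumes "p \<in> CP" "q \<in> CP" "idx p \<le> idx q"
  shows "cmod p \<le> cmod q"
proof -
  obtain k a where p: "idx p = k * (T + 1) + a" "(cmod p)^2 = real k"
    using idx_coords[OF assms(1)] by metis
  obtain l b where q: "idx q = l * (T + 1) + b" "b < T + 1" "(cmod q)^2 = real l"
    using idx_coords[OF assms(2)] by metis
  have "k * (T + 1) < (l + 1) * (T + 1)" using assms(3) p q by (simp add: algebra_simps)
  then have "k < l + 1" by (simp only: mult_less_cancel2)
  then have "(cmod p)^2 \<le> (cmod q)^2" using p q by simp
  then show ?thesis by (rule power2_le_imp_le) simp
qed

lemma idx_less:
  assumes "p \<in> CP"
  shows "idx p < (T + 1)^2"
proof -
  obtain k a where p: "idx p = k * (T + 1) + a" "a < T + 1" "k \<le> T"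
    using idx_coords[OF assms] by metis
  have "k * (T + 1) \<le> T * (T + 1)" using p by (intro mult_right_mono) auto
  then show ?thesis using p by (simp add: power2_eq_square)
qed

text \<open>Without its prime \<open>p\<close> of least index the product is at most
  \<open>t ^ 5\<close>. If another prime remains, it is at least as large as \<open>p\<close>, so
  \<open>|p| \<le> t ^ 5\<close> and the full product is at most \<open>t ^ 10\<close>; if none
  remains, the product is \<open>|p| \<le> t ^ 6\<close>. Critical products thus fall into the
  bilinear range.\<close>

lemma crit_norm:
  assumes A: "A \<subseteq> CP" "crit idx cmod (t ^ 5) A"
  shows "t ^ 5 < cmod (\<Prod>A)" "cmod (\<Prod>A) \<le> t ^ 10"
proof -
  have w: "prod cmod B = cmod (\<Prod>B)" for B by (simp add: prod_norm)
  obtain p where p: "p \<in> A" "\<And>x. x \<in> A \<Longrightarrow> idx p \<le> idx x" "t ^ 5 < prod cmod A" "prod cmod (A - {p}) \<le> t ^ 5"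
    using A(2) unfolding crit_def by blast
  show "t ^ 5 < cmod (\<Prod>A)" using p w by simp
  have finA: "finite A" using A finite_CP finite_subset by blast
  have split: "prod cmod A = cmod p * prod cmod (A - {p})" using finA p by (simp add: prod.remove)
  show "cmod (\<Prod>A) \<le> t ^ 10"
  proof (cases "A - {p} = {}")
    case True
    then have "prod cmod A = cmod p" using split by (simp only: prod.empty mult_1_right)
    also have "\<dots> \<le> t ^ 6" using CP_norm p A by blast
    also have "\<dots> \<le> t ^ 10" using t2 by (intro power_increasing) auto
    finally show ?thesis by (simp add: w)
  next
    case False
    then obtain x where x: "x \<in> A" "x \<noteq> p" by auto
    have "cmod p \<le> cmod x" using idx_mono[of p x] p x A by blast
    also have "\<dots> \<le> prod cmod (A - {p})"
    proof -
      have "1 \<le> prod cmod (A - {p} - {x})" using A CP_norm by (intro prod_ge_1) auto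
      then have "cmod x * 1 \<le> cmod x * prod cmod (A - {p} - {x})" by (intro mult_left_mono) auto
      also have "\<dots> = prod cmod (A - {p})" using finA x by (subst prod.remove[of "A - {p}" x]) auto
      finally show ?thesis by simp
    qed
    finally have "cmod p \<le> t ^ 5" using p by linarith
    then have "prod cmod A \<le> t ^ 5 * t ^ 5" unfolding split using p t2 by (intro mult_mono prod_nonneg) auto
    then show ?thesis by (simp add: w power_add[symmetric])
  qed
qed

text \<open>The number of dyadic ranges needed to cover \<open>[1, t^10]\<close>.\<close>

definition nn :: nat where "nn = Suc (nat \<lfloor>log 2 (t ^ 10)\<rfloor>)"

lemma nn: "t ^ 10 < 2 ^ nn" "real nn \<le> 1 + 15 * ln t"
proof -
  have t10: "1 \<le> t ^ 10" by (rule t_pow_ge_1)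
  have l0: "0 \<le> log 2 (t ^ 10)" using t10 t2 by (subst zero_le_log_cancel_iff) auto
  have "log 2 (t ^ 10) < real nn" using l0 unfolding nn_def by linarith
  then have "t ^ 10 < 2 powr real nn" using t10 by (subst (asm) log_less_iff) auto
  then show "t ^ 10 < 2 ^ nn" by (simp add: powr_realpow)
  have "real nn \<le> 1 + log 2 (t ^ 10)" using l0 unfolding nn_def by simp
  also have "log 2 (t ^ 10) = 10 * ln t / ln 2" using t2 by (simp add: log_def ln_realpow)
  also have "\<dots> \<le> 10 * ln t / (2/3)" using ln2_ge_two_thirds t2 by (intro divide_left_mono) auto
  finally show "real nn \<le> 1 + 15 * ln t" by simp
qed

text \<open>The element \<open>d\<close> in the hypothesis restricts it to nonempty blocks; through
  \<open>d\<close> the range of \<open>X\<close> yields the bounds on \<open>D\<close> that the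
  block estimates require.\<close>

lemma dyadic_total:
  fixes f :: "complex \<Rightarrow> complex"
  assumes X: "X \<subseteq> {d \<in> ZI. 1 \<le> cmod d \<and> cmod d \<le> t ^ 10}" and "0 \<le> B"
    and block: "\<And>D d. d \<in> X \<Longrightarrow> D \<le> cmod d \<Longrightarrow> cmod d < 2 * D \<Longrightarrow> 1 \<le> D \<Longrightarrow>
      cmod (sum f {d \<in> X. D \<le> cmod d \<and> cmod d < 2 * D}) \<le> B"
  shows "cmod (sum f X) \<le> real nn * B"
proof -
  have finX: "finite X" using X by (intro finite_subset[OF _ finite_gball[of "t ^ 10"]]) (auto simp: gball_def)
  show ?thesis
  proof (rule dyadic_bound[where w = cmod, OF finX])
    show "1 \<le> cmod d \<and> cmod d < 2 ^ nn" if "d \<in> X" for d using that X nn(1) by auto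
    fix j
    show "cmod (sum f {d \<in> X. 2 ^ j \<le> cmod d \<and> cmod d < 2 * 2 ^ j}) \<le> B"
    proof (cases "{d \<in> X. 2 ^ j \<le> cmod d \<and> cmod d < 2 * 2 ^ j} = {}")
      case False
      then show ?thesis using block[of _ "2 ^ j"] by auto
    next
      case True
      then show ?thesis using \<open>0 \<le> B\<close> by (simp only: sum.empty norm_zero)
    qed
  qed
qed

lemma type_I_total:
  assumes X: "X \<subseteq> {d \<in> ZI. 1 \<le> cmod d \<and> cmod d \<le> t ^ 5}" and a: "\<And>d. cmod (a d) \<le> 1"
  shows "cmod (\<Sum>d\<in>X. a d * (\<Sum>m\<in>slice d. ee (d * m * \<xi>))) \<le> real nn * (65400 * t ^ 22)"
proof (rule dyadic_total)
  have "t ^ 5 \<le> t ^ 10" using t2 by (intro power_increasing) auto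
  then show "X \<subseteq> {d \<in> ZI. 1 \<le> cmod d \<and> cmod d \<le> t ^ 10}" using X by auto
next
  let ?s = "\<lambda>d. \<Sum>m\<in>slice d. ee (d * m * \<xi>)"
  fix D d assume D: "d \<in> X" "D \<le> cmod d" "1 \<le> D"
  have "cmod (\<Sum>d\<in>{d \<in> X. D \<le> cmod d \<and> cmod d < 2 * D}. a d * ?s d)
      \<le> (\<Sum>d\<in>{d \<in> X. D \<le> cmod d \<and> cmod d < 2 * D}. cmod (?s d))"
    using a by (intro sum_norm_le) (simp add: norm_mult mult_left_le_one_le)
  also have "\<dots> \<le> 65400 * t ^ 22" using X D by (intro type_I_block[of D]) auto
  finally show "cmod (\<Sum>d\<in>{d \<in> X. D \<le> cmod d \<and> cmod d < 2 * D}. a d * ?s d) \<le> 65400 * t ^ 22" .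
qed (use t2 in auto)

lemma type_II_total:
  assumes X: "X \<subseteq> {d \<in> ZI. t ^ 5 < cmod d \<and> cmod d \<le> t ^ 10}"
    and a: "\<And>d. cmod (a d) \<le> 1" and b: "\<And>m. cmod (b m) \<le> 1"
  shows "cmod (\<Sum>d\<in>X. a d * (\<Sum>m\<in>slice d. b m * ee (d * m * \<xi>))) \<le> real nn * (5200 * t ^ 22)"
proof (rule dyadic_total)
  show "X \<subseteq> {d \<in> ZI. 1 \<le> cmod d \<and> cmod d \<le> t ^ 10}" using X t_pow_ge_1[of 5] by auto
next
  fix D d assume D: "d \<in> X" "D \<le> cmod d" "cmod d < 2 * D"
  then have "t ^ 5 < cmod d" "cmod d \<le> t ^ 10" using X by auto
  then have "t ^ 5 \<le> 2 * D" "D \<le> t ^ 10" using D by linarith+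
  then show "cmod (\<Sum>d\<in>{d \<in> X. D \<le> cmod d \<and> cmod d < 2 * D}. a d * (\<Sum>m\<in>slice d. b m * ee (d * m * \<xi>))) \<le> 5200 * t ^ 22"
    using X a b by (intro type_II_block[of D]) auto
qed (use t2 in auto)

definition lpoints :: "complex set" where
  "lpoints = \<Omega> \<inter> ZI"

lemma finite_lpoints: "finite lpoints"
  using \<Omega> by (intro finite_subset[OF _ finite_gball[of M]]) (auto simp: gball_def lpoints_def)

lemma Prod_CP:
  assumes "A \<subseteq> CP"
  shows "\<Prod>A \<in> ZI" "1 \<le> cmod (\<Prod>A)" "\<Prod>A \<noteq> 0"
proof -
  show "\<Prod>A \<in> ZI" using assms by (intro gauss_ints_prod) (auto simp: CP_def cprime_gauss_int)
  have "1 \<le> (\<Prod>p\<in>A. cmod p)" using assms CP_norm by (intro prod_ge_1) auto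
  then show "1 \<le> cmod (\<Prod>A)" by (simp add: prod_norm)
  then show "\<Prod>A \<noteq> 0" by auto
qed

lemma CP_dvd_Prod:
  assumes "A \<subseteq> CP"
  shows "{p \<in> CP. gdvd p (\<Prod>A)} = A"
  using assms cprime_dvd_Prod_iff[of _ A] finite_subset[OF assms finite_CP] by (auto simp: CP_def)

text \<open>A product returns its set as the primes of \<open>CP\<close> that divide it. Sums over
  sets thus become sums over distinct moduli \<open>d\<close> with coefficients of modulus at most
  1.\<close>

lemma inj_Prod: "inj_on (\<lambda>A. \<Prod>A) (Pow CP)"
  by (rule inj_on_inverseI[of _ "\<lambda>d. {p \<in> CP. gdvd p d}"]) (simp add: CP_dvd_Prod)

lemma multiples_slice:
  assumes "A \<subseteq> CP"
  shows "{n \<in> lpoints. A \<subseteq> sprimes n} = (\<lambda>m. \<Prod>A * m) ` slice (\<Prod>A)"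
proof -
  have "A \<subseteq> sprimes n \<longleftrightarrow> gdvd (\<Prod>A) n" if "n \<in> ZI" for n
    using Prod_cprime_dvd_iff[of A n] that assms finite_subset[OF assms finite_CP]
    by (auto simp: sprimes_def CP_def)
  note dvd = this
  show ?thesis
  proof (intro set_eqI iffI)
    fix n assume "n \<in> {n \<in> lpoints. A \<subseteq> sprimes n}"
    then have n: "n \<in> \<Omega>" "n \<in> ZI" "gdvd (\<Prod>A) n" using dvd by (auto simp: lpoints_def)
    then obtain m where "m \<in> ZI" "n = \<Prod>A * m" by (auto simp: gdvd_def)
    then show "n \<in> (\<lambda>m. \<Prod>A * m) ` slice (\<Prod>A)" using n by (auto simp: slice_def)
  next
    fix n assume "n \<in> (\<lambda>m. \<Prod>A * m) ` slice (\<Prod>A)"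
    then obtain m where m: "m \<in> ZI" "\<Prod>A * m \<in> \<Omega>" "n = \<Prod>A * m" by (auto simp: slice_def)
    then have "gdvd (\<Prod>A) n" "n \<in> ZI"
      using Prod_CP(1)[OF assms] by (auto simp: gdvd_def simp del: mult_cancel_left)
    then show "n \<in> {n \<in> lpoints. A \<subseteq> sprimes n}"
      using m dvd by (simp add: lpoints_def)
  qed
qed

lemma sprimes_mult:
  assumes "A \<subseteq> CP" "m \<in> ZI"
  shows "sprimes (\<Prod>A * m) = A \<union> sprimes m"
proof -
  have "gdvd p (\<Prod>A * m) \<longleftrightarrow> gdvd p (\<Prod>A) \<or> gdvd p m" if "p \<in> CP" for p
  proof
    assume "gdvd p (\<Prod>A * m)"
    then show "gdvd p (\<Prod>A) \<or> gdvd p m"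
      using that Prod_CP(1)[OF assms(1)] assms(2) by (simp add: CP_def cprime_def gauss_prime_def)
  next
    assume "gdvd p (\<Prod>A) \<or> gdvd p m"
    then show "gdvd p (\<Prod>A * m)"
      using gdvd_mult_left[of p "\<Prod>A" m] gdvd_mult_left[of p m "\<Prod>A"] Prod_CP(1)[OF assms(1)] assms(2)
      by (auto simp: mult.commute)
  qed
  then have "sprimes (\<Prod>A * m) = {p \<in> CP. gdvd p (\<Prod>A)} \<union> sprimes m"
    by (auto simp: sprimes_def)
  then show ?thesis by (simp add: CP_dvd_Prod[OF assms(1)])
qed

abbreviation (input) small_sets :: "complex set set" where
  "small_sets \<equiv> {A \<in> Pow CP. prod cmod A \<le> t ^ 5}"

abbreviation (input) crit_sets :: "complex set set" where
  "crit_sets \<equiv> {A \<in> Pow CP. crit idx cmod (t ^ 5) A}"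

text \<open>The default \<open>(T + 1)^2\<close> exceeds every index on \<open>CP\<close>, so a
  cofactor \<open>m\<close> without sieving primes imposes no condition.\<close>

definition least_idx :: "complex \<Rightarrow> nat" where
  "least_idx m = (if sprimes m = {} then (T + 1)^2 else Min (idx ` sprimes m))"

abbreviation (input) coupled :: "complex set \<Rightarrow> complex \<Rightarrow> complex" where
  "coupled A m \<equiv> (if Min (idx ` A) \<le> least_idx m then 1 else 0)"

abbreviation (input) multiple_sum :: "complex set \<Rightarrow> complex" where
  "multiple_sum A \<equiv> (\<Sum>m\<in>slice (\<Prod>A). ee (\<Prod>A * m * \<xi>))"

abbreviation (input) coupled_sum :: "complex set \<Rightarrow> complex" where
  "coupled_sum A \<equiv> (\<Sum>m\<in>slice (\<Prod>A). coupled A m * ee (\<Prod>A * m * \<xi>))"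

lemma finite_sprimes: "finite (sprimes m)"
  using finite_CP by (simp add: sprimes_def)

lemma least_idx_less: "least_idx m < (T + 1)^2 + 1"
proof (cases "sprimes m = {}")
  case False
  then obtain p where p: "p \<in> sprimes m" by auto
  then have "Min (idx ` sprimes m) \<le> idx p" using finite_sprimes by simp
  also have "\<dots> < (T + 1)^2" using p by (intro idx_less) (simp add: sprimes_def)
  finally show ?thesis by (simp add: least_idx_def)
qed (simp add: least_idx_def)

text \<open>The primes of \<open>A\<close> satisfy the condition by themselves, which leaves those
  of \<open>m\<close>. The condition on the product becomes an inequality between a number attached
  to \<open>A\<close> and one attached to \<open>m\<close>, the form that
  \<open>order_separation\<close> splits.\<close>

lemma coupling_iff:
  assumes A: "A \<subseteq> CP" "A \<noteq> {}" and m: "m \<in> ZI"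
  shows "(\<forall>p\<in>sprimes (\<Prod>A * m). Min (idx ` A) \<le> idx p) \<longleftrightarrow> Min (idx ` A) \<le> least_idx m"
    and "Min (idx ` A) < (T + 1)^2 + 1"
proof -
  have finA: "finite A" using A finite_CP finite_subset by blast
  obtain p where p: "p \<in> A" using A by auto
  then have "Min (idx ` A) \<le> idx p" using finA by simp
  also have "\<dots> < (T + 1)^2" using p A by (intro idx_less) auto
  finally have lt: "Min (idx ` A) < (T + 1)^2" .
  then show "Min (idx ` A) < (T + 1)^2 + 1" by simp
  have "(\<forall>p\<in>sprimes (\<Prod>A * m). Min (idx ` A) \<le> idx p) \<longleftrightarrow> (\<forall>p\<in>sprimes m. Min (idx ` A) \<le> idx p)"
    unfolding sprimes_mult[OF A(1) m] using finA by auto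
  also have "\<dots> \<longleftrightarrow> Min (idx ` A) \<le> least_idx m"
    using lt finite_sprimes by (auto simp: least_idx_def)
  finally show "(\<forall>p\<in>sprimes (\<Prod>A * m). Min (idx ` A) \<le> idx p) \<longleftrightarrow> Min (idx ` A) \<le> least_idx m" .
qed

lemma slice_sum:
  assumes "A \<subseteq> CP"
  shows "(\<Sum>n\<in>{n \<in> lpoints. A \<subseteq> sprimes n \<and> Q n}. ee (n * \<xi>)) =
    (\<Sum>m\<in>slice (\<Prod>A). (if Q (\<Prod>A * m) then 1 else 0) * ee (\<Prod>A * m * \<xi>))"
proof -
  have "{n \<in> lpoints. A \<subseteq> sprimes n \<and> Q n} = {n \<in> {n \<in> lpoints. A \<subseteq> sprimes n}. Q n}"
    by auto
  also have "(\<Sum>n\<in>\<dots>. ee (n * \<xi>)) = (\<Sum>n\<in>{n \<in> lpoints. A \<subseteq> sprimes n}. if Q n then ee (n * \<xi>) else 0)"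
    using finite_lpoints by (intro sum.inter_filter) auto
  also have "\<dots> = (\<Sum>m\<in>slice (\<Prod>A). if Q (\<Prod>A * m) then ee (\<Prod>A * m * \<xi>) else 0)"
    unfolding multiples_slice[OF assms] using Prod_CP(3)[OF assms]
    by (subst sum.reindex) (auto simp: inj_on_def)
  also have "\<dots> = (\<Sum>m\<in>slice (\<Prod>A). (if Q (\<Prod>A * m) then 1 else 0) * ee (\<Prod>A * m * \<xi>))"
    by (intro sum.cong) auto
  finally show ?thesis .
qed

text \<open>\<open>sieve_identity\<close> is applied with \<open>S = sprimes n\<close> at each
  lattice point \<open>n\<close>, and the sums over \<open>n\<close> and \<open>A\<close> are
  exchanged; the points divisible by all of \<open>A\<close> are the multiples of
  \<open>\<Prod>A\<close>.\<close>

lemma sifted_sum_split: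
  "(\<Sum>n\<in>{n \<in> lpoints. sprimes n = {}}. ee (n * \<xi>)) =
    (\<Sum>A\<in>small_sets. (-1) ^ card A * multiple_sum A) +
    (\<Sum>A\<in>crit_sets. (-1) ^ card A *
      coupled_sum A)"
proof -
  have fP: "finite (Pow CP)" using finite_CP by simp
  have swap: "(\<Sum>n\<in>lpoints. (\<Sum>A\<in>{A \<in> Pow (sprimes n). P A \<and> Q A n}. (-1) ^ card A) * ee (n * \<xi>)) =
      (\<Sum>A\<in>{A \<in> Pow CP. P A}. (-1) ^ card A * (\<Sum>n\<in>{n \<in> lpoints. A \<subseteq> sprimes n \<and> Q A n}. ee (n * \<xi>)))"
    for P Q
  proof -
    have "(\<Sum>n\<in>lpoints. (\<Sum>A\<in>{A \<in> Pow (sprimes n). P A \<and> Q A n}. (-1) ^ card A) * ee (n * \<xi>)) =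
      (\<Sum>n\<in>lpoints. \<Sum>A\<in>{A \<in> {A \<in> Pow CP. P A}. A \<subseteq> sprimes n \<and> Q A n}. (-1) ^ card A * ee (n * \<xi>))"
      unfolding sum_distrib_right by (intro sum.cong refl) (auto simp: sprimes_def)
    also have "\<dots> = (\<Sum>A\<in>{A \<in> Pow CP. P A}. \<Sum>n\<in>{n \<in> lpoints. A \<subseteq> sprimes n \<and> Q A n}. (-1) ^ card A * ee (n * \<xi>))"
      by (rule sum.swap_restrict) (use finite_lpoints fP in auto)
    finally show ?thesis by (simp add: sum_distrib_left)
  qed
  have "(\<Sum>n\<in>{n \<in> lpoints. sprimes n = {}}. ee (n * \<xi>)) =
      (\<Sum>n\<in>lpoints. (if sprimes n = {} then 1 else 0) * ee (n * \<xi>))"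
    by (subst sum.inter_filter[OF finite_lpoints]) (intro sum.cong, auto)
  also have "\<dots> = (\<Sum>n\<in>lpoints. (\<Sum>A\<in>{A \<in> Pow (sprimes n). prod cmod A \<le> t ^ 5 \<and> True}. (-1) ^ card A) * ee (n * \<xi>)) +
    (\<Sum>n\<in>lpoints. (\<Sum>A\<in>{A \<in> Pow (sprimes n). crit idx cmod (t ^ 5) A \<and> (\<forall>p\<in>sprimes n. Min (idx ` A) \<le> idx p)}. (-1) ^ card A) * ee (n * \<xi>))"
    unfolding sum.distrib[symmetric] distrib_right[symmetric]
  proof (intro sum.cong refl arg_cong2[where f = "(*)"])
    fix n
    have "sprimes n \<subseteq> CP" by (auto simp: sprimes_def)
    then have inj: "inj_on idx (sprimes n)" and w: "\<And>p. p \<in> sprimes n \<Longrightarrow> 1 \<le> cmod p"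
      using inj_on_subset[OF inj_idx] CP_norm(1) by auto
    show "(if sprimes n = {} then 1 else 0) = (\<Sum>A\<in>{A \<in> Pow (sprimes n). prod cmod A \<le> t ^ 5 \<and> True}. (-1) ^ card A) +
     (\<Sum>A\<in>{A \<in> Pow (sprimes n). crit idx cmod (t ^ 5) A \<and> (\<forall>p\<in>sprimes n. Min (idx ` A) \<le> idx p)}. (-1) ^ card A :: complex)"
      using sieve_identity[OF finite_sprimes[of n] inj w t_pow_ge_1[of 5]] by simp
  qed
  also have "\<dots> = (\<Sum>A\<in>small_sets. (-1) ^ card A * multiple_sum A) +
    (\<Sum>A\<in>crit_sets. (-1) ^ card A *
      coupled_sum A)"
    unfolding swap
  proof (rule arg_cong2[where f = "(+)"], goal_cases)
    have "(\<Sum>n\<in>{n \<in> lpoints. A \<subseteq> sprimes n \<and> True}. ee (n * \<xi>)) = multiple_sum A"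
      if "A \<in> small_sets" for A
      using that slice_sum[of A "\<lambda>_. True"] by simp
    note e = this
    case 1
    show ?case by (rule sum.cong[OF refl]) (simp only: e)
  next
    have "(\<Sum>n\<in>{n \<in> lpoints. A \<subseteq> sprimes n \<and> (\<forall>p\<in>sprimes n. Min (idx ` A) \<le> idx p)}. ee (n * \<xi>)) =
      coupled_sum A" if "A \<in> crit_sets" for A
    proof -
      have A: "A \<subseteq> CP" "A \<noteq> {}" using that by (auto simp: crit_def)
      show ?thesis unfolding slice_sum[OF A(1)]
        by (rule sum.cong[OF refl]) (subst coupling_iff[OF A], auto simp: slice_def)
    qed
    note e = this
    case 2
    show ?case by (rule sum.cong[OF refl]) (simp only: e)
  qed
  finally show ?thesis .
qed

lemma ln_index_range: "ln (real (2 * ((T + 1)^2 + 1))) \<le> 30 * ln t"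
proof -
  have "real T \<le> M" unfolding T_def using t_pow_ge_1[of 12] M by (simp add: of_nat_floor)
  then have "(real T + 1)^2 \<le> (2 * t ^ 12)^2"
    using M t_pow_ge_1[of 12] by (intro power_mono) auto
  then have "(real T + 1)^2 \<le> 4 * t ^ 24" by (simp add: power_mult_distrib power_mult[symmetric])
  then have "real (2 * ((T + 1)^2 + 1)) \<le> 8 * t ^ 24 + 2 * t ^ 24"
    using t_pow_ge_1[of 24] by (simp add: add.commute)
  also have "\<dots> \<le> 2 ^ 6 * t ^ 24" using t_pow_ge_1[of 24] by simp
  also have "\<dots> \<le> t ^ 6 * t ^ 24" using t2 by (intro mult_right_mono power_mono) auto
  also have "\<dots> = t ^ 30" by (simp add: power_add[symmetric])
  finally have "ln (real (2 * ((T + 1)^2 + 1))) \<le> ln (t ^ 30)"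
    using t2 by (subst ln_le_cancel_iff) (auto intro!: add_pos_nonneg)
  then show ?thesis using t2 by (simp add: ln_realpow)
qed

text \<open>The small sets give linear sums with Moebius coefficients. For the critical sets every
  character in the expansion of the coupling is absorbed into the coefficients \<open>a\<close> and
  \<open>b\<close>, so \<open>type_II_total\<close> applies to each \<open>u\<close>. The dyadic
  ranges cost one logarithm, the sum of \<open>|k u|\<close> another.\<close>

lemma sifted_sum_bound:
  "cmod (\<Sum>n\<in>{n \<in> lpoints. sprimes n = {}}. ee (n * \<xi>)) \<le>
     real nn * (65400 * t ^ 22) + (3 + 30 * ln t) * (real nn * (5200 * t ^ 22))"
proof -
  \<comment> \<open>The inverse lets sign and least index of \<open>A\<close> be written as
    functions of the modulus \<open>d\<close>.\<close>
  define inv where "inv = the_inv_into (Pow CP) (\<lambda>A. \<Prod>A)"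
  have inv: "inv (\<Prod>A) = A" if "A \<subseteq> CP" for A
    unfolding inv_def using that by (intro the_inv_into_f_f inj_Prod) auto
  have reindex: "(\<Sum>A\<in>{A \<in> Pow CP. P A}. f A * g (\<Prod>A)) = (\<Sum>d\<in>(\<lambda>A. \<Prod>A) ` {A \<in> Pow CP. P A}. f (inv d) * g d)"
    for P and f :: "complex set \<Rightarrow> complex" and g
    using inv by (subst sum.reindex) (auto intro: inj_on_subset[OF inj_Prod])
  define X1 where "X1 = (\<lambda>A. \<Prod>A) ` small_sets"
  define X2 where "X2 = (\<lambda>A. \<Prod>A) ` crit_sets"
  have "(\<Sum>A\<in>small_sets. (-1) ^ card A * multiple_sum A)
     = (\<Sum>d\<in>X1. (-1) ^ card (inv d) * (\<Sum>m\<in>slice d. ee (d * m * \<xi>)))"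
    unfolding X1_def by (rule reindex)
  also have "cmod \<dots> \<le> real nn * (65400 * t ^ 22)"
    by (rule type_I_total) (auto simp: X1_def norm_power prod_norm[symmetric] Prod_CP simp del: prod_norm intro: order_trans[OF Prod_CP(2)])
  finally have I: "cmod (\<Sum>A\<in>small_sets. (-1) ^ card A * multiple_sum A) \<le> \<dots>" .
  define K where "K = (T + 1)^2 + 1"
  obtain k :: "nat \<Rightarrow> complex" where k:
    "\<And>i j. i < K \<Longrightarrow> j < K \<Longrightarrow> (if i \<le> j then 1 else 0) =
       (\<Sum>u<2 * K. k u * (cis (- 2 * pi * (real u * real i / real (2 * K))) * ec (real u * real j / real (2 * K))))"
    "(\<Sum>u<2 * K. cmod (k u)) \<le> 3 + ln (real (2 * K))"
    using order_separation[of K] by (auto simp: K_def)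
  define a where "a u d = (-1) ^ card (inv d) * cis (- 2 * pi * (real u * real (Min (idx ` inv d)) / real (2 * K)))" for u d
  define b where "b u m = ec (real u * real (least_idx m) / real (2 * K))" for u m
  let ?s = "\<lambda>u d. a u d * (\<Sum>m\<in>slice d. b u m * ee (d * m * \<xi>))"
  have "(\<Sum>A\<in>crit_sets. (-1) ^ card A *
      coupled_sum A)
    = (\<Sum>A\<in>crit_sets. \<Sum>u<2 * K. k u * ?s u (\<Prod>A))"
  proof (intro sum.cong refl)
    fix A assume "A \<in> crit_sets"
    then have A: "A \<subseteq> CP" "A \<noteq> {}" by (auto simp: crit_def)
    have "(-1) ^ card A * coupled_sum A
      = (\<Sum>m\<in>slice (\<Prod>A). \<Sum>u<2 * K. k u * (a u (\<Prod>A) * (b u m * ee (\<Prod>A * m * \<xi>))))"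
      unfolding sum_distrib_left
    proof (intro sum.cong refl)
      fix m assume "m \<in> slice (\<Prod>A)"
      then have "m \<in> ZI" by (simp add: slice_def)
      then have "Min (idx ` A) < K" "least_idx m < K"
        using coupling_iff(2)[OF A] least_idx_less by (auto simp: K_def)
      then show "(-1) ^ card A * (coupled A m * ee (\<Prod>A * m * \<xi>)) =
         (\<Sum>u<2 * K. k u * (a u (\<Prod>A) * (b u m * ee (\<Prod>A * m * \<xi>))))"
        by (subst k(1)) (simp_all add: a_def b_def inv[OF A(1)] sum_distrib_left sum_distrib_right mult_ac)
    qed
    also have "\<dots> = (\<Sum>u<2 * K. \<Sum>m\<in>slice (\<Prod>A). k u * (a u (\<Prod>A) * (b u m * ee (\<Prod>A * m * \<xi>))))"
      by (rule sum.swap)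
    finally show "(-1) ^ card A * coupled_sum A
      = (\<Sum>u<2 * K. k u * ?s u (\<Prod>A))"
      by (simp add: sum_distrib_left)
  qed
  also have "\<dots> = (\<Sum>u<2 * K. k u * (\<Sum>A\<in>crit_sets. 1 * ?s u (\<Prod>A)))"
    by (subst sum.swap) (simp add: sum_distrib_left)
  also have "\<dots> = (\<Sum>u<2 * K. k u * (\<Sum>d\<in>X2. ?s u d))"
    unfolding X2_def by (subst reindex) simp
  also have "cmod \<dots> \<le> (\<Sum>u<2 * K. cmod (k u) * (real nn * (5200 * t ^ 22)))"
  proof (rule sum_norm_le)
    fix u
    have "cmod (\<Sum>d\<in>X2. ?s u d) \<le> real nn * (5200 * t ^ 22)"
      by (rule type_II_total) (auto simp: X2_def a_def b_def norm_mult norm_power Prod_CP crit_norm)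
    then show "cmod (k u * (\<Sum>d\<in>X2. ?s u d)) \<le> cmod (k u) * (real nn * (5200 * t ^ 22))"
      by (simp add: norm_mult mult_left_mono)
  qed
  also have "\<dots> \<le> (3 + 30 * ln t) * (real nn * (5200 * t ^ 22))"
  proof -
    have "(\<Sum>u<2 * K. cmod (k u)) \<le> 3 + 30 * ln t" using k(2) ln_index_range unfolding K_def by linarith
    then show ?thesis unfolding sum_distrib_right[symmetric] using t2 by (intro mult_right_mono) auto
  qed
  finally show ?thesis unfolding sifted_sum_split using I by (intro norm_triangle_le add_mono)
qed

text \<open>Primes and sifted points differ only inside the ball of radius \<open>t ^ 6\<close>: the
  sieve discards the primes up to \<open>t ^ 6\<close> and retains units. A sifted nonunit is prime,
  as a composite of modulus at most \<open>M\<close> has a prime factor of modulus at most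
  \<open>t ^ 6\<close>.\<close>

theorem prime_exponential_sum:
  "cmod (\<Sum>p\<in>(primes_in \<Omega>). ee (p * \<xi>)) \<le> 4000000 * (1 + ln t)^2 * t ^ 22"
proof -
  let ?s = "sum (\<lambda>p. ee (p * \<xi>))"
  define P where "P = (primes_in \<Omega>)"
  define Q where "Q = {n \<in> lpoints. sprimes n = {}}"
  have PL: "P \<subseteq> lpoints" by (auto simp: P_def lpoints_def gauss_prime_def)
  have fin: "finite P" "finite Q" using finite_subset[OF PL finite_lpoints] finite_lpoints by (auto simp: Q_def)
  have t6: "1 \<le> t ^ 6" by (rule t_pow_ge_1)
  have PQ: "P - Q \<subseteq> gball (t ^ 6)"
  proof
    fix p assume p: "p \<in> P - Q"
    then have pp: "gauss_prime p" "p \<in> ZI" by (auto simp: P_def gauss_prime_def)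
    from p PL obtain q where q: "q \<in> CP" "gdvd q p" by (auto simp: Q_def sprimes_def)
    then obtain u where "gauss_unit u" "p = q * u"
      using gauss_prime_gdvd_unit[of q p] pp(1) by (auto simp: CP_def cprime_def)
    then have "cmod p = cmod q" by (simp add: norm_mult gauss_unit_iff)
    then show "p \<in> gball (t ^ 6)" using CP_norm(2)[OF q(1)] pp by (simp add: gball_def)
  qed
  have QP: "Q - P \<subseteq> gball (t ^ 6)"
  proof
    fix n assume n: "n \<in> Q - P"
    then have nG: "n \<in> ZI" "n \<in> \<Omega>" "sprimes n = {}" "\<not> gauss_prime n"
      by (auto simp: Q_def P_def lpoints_def)
    then have nM: "n \<noteq> 0" "cmod n \<le> M" using \<Omega> by auto
    have "gauss_unit n"
    proof (rule ccontr)
      assume "\<not> gauss_unit n"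
      then obtain p where p: "gauss_prime p" "gdvd p n" "(cmod p)^2 \<le> cmod n"
        using gauss_prime_small_factor nG nM by metis
      obtain q where q: "cprime q" "gdvd q p" "cmod q = cmod p" using cprime_associate[OF p(1)] by blast
      then have "q \<in> sprimes n" using p nM gdvd_trans by (auto simp: sprimes_def CP_def)
      then show False using nG by simp
    qed
    then show "n \<in> gball (t ^ 6)" using nG t6 by (simp add: gball_def gauss_unit_iff)
  qed
  have "?s P = ?s Q + ?s (P - Q) - ?s (Q - P)"
    using fin sum.union_inter[of P Q] by (simp add: sum_diff[of P "P \<inter> Q"] sum_diff[of Q "P \<inter> Q"] Diff_Int Int_commute sum.Int_Diff[of P _ Q] sum.Int_Diff[of Q _ P])
  then have A: "cmod (?s P) \<le> cmod (?s Q) + cmod (?s (P - Q)) + cmod (?s (Q - P))"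
    by (simp add: norm_triangle_le norm_triangle_le_diff)
  have small: "cmod (?s B) \<le> 9 * t ^ 22" if "B \<subseteq> gball (t ^ 6)" for B
  proof -
    have "cmod (?s B) \<le> (\<Sum>p\<in>B. 1)" by (rule sum_norm_le) simp
    also have "\<dots> \<le> real (card (gball (t ^ 6)))" using card_mono[OF _ that] by simp
    also have "\<dots> \<le> (2 * t ^ 6 + 1)^2" using t6 by (intro card_gball) auto
    also have "\<dots> \<le> (3 * t ^ 6)^2" using t6 by (intro power_mono) auto
    also have "\<dots> = 9 * t ^ 12" by (simp add: power_mult_distrib power_mult[symmetric])
    also have "\<dots> \<le> 9 * t ^ 22" using t2 by (intro mult_left_mono power_increasing) auto
    finally show ?thesis .
  qed
  define l where "l = ln t"
  have l: "0 \<le> l" using t2 by (simp add: l_def)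
  have "cmod (?s Q) \<le> (real nn * (65400 + (3 + 30 * l) * 5200)) * t ^ 22"
    using sifted_sum_bound by (simp add: Q_def l_def algebra_simps)
  \<comment> \<open>The two logarithmic factors are \<open>nn \<le> 1 + 15 * l\<close> and
    \<open>65400 + (3 + 30 * l) * 5200 = 81000 + 156000 * l\<close>.\<close>
  also have "\<dots> \<le> (15 * (1 + l) * (230000 * (1 + l))) * t ^ 22"
  proof (intro mult_right_mono mult_mono)
    show "real nn \<le> 15 * (1 + l)" using nn(2) by (simp add: l_def)
  qed (use l t2 in auto)
  also have "\<dots> = 3450000 * ((1 + l)^2 * t ^ 22)" by (simp add: power2_eq_square algebra_simps)
  finally have B: "cmod (?s Q) \<le> 3450000 * ((1 + l)^2 * t ^ 22)" .
  define u where "u = (1 + l)^2 * t ^ 22"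
  have "1 * t ^ 22 \<le> (1 + l)^2 * t ^ 22" using l t2 by (intro mult_right_mono one_le_power) auto
  then have C: "t ^ 22 \<le> u" by (simp add: u_def)
  have "0 \<le> u" by (simp add: u_def)
  then have "cmod (?s P) \<le> 4000000 * u"
    using A B C small[OF PQ] small[OF QP] unfolding u_def[symmetric] by linarith
  then show ?thesis by (simp add: P_def l_def u_def)
qed

end

section \<open>Counting points in a box\<close>

abbreviation (input) symI :: "nat \<Rightarrow> int set" where
  "symI J \<equiv> {- int J..int J}"

abbreviation (input) wave :: "nat \<Rightarrow> nat \<Rightarrow> real \<Rightarrow> complex" where
  "wave k l x \<equiv> ec ((real k - real l) * x)"

text \<open>On the unit circle this is, up to a phase, a power of a Dirichlet kernel; its squared
  modulus decays like \<open>dint x\<close> to the power \<open>- 2 * r\<close>. Large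
  \<open>r\<close> makes the tails negligible at the cost of a degree of about
  \<open>r * H\<close>.\<close>

definition kernel_poly :: "nat \<Rightarrow> nat \<Rightarrow> complex poly" where
  "kernel_poly H r = (\<Sum>i<H. monom 1 i) ^ r"

text \<open>\<open>L\<close> exceeds every frequency difference \<open>k - l\<close> of
  \<open>K\<close>, so an average over \<open>L\<close> equidistant points picks out the constant
  term exactly.\<close>

locale kernel =
  fixes H r L :: nat
  assumes H: "1 \<le> H" and r: "1 \<le> r" and L: "r * H < L"
begin

definition n :: nat where "n = r * H"
definition a :: "nat \<Rightarrow> complex" where "a k = coeff (kernel_poly H r) k"
text \<open>By Parseval, the mean of \<open>K\<close> over a period, see
  \<open>K_period_sum\<close>.\<close>

definition A :: real where "A = (\<Sum>k\<le>n. (cmod (a k))^2)"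
definition K :: "real \<Rightarrow> real" where "K x = (cmod (poly (kernel_poly H r) (ec x)))^2"
definition F :: "nat \<Rightarrow> real \<Rightarrow> real" where
  "F J x = (\<Sum>j\<in>symI J. K (x - of_int j / real L)) / (real L * A)"

text \<open>\<open>K\<close> is the \<open>r\<close>-th power of a Fejer kernel, and \<open>F J\<close> its normalised convolution with the points
  \<open>j / L\<close>, \<open>\<bar>j\<bar> \<le> J\<close>, a discrete model of the interval \<open>[- J / L, J / L]\<close> modulo 1.\<close>

abbreviation (input) dens :: "nat \<Rightarrow> real" where
  "dens J \<equiv> real (2 * J + 1) / real L"

lemma degree_kernel_poly: "degree (kernel_poly H r) \<le> n"
proof -
  have "degree (\<Sum>i<H. monom (1 :: complex) i) \<le> H"
    by (intro degree_sum_le) (auto intro: order_trans[OF degree_monom_le])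
  then have "degree (kernel_poly H r) \<le> H * r"
    unfolding kernel_poly_def by (intro order_trans[OF degree_power_le] mult_right_mono) auto
  then show ?thesis by (simp add: n_def mult.commute)
qed

lemma poly_kernel: "poly (kernel_poly H r) z = (\<Sum>k\<le>n. a k * z ^ k)"
  unfolding a_def poly_altdef using degree_kernel_poly
  by (intro sum.mono_neutral_left) (auto simp: coeff_eq_0)

lemma poly_kernel_power: "poly (kernel_poly H r) z = (\<Sum>i<H. z ^ i) ^ r"
  by (simp add: kernel_poly_def poly_power poly_sum poly_monom)

text \<open>Cauchy's inequality for the coefficients at the peak: \<open>K 0 = H ^ (2 * r)\<close>
  is at most \<open>n + 1\<close> times the mean of \<open>K\<close>.\<close>

lemma A_ge: "real H ^ (2 * r) \<le> (real n + 1) * A"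
proof -
  have "real H ^ r = cmod (poly (kernel_poly H r) 1)"
    by (simp add: poly_kernel_power norm_power)
  also have "\<dots> \<le> (\<Sum>k\<le>n. cmod (a k))" unfolding poly_kernel by (rule sum_norm_le) simp
  finally have "(real H ^ r)^2 \<le> (\<Sum>k\<le>n. cmod (a k))^2" by (intro power_mono) auto
  also have "\<dots> \<le> (\<Sum>k\<le>n. (cmod (a k))^2) * real (card {..n})"
    by (rule sum_squared_le_sum_of_squares)
  finally show ?thesis by (simp add: A_def power_mult[symmetric] mult_ac add.commute)
qed

lemma A_pos: "0 < A"
proof -
  have "0 < real H ^ (2 * r)" using H by simp
  then have "0 < (real n + 1) * A" using A_ge by linarith
  then show ?thesis by (simp add: zero_less_mult_iff)
qed

lemma L_pos: "0 < real L" using L by simp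

lemma coeff_l1: "(\<Sum>k\<le>n. cmod (a k))^2 \<le> (real n + 1) * A"
  using sum_squared_le_sum_of_squares[of "\<lambda>k. cmod (a k)" "{..n}"] by (simp add: A_def mult_ac add.commute)

lemma K_nonneg: "0 \<le> K x"
  by (simp add: K_def)

lemma F_nonneg: "0 \<le> F J x"
  unfolding F_def using A_pos by (intro divide_nonneg_nonneg sum_nonneg K_nonneg) auto

lemma cis_nat_power: "ec x ^ k = ec (real k * x)"
  by (simp add: Complex.DeMoivre mult_ac)

lemma K_expand: "complex_of_real (K x) = (\<Sum>k\<le>n. \<Sum>l\<le>n. a k * cnj (a l) * wave k l x)"
proof -
  have "complex_of_real (K x) = (\<Sum>k\<le>n. a k * ec x ^ k) * cnj (\<Sum>l\<le>n. a l * ec x ^ l)"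
    unfolding K_def complex_norm_square poly_kernel ..
  also have "\<dots> = (\<Sum>k\<le>n. \<Sum>l\<le>n. (a k * ec x ^ k) * cnj (a l * ec x ^ l))"
    by (simp only: cnj_sum sum_product)
  also have "\<dots> = (\<Sum>k\<le>n. \<Sum>l\<le>n. a k * cnj (a l) * wave k l x)"
  proof (intro sum.cong refl)
    fix k l
    have "ec x ^ k * cnj (ec x ^ l) = wave k l x"
      unfolding cis_nat_power cis_cnj cis_mult by (simp add: algebra_simps)
    then show "(a k * ec x ^ k) * cnj (a l * ec x ^ l) = a k * cnj (a l) * wave k l x"
      by (simp add: mult_ac)
  qed
  finally show ?thesis .
qed

lemma K_bound: "K x * (2 * dint x) ^ (2 * r) \<le> 1"
proof -
  have "(\<Sum>k\<in>int ` {..<H}. ec (of_int k * x)) = (\<Sum>i<H. ec x ^ i)"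
    by (subst sum.reindex) (auto simp: cis_nat_power inj_on_def)
  moreover have "cmod (\<Sum>k\<in>int ` {..<H}. ec (of_int k * x)) * dint x \<le> 1/2"
  proof (rule geometric_cis_bound)
    fix a b c :: int
    assume "a \<in> int ` {..<H}" "b \<in> int ` {..<H}" "a \<le> c" "c \<le> b"
    then have "c = int (nat c)" "nat c < H" by auto
    then show "c \<in> int ` {..<H}" by blast
  qed auto
  ultimately have "cmod (\<Sum>i<H. ec x ^ i) * (2 * dint x) \<le> 1" by simp
  then have "(cmod (\<Sum>i<H. ec x ^ i) * (2 * dint x)) ^ (2 * r) \<le> 1"
    by (intro power_le_one) auto
  then show ?thesis
    by (simp add: K_def poly_kernel_power norm_power power_mult_distrib power_mult[symmetric] mult.commute)
qed

lemma K_tail: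
  assumes "0 < \<Delta>" "\<And>m :: int. \<Delta> \<le> \<bar>x - of_int m\<bar>"
  shows "K x \<le> 1 / (2 * \<Delta>) ^ (2 * r)"
proof -
  have "\<Delta> \<le> dint x" using assms(2) by (simp add: dint_def)
  then have "K x * (2 * \<Delta>) ^ (2 * r) \<le> K x * (2 * dint x) ^ (2 * r)"
    using assms(1) K_nonneg by (intro mult_left_mono power_mono) auto
  also have "\<dots> \<le> 1" by (rule K_bound)
  finally show ?thesis using assms(1) by (simp add: field_simps)
qed

lemma K_sum_expand:
  "complex_of_real (\<Sum>j\<in>I. K (x - of_int j / real L)) =
    (\<Sum>k\<le>n. \<Sum>l\<le>n. \<Sum>j\<in>I. a k * cnj (a l) * wave k l (x - of_int j / real L))"
  unfolding of_real_sum K_expand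
  by (rule trans[OF sum.swap]) (rule sum.cong[OF refl], rule sum.swap)

text \<open>Orthogonality modulo \<open>L\<close> leaves the terms with \<open>k = l\<close>, since
  \<open>|k - l| \<le> n < L\<close>.\<close>

lemma K_period_sum: "(\<Sum>j\<in>{b..<b + int L}. K (x - of_int j / real L)) = real L * A"
proof -
  have "complex_of_real (\<Sum>j\<in>{b..<b + int L}. K (x - of_int j / real L)) =
    (\<Sum>k\<le>n. \<Sum>l\<le>n. \<Sum>j\<in>{b..<b + int L}. a k * cnj (a l) * wave k l (x - of_int j / real L))"
    by (rule K_sum_expand)
  also have "\<dots> = (\<Sum>k\<le>n. \<Sum>l\<le>n. if k = l then of_nat L * (a k * cnj (a l)) else 0)"
  proof (intro sum.cong refl)
    fix k l assume kl: "k \<in> {..n}" "l \<in> {..n}"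
    have bij: "(\<Sum>j\<in>{b..<b + int L}. f j) = (\<Sum>t<L. f (b + int t))" for f :: "int \<Rightarrow> complex"
      by (rule sum.reindex_bij_witness[of _ "\<lambda>t. b + int t" "\<lambda>j. nat (j - b)"]) auto
    have "(\<Sum>j\<in>{b..<b + int L}. a k * cnj (a l) * wave k l (x - of_int j / real L))
      = (\<Sum>t<L. a k * cnj (a l) * wave k l (x - of_int b / real L) *
          ec (real t * of_int (int l - int k) / real L))"
      unfolding bij
      by (intro sum.cong refl) (simp add: mult.assoc cis_mult, simp add: algebra_simps add_divide_distrib diff_divide_distrib)
    also have "\<dots> = a k * cnj (a l) * wave k l (x - of_int b / real L) *
        (if int L dvd int l - int k then of_nat L else 0)"
      unfolding sum_distrib_left[symmetric] using L by (subst sum_cis_orthogonal) auto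
    also have "int L dvd int l - int k \<longleftrightarrow> k = l"
    proof -
      have "\<bar>int l - int k\<bar> < int L" using kl L by (auto simp: n_def)
      then show ?thesis using zdvd_imp_le[of "int L" "\<bar>int l - int k\<bar>"] by auto
    qed
    finally show "(\<Sum>j\<in>{b..<b + int L}. a k * cnj (a l) * wave k l (x - of_int j / real L))
      = (if k = l then of_nat L * (a k * cnj (a l)) else 0)" by simp
  qed
  also have "\<dots> = (\<Sum>k\<le>n. of_nat L * (a k * cnj (a k)))" by simp
  also have "\<dots> = complex_of_real (real L * A)"
    by (simp add: A_def complex_norm_square sum_distrib_left del: of_real_power)
  finally show ?thesis by (simp only: of_real_eq_iff)
qed

text \<open>Bounds the normalised kernel \<open>K / A\<close> at distance at least
  \<open>\<Delta>\<close> from the integers, by \<open>K_tail\<close> and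
  \<open>A_ge\<close>.\<close>

definition tail :: "real \<Rightarrow> real" where
  "tail \<Delta> = (real n + 1) / (2 * real H * \<Delta>) ^ (2 * r)"

lemma tail_ge:
  assumes "0 < \<Delta>"
  shows "1 / (2 * \<Delta>) ^ (2 * r) / A \<le> tail \<Delta>"
proof -
  have "1 / A \<le> (real n + 1) / real H ^ (2 * r)" using A_ge A_pos H by (simp add: field_simps)
  then have "1 / (2 * \<Delta>) ^ (2 * r) * (1 / A) \<le> 1 / (2 * \<Delta>) ^ (2 * r) * ((real n + 1) / real H ^ (2 * r))"
    using assms by (intro mult_left_mono) auto
  then show ?thesis by (simp add: tail_def power_mult_distrib mult_ac)
qed

lemma F_le_1:
  assumes "2 * J + 1 \<le> L"
  shows "F J x \<le> 1"
proof -
  have "(\<Sum>j\<in>symI J. K (x - of_int j / real L)) \<le> (\<Sum>j\<in>{- int J..<- int J + int L}. K (x - of_int j / real L))"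
    using assms by (intro sum_mono2 K_nonneg) auto
  also have "\<dots> = real L * A" by (rule K_period_sum)
  finally show ?thesis unfolding F_def using L_pos A_pos by simp
qed

lemma F_outside:
  assumes "2 * J + 1 \<le> L" "0 < \<Delta>" "real J / real L + \<Delta> \<le> \<delta>" "\<And>m :: int. \<delta> < \<bar>x - of_int m\<bar>"
  shows "F J x \<le> tail \<Delta>"
proof -
  have "(\<Sum>j\<in>symI J. K (x - of_int j / real L)) \<le> (\<Sum>j\<in>symI J. 1 / (2 * \<Delta>) ^ (2 * r))"
  proof (intro sum_mono K_tail assms(2))
    fix j m :: int assume j: "j \<in> symI J"
    then have "\<bar>of_int j\<bar> \<le> real J" by auto
    then have "\<bar>of_int j / real L\<bar> \<le> real J / real L" using L_pos by (simp add: divide_right_mono)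
    moreover have "\<delta> < \<bar>x - of_int m\<bar>" by (rule assms(4))
    ultimately show "\<Delta> \<le> \<bar>x - of_int j / real L - of_int m\<bar>" using assms(3) by linarith
  qed
  also have "\<dots> = real (2 * J + 1) * (1 / (2 * \<Delta>) ^ (2 * r))" by simp
  also have "\<dots> \<le> real L * (1 / (2 * \<Delta>) ^ (2 * r))"
    using assms(1,2) by (intro mult_right_mono) (auto simp del: of_nat_add of_nat_mult)
  finally have "F J x \<le> (real L * (1 / (2 * \<Delta>) ^ (2 * r))) / (real L * A)"
    unfolding F_def using L_pos A_pos by (intro divide_right_mono) auto
  also have "\<dots> = 1 / (2 * \<Delta>) ^ (2 * r) / A" using L_pos by simp
  also have "\<dots> \<le> tail \<Delta>" by (rule tail_ge[OF assms(2)])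
  finally show ?thesis .
qed

lemma K_periodic: "K (x + of_int m) = K x"
proof -
  have "ec (x + of_int m) = ec x * cis (2 * pi * of_int m)"
    by (simp add: cis_mult algebra_simps)
  also have "cis (2 * pi * of_int m) = 1" by (intro cis_multiple_2pi) auto
  finally show ?thesis by (simp add: K_def)
qed

text \<open>A full period of shifts has total weight 1. A shift missing from \<open>F J\<close> has
  \<open>|j| > J\<close> and so lies at distance at least \<open>\<Delta>\<close> from
  \<open>x\<close> modulo 1, where the kernel is small.\<close>

lemma F_inside:
  assumes \<delta>: "\<delta> \<le> 1/2" and \<Delta>: "0 < \<Delta>" and J: "\<delta> + \<Delta> \<le> real J / real L" and x: "\<bar>x - of_int m\<bar> \<le> \<delta>"
  shows "1 - tail \<Delta> \<le> F J x"
proof -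
  define y where "y = x - of_int m"
  have y: "\<bar>y\<bar> \<le> \<delta>" using x by (simp add: y_def)
  have Kxy: "K (x - u) = K (y - u)" for u using K_periodic[of "y - u" m] by (simp add: y_def algebra_simps)
  \<comment> \<open>The period is centred at \<open>y\<close>: then \<open>y - j / L\<close> is at
    most 1/2 in modulus, and subtracting a nonzero integer \<open>k\<close> leaves at least
    1/2.\<close>
  define b where "b = \<lceil>real L * (y - 1/2)\<rceil>"
  have b: "real L * (y - 1/2) \<le> of_int b" "of_int b < real L * (y - 1/2) + 1" unfolding b_def by linarith+
  define B1 where "B1 = {b..<b + int L} \<inter> symI J"
  define B2 where "B2 = {b..<b + int L} - symI J"
  have "real L * A = (\<Sum>j\<in>{b..<b + int L}. K (y - of_int j / real L))" by (rule K_period_sum[symmetric])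
  also have "\<dots> = (\<Sum>j\<in>B1. K (y - of_int j / real L)) + (\<Sum>j\<in>B2. K (y - of_int j / real L))"
    unfolding B1_def B2_def by (rule sum.Int_Diff) simp
  also have "(\<Sum>j\<in>B1. K (y - of_int j / real L)) \<le> (\<Sum>j\<in>symI J. K (y - of_int j / real L))"
    by (intro sum_mono2 K_nonneg) (auto simp: B1_def)
  also have "\<dots> = F J x * (real L * A)" unfolding F_def Kxy using L_pos A_pos by simp
  also have "(\<Sum>j\<in>B2. K (y - of_int j / real L)) \<le> (\<Sum>j\<in>B2. 1 / (2 * \<Delta>) ^ (2 * r))"
  proof (intro sum_mono K_tail \<Delta>)
    fix j k :: int assume j: "j \<in> B2"
    have "real L * (y - 1/2) \<le> of_int j" "of_int j < real L * (y - 1/2) + real L"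
    proof -
      have "b \<le> j" "j + 1 \<le> b + int L" using j by (auto simp: B2_def)
      then have "real_of_int b \<le> of_int j" "real_of_int j + 1 \<le> of_int b + real L" by linarith+
      then show "real L * (y - 1/2) \<le> of_int j" "of_int j < real L * (y - 1/2) + real L" using b by linarith+
    qed
    then have half: "y - 1/2 \<le> of_int j / real L" "of_int j / real L < y + 1/2"
      using L_pos by (auto simp: field_simps)
    have "int J < \<bar>j\<bar>" using j by (auto simp: B2_def)
    then have "real J \<le> \<bar>of_int j\<bar>" by linarith
    then have "real J / real L \<le> \<bar>of_int j / real L\<bar>" using L_pos by (simp add: divide_right_mono)
    then have "\<Delta> \<le> \<bar>y - of_int j / real L\<bar>" using J y by linarith
    then have "\<Delta> \<le> 1/2" using half by linarith
    consider "k = 0" | "1 \<le> real_of_int k" | "real_of_int k \<le> -1" by linarith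
    then show "\<Delta> \<le> \<bar>y - of_int j / real L - of_int k\<bar>"
    proof cases
      case 1
      then show ?thesis using \<open>\<Delta> \<le> \<bar>y - of_int j / real L\<bar>\<close> by simp
    qed (use half \<open>\<Delta> \<le> 1/2\<close> in linarith)+
  qed
  also have "\<dots> = real (card B2) * (1 / (2 * \<Delta>) ^ (2 * r))" by simp
  also have "\<dots> \<le> real L * (1 / (2 * \<Delta>) ^ (2 * r))"
  proof (intro mult_right_mono)
    have "card B2 \<le> card {b..<b + int L}" by (intro card_mono) (auto simp: B2_def)
    then show "real (card B2) \<le> real L" by simp
  qed (use \<Delta> in auto)
  finally have "real L * A \<le> F J x * (real L * A) + real L * (1 / (2 * \<Delta>) ^ (2 * r))" by simp
  then have "real L * A / (real L * A) \<le> (F J x * (real L * A) + real L * (1 / (2 * \<Delta>) ^ (2 * r))) / (real L * A)"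
    using L_pos A_pos by (intro divide_right_mono) auto
  then have "1 \<le> F J x + 1 / (2 * \<Delta>) ^ (2 * r) / A" using L_pos A_pos by (simp add: add_divide_distrib)
  then show ?thesis using tail_ge[OF \<Delta>] by linarith
qed

text \<open>Pairs \<open>(k, l)\<close> are not merged by their frequency \<open>k - l\<close>: kept
  apart, they show the constant term as a diagonal, and the bound for the sum of moduli
  factorises.\<close>

definition g :: "nat \<Rightarrow> nat \<Rightarrow> nat \<Rightarrow> complex" where
  "g J k l = a k * cnj (a l) * (\<Sum>j\<in>symI J. wave l k (of_int j / real L)) / (of_nat L * of_real A)"

lemma F_expand: "complex_of_real (F J x) = (\<Sum>k\<le>n. \<Sum>l\<le>n. g J k l * wave k l x)"
proof -
  have "complex_of_real (F J x) = complex_of_real (\<Sum>j\<in>symI J. K (x - of_int j / real L)) / (of_nat L * of_real A)"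
    by (simp only: F_def of_real_divide of_real_mult of_real_of_nat_eq)
  also have "\<dots> = (\<Sum>k\<le>n. \<Sum>l\<le>n. (\<Sum>j\<in>symI J. a k * cnj (a l) * wave k l (x - of_int j / real L)) / (of_nat L * of_real A))"
    unfolding K_sum_expand by (simp only: sum_divide_distrib)
  also have "\<dots> = (\<Sum>k\<le>n. \<Sum>l\<le>n. g J k l * wave k l x)"
  proof (intro sum.cong refl)
    fix k l
    have e: "wave k l (x - z) =
      wave l k z * wave k l x" for z
      by (simp add: cis_mult algebra_simps)
    have "(\<Sum>j\<in>symI J. a k * cnj (a l) * wave k l (x - of_int j / real L))
      = a k * cnj (a l) * (\<Sum>j\<in>symI J. wave l k (of_int j / real L)) * wave k l x"
      unfolding e sum_distrib_left sum_distrib_right by (intro sum.cong refl) (simp only: mult_ac)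
    then show "(\<Sum>j\<in>symI J. a k * cnj (a l) * wave k l (x - of_int j / real L)) / (of_nat L * of_real A)
      = g J k l * wave k l x"
      unfolding g_def by simp
  qed
  finally show ?thesis .
qed

lemma g_diag: "(\<Sum>k\<le>n. g J k k) = of_real (dens J)"
proof -
  have "g J k k = a k * cnj (a k) * (of_nat (2 * J + 1) / (of_nat L * of_real A))" for k
    by (simp add: g_def add.commute)
  then have "(\<Sum>k\<le>n. g J k k) = (\<Sum>k\<le>n. a k * cnj (a k)) * (of_nat (2 * J + 1) / (of_nat L * of_real A))"
    by (simp only: sum_distrib_right)
  also have "(\<Sum>k\<le>n. a k * cnj (a k)) = of_real A"
    by (simp add: A_def complex_norm_square del: of_real_power)
  finally show ?thesis using A_pos by simp
qed

text \<open>The normalisation by \<open>A\<close> cancels against Cauchy's bound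
  \<open>coeff_l1\<close>. In the application \<open>dens J\<close> is about the width of the box
  and \<open>n\<close> its reciprocal times a small power of \<open>t\<close>, so only that power is
  lost.\<close>

lemma g_l1: "(\<Sum>k\<le>n. \<Sum>l\<le>n. cmod (g J k l)) \<le> dens J * (real n + 1)"
proof -
  have "cmod (g J k l) \<le> cmod (a k) * cmod (a l) * (real (2 * J + 1) / (real L * A))" for k l
  proof -
    have "cmod (\<Sum>j\<in>symI J. wave l k (of_int j / real L)) \<le> (\<Sum>j\<in>symI J. 1)"
      by (rule sum_norm_le) simp
    also have "\<dots> = real (2 * J + 1)" by simp
    finally have "cmod (a k) * cmod (a l) * cmod (\<Sum>j\<in>symI J. wave l k (of_int j / real L)) / (real L * A)
      \<le> cmod (a k) * cmod (a l) * real (2 * J + 1) / (real L * A)"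
      using A_pos by (intro divide_right_mono mult_left_mono) auto
    then show ?thesis using A_pos by (simp add: g_def norm_mult norm_divide)
  qed
  then have "(\<Sum>k\<le>n. \<Sum>l\<le>n. cmod (g J k l)) \<le> (\<Sum>k\<le>n. \<Sum>l\<le>n. cmod (a k) * cmod (a l) * (real (2 * J + 1) / (real L * A)))"
    by (intro sum_mono)
  also have "\<dots> = (\<Sum>k\<le>n. cmod (a k))^2 * (real (2 * J + 1) / (real L * A))"
    by (simp only: power2_eq_square sum_product[symmetric] sum_distrib_right[symmetric])
  also have "\<dots> \<le> (real n + 1) * A * (real (2 * J + 1) / (real L * A))"
    using coeff_l1 A_pos by (intro mult_right_mono) auto
  also have "\<dots> = dens J * (real n + 1)" using A_pos by simp
  finally show ?thesis .
qed

text \<open>Both factors are expanded into characters. The constant terms give the expected density,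
  and every other frequency is a nonzero Gaussian integer \<open>h\<close>, to which the bound
  \<open>E\<close> applies.\<close>

lemma F_product_sum:
  fixes P :: "complex set"
  assumes P: "finite P" and E: "0 \<le> E"
    and exp_sum: "\<And>h. h \<in> ZI \<Longrightarrow> h \<noteq> 0 \<Longrightarrow> cmod h \<le> 2 * real n \<Longrightarrow> cmod (\<Sum>p\<in>P. ee (p * (h * c))) \<le> E"
  shows "\<bar>(\<Sum>p\<in>P. F J (Re (p * c)) * F J (Im (p * c))) - (dens J)^2 * real (card P)\<bar>
    \<le> (dens J * (real n + 1))^2 * E"
proof -
  define S where "S = {..n} \<times> {..n}"
  define G where "G = (\<lambda>(k, l). g J k l)"
  \<comment> \<open>The inner minus sign offsets the one in
    \<open>Re (h * z) = Re h * Re z - Im h * Im z\<close>, so that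
    \<open>Re (h * z) = (k - l) * Re z + (k' - l') * Im z\<close>.\<close>
  define h where "h = (\<lambda>((k, l), (k', l')). Complex (real k - real l) (- (real k' - real l')) :: complex)"
  let ?E = "\<lambda>u v. \<Sum>p\<in>P. ee (p * (h (u, v) * c))" and ?T = "\<Sum>p\<in>P. F J (Re (p * c)) * F J (Im (p * c))"
  have finS: "finite S" by (simp add: S_def)
  have F: "complex_of_real (F J x) = (\<Sum>u\<in>S. G u * ec ((real (fst u) - real (snd u)) * x))" for x
    unfolding F_expand S_def G_def by (simp add: sum.cartesian_product case_prod_beta)
  have "complex_of_real ?T =
     (\<Sum>p\<in>P. \<Sum>u\<in>S. \<Sum>v\<in>S. G u * G v * ee (p * (h (u, v) * c)))"
    unfolding of_real_sum of_real_mult F sum_product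
    by (intro sum.cong refl) (auto simp: ee_def h_def cis_mult algebra_simps split: prod.splits)
  also have "\<dots> = (\<Sum>u\<in>S. \<Sum>v\<in>S. \<Sum>p\<in>P. G u * G v * ee (p * (h (u, v) * c)))"
    by (rule trans[OF sum.swap]) (rule sum.cong[OF refl], rule sum.swap)
  finally have e1: "complex_of_real ?T =
    (\<Sum>u\<in>S. \<Sum>v\<in>S. G u * G v * ?E u v)"
    by (simp add: sum_distrib_left)
  \<comment> \<open>\<open>D\<close> selects frequency zero, where the sum over \<open>P\<close> is
    \<open>card P\<close>.\<close>
  define D where "D = (\<lambda>u :: nat \<times> nat. if fst u = snd u then 1 else 0 :: complex)"
  have GD: "(\<Sum>u\<in>S. G u * D u) = of_real (dens J)"
  proof -
    have "(\<Sum>u\<in>S. G u * D u) = (\<Sum>k\<le>n. \<Sum>l\<le>n. g J k l * (if k = l then 1 else 0))"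
      unfolding S_def G_def D_def by (simp add: sum.cartesian_product case_prod_beta)
    also have "\<dots> = (\<Sum>k\<le>n. g J k k)"
    proof (rule sum.cong[OF refl])
      fix k assume k: "k \<in> {..n}"
      have "(\<Sum>l\<le>n. g J k l * (if k = l then 1 else 0)) = (\<Sum>l\<le>n. if k = l then g J k l else 0)"
        by (intro sum.cong) auto
      then show "(\<Sum>l\<le>n. g J k l * (if k = l then 1 else 0)) = g J k k" using k by simp
    qed
    finally show ?thesis by (simp add: g_diag)
  qed
  have "complex_of_real ((dens J)^2 * real (card P)) = (\<Sum>u\<in>S. G u * D u) * (\<Sum>v\<in>S. G v * D v) * of_nat (card P)"
    unfolding GD by (simp add: power2_eq_square)
  also have "\<dots> = (\<Sum>u\<in>S. \<Sum>v\<in>S. (G u * D u) * (G v * D v) * of_nat (card P))"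
    by (subst sum_product) (simp only: sum_distrib_right)
  also have "\<dots> = (\<Sum>u\<in>S. \<Sum>v\<in>S. G u * G v * (D u * D v * of_nat (card P)))"
    by (intro sum.cong refl) (simp add: mult_ac)
  finally have e2: "complex_of_real ((dens J)^2 * real (card P)) = \<dots>" .
  have "\<bar>?T - (dens J)^2 * real (card P)\<bar>
    = cmod ((\<Sum>u\<in>S. \<Sum>v\<in>S. G u * G v * ?E u v) - (\<Sum>u\<in>S. \<Sum>v\<in>S. G u * G v * (D u * D v * of_nat (card P))))"
    unfolding e1[symmetric] e2[symmetric] of_real_diff[symmetric] norm_of_real ..
  also have "\<dots> = cmod (\<Sum>u\<in>S. \<Sum>v\<in>S. G u * G v * (?E u v - D u * D v * of_nat (card P)))"
    by (simp add: sum_subtractf right_diff_distrib)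
  also have "\<dots> \<le> (\<Sum>u\<in>S. \<Sum>v\<in>S. cmod (G u) * cmod (G v) * E)"
  proof (intro sum_norm_le)
    fix u v assume uv: "u \<in> S" "v \<in> S"
    obtain k l k' l' where kl: "u = (k, l)" "v = (k', l')" by (cases u, cases v)
    have le: "k \<le> n" "l \<le> n" "k' \<le> n" "l' \<le> n" using uv by (auto simp: S_def kl)
    have "cmod (?E u v - D u * D v * of_nat (card P)) \<le> E"
    proof (cases "k = l \<and> k' = l'")
      case True
      then have "h (u, v) = 0" by (simp add: h_def kl complex_eq_iff)
      then show ?thesis using True E by (simp add: D_def kl)
    next
      case False
      then have "D u * D v = 0" by (auto simp: D_def kl)
      then have D0: "D u * D v * of_nat (card P) = 0" by simp
      from False have "h (u, v) \<noteq> 0" by (auto simp: h_def kl complex_eq_iff)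
      moreover have "h (u, v) \<in> ZI" by (auto simp: h_def kl gauss_ints_def)
      moreover have "cmod (h (u, v)) \<le> \<bar>real k - real l\<bar> + \<bar>real k' - real l'\<bar>"
        using cmod_le[of "h (u, v)"] by (simp add: h_def kl)
      then have "cmod (h (u, v)) \<le> 2 * real n" using le by linarith
      ultimately show ?thesis unfolding D0 using exp_sum[of "h (u, v)"] by simp
    qed
    then show "cmod (G u * G v * (?E u v - D u * D v * of_nat (card P))) \<le> cmod (G u) * cmod (G v) * E"
      by (simp add: norm_mult mult_left_mono)
  qed
  also have "\<dots> = (\<Sum>u\<in>S. cmod (G u))^2 * E"
    unfolding power2_eq_square by (subst sum_product) (simp only: sum_distrib_right)
  also have "\<dots> \<le> (dens J * (real n + 1))^2 * E"
  proof (intro mult_right_mono power_mono E sum_nonneg)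
    have "(\<Sum>u\<in>S. cmod (G u)) = (\<Sum>k\<le>n. \<Sum>l\<le>n. cmod (g J k l))"
      unfolding S_def G_def by (simp add: sum.cartesian_product case_prod_beta)
    then show "(\<Sum>u\<in>S. cmod (G u)) \<le> dens J * (real n + 1)" using g_l1 by simp
  qed auto
  finally show ?thesis .
qed

end

section \<open>From kernels to the number of points in a box\<close>

definition near_int :: "real \<Rightarrow> real \<Rightarrow> bool" where
  "near_int \<delta> x \<longleftrightarrow> (\<exists>m :: int. \<bar>x - of_int m\<bar> \<le> \<delta>)"

text \<open>Up to \<open>\<tau>\<close>, \<open>F J\<close> with
  \<open>J / L \<ge> \<delta> + \<Delta>\<close> is a majorant of the interval and
  \<open>F J'\<close> with \<open>J' / L \<le> \<delta> - \<Delta>\<close> a minorant. Their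
  densities differ from \<open>2 * \<delta>\<close> by at most \<open>5 * \<Delta>\<close>, and
  \<open>\<Delta> \<le> \<delta>\<close> turns the squares into an error of
  \<open>45 * (\<delta> * \<Delta>)\<close>.\<close>

lemma box_count:
  fixes P :: "complex set"
  assumes P: "finite P" and E: "0 \<le> E" and Hr: "1 \<le> H" "1 \<le> r"
    and \<delta>: "0 < \<delta>" "\<delta> \<le> 1/2" and \<Delta>: "0 < \<Delta>" "2 * \<Delta> \<le> \<delta>"
    and exp_sum: "\<And>h. h \<in> ZI \<Longrightarrow> h \<noteq> 0 \<Longrightarrow> cmod h \<le> 2 * real (r * H) \<Longrightarrow> cmod (\<Sum>p\<in>P. ee (p * (h * c))) \<le> E"
    and \<tau>: "(real (r * H) + 1) / (2 * real H * \<Delta>) ^ (2 * r) \<le> \<tau>" "\<tau> \<le> 1"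
  shows "\<bar>real (card {p \<in> P. near_int \<delta> (Re (p * c)) \<and> near_int \<delta> (Im (p * c))}) - 4 * \<delta>^2 * real (card P)\<bar>
    \<le> (45 * (\<delta> * \<Delta>) + 2 * \<tau>) * real (card P) + 49 * \<delta>^2 * (real (r * H) + 1)^2 * E"
proof -
  \<comment> \<open>\<open>L > r * H\<close> is required by the kernel, and
    \<open>1 / L < \<Delta>\<close> lets \<open>\<Delta>\<close> absorb the rounding of
    \<open>J\<close> and \<open>J'\<close>.\<close>
  obtain L :: nat where Lb: "real (r * H) < real L" "1 / \<Delta> < real L"
    using reals_Archimedean2[of "max (real (r * H)) (1 / \<Delta>)"] by auto
  interpret kernel H r L
    by unfold_locales (use Hr Lb(1) in \<open>simp_all only: of_nat_less_iff\<close>)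
  define v where "v = 1 / real L"
  have L0: "0 < real L" "v < \<Delta>" using L_pos Lb(2) \<Delta> by (auto simp: v_def field_simps)
  let ?near = "\<lambda>p. near_int \<delta> (Re (p * c)) \<and> near_int \<delta> (Im (p * c))"
  let ?F = "\<lambda>J p. F J (Re (p * c)) * F J (Im (p * c))"
  have \<tau>': "tail \<Delta> \<le> \<tau>" using \<tau> by (simp add: tail_def n_def)
  define B where "B = {p \<in> P. ?near p}"
  define N where "N = real (card P)"
  have B: "real (card B) = (\<Sum>p\<in>P. if ?near p then 1 else 0)"
    unfolding B_def using P by (simp add: sum.inter_filter[symmetric])
  define J where "J = nat \<lceil>(\<delta> + \<Delta>) * real L\<rceil>"
  define J' where "J' = nat \<lfloor>(\<delta> - \<Delta>) * real L\<rfloor>"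
  have "0 \<le> (\<delta> + \<Delta>) * real L" "0 \<le> (\<delta> - \<Delta>) * real L" using \<delta> \<Delta> by auto
  then have J: "(\<delta> + \<Delta>) * real L \<le> real J" "real J \<le> (\<delta> + \<Delta>) * real L + 1"
    and J': "(\<delta> - \<Delta>) * real L - 1 \<le> real J'" "real J' \<le> (\<delta> - \<Delta>) * real L"
    unfolding J_def J'_def by linarith+
  define q where "q = real (2 * J + 1) / real L"
  define q' where "q' = real (2 * J' + 1) / real L"
  have "q \<le> (2 * ((\<delta> + \<Delta>) * real L + 1) + 1) / real L"
    unfolding q_def using J L0 by (intro divide_right_mono) auto
  also have "\<dots> = 2 * (\<delta> + \<Delta>) + 3 * v" using L0 by (simp add: v_def field_simps)
  finally have qu: "q \<le> 2 * \<delta> + 5 * \<Delta>" using L0(2) by (simp add: algebra_simps)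
  have q0: "0 \<le> q" "0 \<le> q'" by (auto simp: q_def q'_def)
  have "q' \<le> (2 * ((\<delta> - \<Delta>) * real L) + 1) / real L"
    unfolding q'_def using J' L0 by (intro divide_right_mono) auto
  also have "\<dots> = 2 * (\<delta> - \<Delta>) + v" using L0 by (simp add: v_def field_simps)
  finally have q'u: "q' \<le> 2 * \<delta> - \<Delta>" using L0(2) by (simp add: algebra_simps)
  have "(2 * ((\<delta> - \<Delta>) * real L - 1) + 1) / real L \<le> q'"
    unfolding q'_def using J' L0 by (intro divide_right_mono) auto
  moreover have "(2 * ((\<delta> - \<Delta>) * real L - 1) + 1) / real L = 2 * (\<delta> - \<Delta>) - v"
    using L0 by (simp add: v_def field_simps)
  ultimately have q'l: "2 * \<delta> - 3 * \<Delta> \<le> q'" using L0(2) by (simp add: algebra_simps)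
  \<comment> \<open>The minorant must satisfy \<open>F J' \<le> 1\<close>, hence at most one period
    of shifts; those of the majorant may exceed a period when \<open>\<delta>\<close> is near
    1/2.\<close>
  have J'L: "2 * J' + 1 \<le> L"
  proof -
    have "q' \<le> 1" using q'u \<delta> \<Delta> by linarith
    then have "real (2 * J' + 1) \<le> real L" using L0 by (simp add: q'_def)
    then show ?thesis by linarith
  qed
  have es: "cmod (\<Sum>p\<in>P. ee (p * (h * c))) \<le> E" if "h \<in> ZI" "h \<noteq> 0" "cmod h \<le> 2 * real n" for h
    using exp_sum that by (simp add: n_def)
  have qE: "(x * (real n + 1))^2 * E \<le> 49 * \<delta>^2 * (real n + 1)^2 * E" if "0 \<le> x" "x \<le> 7 * \<delta>" for x
  proof -
    have "x^2 \<le> (7 * \<delta>)^2" using that by (intro power_mono)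
    then have "x^2 * ((real n + 1)^2 * E) \<le> 49 * \<delta>^2 * ((real n + 1)^2 * E)"
      using E by (intro mult_right_mono) (auto simp: power_mult_distrib)
    then show ?thesis by (simp add: power_mult_distrib mult_ac)
  qed
  have \<tau>0: "0 \<le> \<tau>"
    by (rule order_trans[OF _ \<tau>(1)]) (use \<Delta> in auto)
  have "real (card B) \<le> (\<Sum>p\<in>P. ?F J p + 2 * \<tau>)"
    unfolding B
  proof (rule sum_mono)
    fix p
    show "(if ?near p then 1 else 0) \<le> ?F J p + 2 * \<tau>"
    proof (cases "?near p")
      case True
      have "\<delta> + \<Delta> \<le> real J / real L" using J L0 by (simp add: field_simps)
      then have "1 - \<tau> \<le> F J (Re (p * c))" "1 - \<tau> \<le> F J (Im (p * c))"
        using True F_inside[OF \<delta>(2) \<Delta>(1)] \<tau>' unfolding near_int_def by fastforce+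
      then have "(1 - \<tau>) * (1 - \<tau>) \<le> ?F J p"
        using \<tau> by (intro mult_mono F_nonneg) auto
      moreover have "1 - 2 * \<tau> \<le> (1 - \<tau>) * (1 - \<tau>)" by (simp add: algebra_simps)
      ultimately show ?thesis using True by simp
    qed (use F_nonneg \<tau>0 in auto)
  qed
  also have "\<dots> = (\<Sum>p\<in>P. ?F J p) + 2 * \<tau> * N" by (simp add: sum.distrib N_def)
  also have "(\<Sum>p\<in>P. ?F J p) \<le> q^2 * N + (q * (real n + 1))^2 * E"
    using F_product_sum[OF P E es, of J] unfolding q_def N_def by linarith
  also have "q^2 * N \<le> (4 * \<delta>^2 + 45 * (\<delta> * \<Delta>)) * N"
  proof (rule mult_right_mono)
    have "q^2 \<le> (2 * \<delta> + 5 * \<Delta>)^2" using qu q0 by (intro power_mono) auto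
    also have "\<dots> = 4 * \<delta>^2 + 20 * (\<delta> * \<Delta>) + 25 * (\<Delta> * \<Delta>)" by (simp add: power2_eq_square algebra_simps)
    also have "\<Delta> * \<Delta> \<le> \<delta> * \<Delta>" using \<Delta> by (intro mult_right_mono) auto
    finally show "q^2 \<le> 4 * \<delta>^2 + 45 * (\<delta> * \<Delta>)" by (simp add: mult_ac add_ac)
  qed (simp add: N_def)
  also have "(q * (real n + 1))^2 * E \<le> 49 * \<delta>^2 * (real n + 1)^2 * E" using qu q0 \<Delta> by (intro qE) auto
  finally have upper: "real (card B) - 4 * \<delta>^2 * N \<le> (45 * (\<delta> * \<Delta>) + 2 * \<tau>) * N + 49 * \<delta>^2 * (real n + 1)^2 * E"
    by (simp add: algebra_simps)
  have "(\<Sum>p\<in>P. ?F J' p - \<tau>) \<le> real (card B)"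
    unfolding B
  proof (rule sum_mono)
    fix p
    have F01: "0 \<le> F J' x" "F J' x \<le> 1" for x using F_nonneg F_le_1[OF J'L] by auto
    have far: "F J' x \<le> \<tau>" if "\<not> near_int \<delta> x" for x
    proof -
      have "real J' / real L + \<Delta> \<le> \<delta>" using J' L0 by (simp add: field_simps)
      then have "F J' x \<le> tail \<Delta>"
        using that by (intro F_outside[OF J'L \<Delta>(1)]) (auto simp: near_int_def not_le)
      then show ?thesis using \<tau>' by linarith
    qed
    have prod1: "F J' x * F J' y \<le> F J' x" "F J' x * F J' y \<le> F J' y" for x y
      using F01 by (auto intro: mult_left_le mult_left_le_one_le)
    \<comment> \<open>One far coordinate already brings the product down to \<open>\<tau>\<close>,
      as the other factor is at most 1.\<close>
    show "?F J' p - \<tau> \<le> (if ?near p then 1 else 0)"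
      using prod1[of "Re (p * c)" "Im (p * c)"] far[of "Re (p * c)"] far[of "Im (p * c)"] F01(2)[of "Re (p * c)"] \<tau>0 by auto
  qed
  then have "(\<Sum>p\<in>P. ?F J' p) - \<tau> * N \<le> real (card B)"
    by (simp add: sum_subtractf N_def mult.commute)
  moreover have "q'^2 * N - (q' * (real n + 1))^2 * E \<le> (\<Sum>p\<in>P. ?F J' p)"
    using F_product_sum[OF P E es, of J'] unfolding q'_def N_def by linarith
  moreover have "(4 * \<delta>^2 - 45 * (\<delta> * \<Delta>)) * N \<le> q'^2 * N"
  proof (rule mult_right_mono)
    have "(2 * \<delta> - 3 * \<Delta>)^2 \<le> q'^2" using q'l \<Delta> by (intro power_mono) auto
    moreover have "(2 * \<delta> - 3 * \<Delta>)^2 = 4 * \<delta>^2 - 12 * (\<delta> * \<Delta>) + 9 * (\<Delta> * \<Delta>)" by (simp add: power2_eq_square algebra_simps)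
    moreover have "0 \<le> \<delta> * \<Delta>" "0 \<le> \<Delta> * \<Delta>" using \<delta> \<Delta> by auto
    ultimately show "4 * \<delta>^2 - 45 * (\<delta> * \<Delta>) \<le> q'^2" by linarith
  qed (simp add: N_def)
  moreover have "(q' * (real n + 1))^2 * E \<le> 49 * \<delta>^2 * (real n + 1)^2 * E" using q'u q0 \<Delta> \<delta> by (intro qE) auto
  moreover have "0 \<le> \<tau> * N" using \<tau>0 by (simp add: N_def)
  ultimately have lower: "4 * \<delta>^2 * N - real (card B) \<le> (45 * (\<delta> * \<Delta>) + 2 * \<tau>) * N + 49 * \<delta>^2 * (real n + 1)^2 * E"
    by (simp add: algebra_simps)
  show ?thesis using upper lower unfolding B_def N_def n_def by linarith
qed

section \<open>Sectors and the final estimate\<close>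

lemma convex_Im_halfplanes: "convex {z. 0 < Im (z * w)}" "convex {z. Im (z * w) \<le> 0}"
proof -
  have "Im (z * w) = Complex (Im w) (Re w) \<bullet> z" for z
    by (simp add: inner_complex_def algebra_simps)
  then show "convex {z. 0 < Im (z * w)}" "convex {z. Im (z * w) \<le> 0}"
    using convex_halfspace_gt[of 0 "Complex (Im w) (Re w)"] convex_halfspace_le[of "Complex (Im w) (Re w)" 0]
    by auto
qed

text \<open>An opening of at most \<open>pi / 2\<close> makes the sector an intersection of
  half-planes with a disc, hence convex. The half-open range of angles becomes one strict and one
  weak inequality, and the strict one also excludes 0.\<close>

lemma polar_region_sector_eq:
  assumes "a < b" "b \<le> a + pi / 2"
  shows "polar_region 0 P a b = {z. 0 < Im (z * cis (- a))} \<inter> {z. Im (z * cis (- b)) \<le> 0} \<inter> cball 0 P"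
proof (intro set_eqI iffI)
  fix z assume "z \<in> polar_region 0 P a b"
  then obtain R \<theta> where R: "0 < R" "R \<le> P" "a < \<theta>" "\<theta> \<le> b" "z = of_real R * cis \<theta>"
    by (auto simp: polar_region_def)
  have eq: "Im (z * cis (- a)) = R * sin (\<theta> - a)" "Im (z * cis (- b)) = - (R * sin (b - \<theta>))"
    by (simp_all add: R sin_diff algebra_simps)
  have "0 < sin (\<theta> - a)" using R assms pi_gt_zero by (intro sin_gt_zero) linarith+
  then have i1: "0 < Im (z * cis (- a))" unfolding eq using R by simp
  have "0 \<le> sin (b - \<theta>)" using R assms pi_gt_zero by (intro sin_ge_zero) linarith+
  then have i2: "Im (z * cis (- b)) \<le> 0" unfolding eq using R by simp
  have "z \<in> cball 0 P" using R by (simp add: norm_mult)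
  with i1 i2 show "z \<in> {z. 0 < Im (z * cis (- a))} \<inter> {z. Im (z * cis (- b)) \<le> 0} \<inter> cball 0 P"
    by (intro IntI CollectI)
next
  fix z assume z: "z \<in> {z. 0 < Im (z * cis (- a))} \<inter> {z. Im (z * cis (- b)) \<le> 0} \<inter> cball 0 P"
  define w where "w = z * cis (- a)"
  define \<phi> where "\<phi> = Arg w"
  have zw: "z = w * cis a" by (simp add: w_def mult.assoc cis_mult)
  have w0: "w \<noteq> 0" using z by (auto simp: w_def)
  have \<phi>: "0 < \<phi>" "\<phi> < pi" using z Arg_lt_pi[of w] unfolding \<phi>_def w_def by auto
  have wR: "w = of_real (cmod w) * cis \<phi>"
    using rcis_cmod_Arg[of w] by (simp add: \<phi>_def rcis_def)
  have z2: "z = of_real (cmod w) * cis (a + \<phi>)"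
    unfolding zw by (subst wR) (simp add: cis_mult mult.assoc add.commute)
  have "Im (z * cis (- b)) = cmod w * sin (a + \<phi> - b)"
    unfolding z2 by (simp add: mult.assoc cis_mult)
  moreover have "Im (z * cis (- b)) \<le> 0" using z by blast
  ultimately have "cmod w * sin (a + \<phi> - b) \<le> 0" by (simp only:)
  then have "sin (a + \<phi> - b) \<le> 0" using w0 by (simp add: mult_le_0_iff)
  then have "a + \<phi> \<le> b" using sin_gt_zero[of "a + \<phi> - b"] \<phi> assms by linarith
  moreover have "cmod w = cmod z" by (simp add: zw norm_mult)
  ultimately show "z \<in> polar_region 0 P a b"
    unfolding polar_region_def using z2 \<phi> w0 z
    by (intro CollectI exI[of _ "cmod w"] exI[of _ "a + \<phi>"]) auto
qed

lemma polar_region_norm: "z \<in> polar_region A P a b \<Longrightarrow> 0 \<le> A \<Longrightarrow> A < cmod z \<and> cmod z \<le> P"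
  by (auto simp: polar_region_def norm_mult)

lemma polar_region_image:
  "polar_region A P a b = (\<lambda>(R, \<theta>). of_real R * cis \<theta>) ` ({A<..P} \<times> {a<..b})"
  unfolding polar_region_def by (force simp: image_iff)

lemma polar_region_split_radius:
  assumes "0 \<le> A" "A \<le> P"
  shows "polar_region 0 P a b = polar_region 0 A a b \<union> polar_region A P a b"
    "polar_region 0 A a b \<inter> polar_region A P a b = {}"
proof -
  have "{0<..P} = {0<..A} \<union> {A<..P}" using assms by auto
  then show "polar_region 0 P a b = polar_region 0 A a b \<union> polar_region A P a b"
    unfolding polar_region_image by (simp only: Sigma_Un_distrib1 image_Un)
  show "polar_region 0 A a b \<inter> polar_region A P a b = {}"
    using polar_region_norm[of _ 0 A a b] polar_region_norm[of _ A P a b] assms by fastforce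
qed

lemma polar_region_split_angle:
  assumes "0 \<le> A" "a \<le> m" "m \<le> b" "b \<le> a + 2 * pi"
  shows "polar_region A P a b = polar_region A P a m \<union> polar_region A P m b"
    "polar_region A P a m \<inter> polar_region A P m b = {}"
proof -
  have "{a<..b} = {a<..m} \<union> {m<..b}" using assms by auto
  then show "polar_region A P a b = polar_region A P a m \<union> polar_region A P m b"
    unfolding polar_region_image by (simp only: Sigma_Un_distrib2 image_Un)
  \<comment> \<open>Equal points have equal moduli and angles congruent modulo
    \<open>2 * pi\<close>, but two angles in \<open>{a<..b}\<close> differ by less than
    \<open>2 * pi\<close>.\<close>
  show "polar_region A P a m \<inter> polar_region A P m b = {}"
  proof (rule ccontr)
    assume "polar_region A P a m \<inter> polar_region A P m b \<noteq> {}"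
    then obtain R \<theta> R' \<theta>' where *: "A < R" "a < \<theta>" "\<theta> \<le> m" "A < R'" "m < \<theta>'" "\<theta>' \<le> b"
      "complex_of_real R * cis \<theta> = of_real R' * cis \<theta>'"
      by (auto simp: polar_region_def)
    have pos: "0 < R" "0 < R'" using * assms by auto
    have "cmod (complex_of_real R * cis \<theta>) = cmod (of_real R' * cis \<theta>')" using * by simp
    then have "R = R'" using pos by (simp add: norm_mult)
    then have "cis \<theta> = cis \<theta>'" using * pos by simp
    then have "cis (\<theta>' - \<theta>) = 1" by (simp add: cis_divide[symmetric])
    define x where "x = (\<theta>' - \<theta>) / (2 * pi)"
    have "\<theta>' - \<theta> < 2 * pi" "0 < \<theta>' - \<theta>" using * assms by auto
    then have x: "0 < x" "x < 1" by (auto simp: x_def field_simps)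
    have "ec x = 1" using \<open>cis (\<theta>' - \<theta>) = 1\<close> by (simp add: x_def)
    then have "dint x = 0" by (rule cis_eq_1_dint)
    then have "x = of_int (round x)" by (simp add: dint_def)
    then have "0 < round x" "round x < 1" using x by linarith+
    then show False by simp
  qed
qed

section \<open>Prime sums over annular sectors\<close>

locale good_scale =
  fixes c :: complex and N :: nat and t :: real
  assumes N: "\<And>j z. j \<in> ZI \<Longrightarrow> j \<noteq> 0 \<Longrightarrow> (cmod j)^2 < real N \<Longrightarrow> z \<in> ZI \<Longrightarrow>
      1 / (2 * sqrt (real N)) \<le> cmod (j * c - z)"
    and t: "2 \<le> t" "t ^ 6 = real N"
begin

lemma sqrt_N: "sqrt (real N) = t ^ 3"
proof -
  have "(t ^ 3)^2 = real N" using t by (simp add: power_mult[symmetric])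
  then show ?thesis by (rule real_sqrt_unique) (use t in auto)
qed

text \<open>An approximation of \<open>k * (h * c)\<close> is one of \<open>j * c\<close> for
  \<open>j = k * h\<close>, and \<open>|j|^2 < t ^ 6 = N\<close>.\<close>

lemma spaced_multiple:
  assumes h: "h \<in> ZI" "h \<noteq> 0"
  shows "spaced (h * c) (t ^ 3 / cmod h) (1 / (2 * t ^ 3))"
  unfolding spaced_def
proof (intro ballI impI)
  fix k z assume k: "k \<in> ZI" "k \<noteq> 0" "cmod k < t ^ 3 / cmod h" "z \<in> ZI"
  have "cmod (k * h) < t ^ 3" using k h by (simp add: norm_mult field_simps)
  then have "(cmod (k * h))^2 < (t ^ 3)^2" by (intro power_strict_mono) auto
  then have "(cmod (k * h))^2 < real N" using t by (simp add: power_mult[symmetric])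
  then have "1 / (2 * sqrt (real N)) \<le> cmod (k * h * c - z)" using k h by (intro N) auto
  then show "1 / (2 * t ^ 3) \<le> cmod (k * (h * c) - z)" by (simp add: sqrt_N mult.assoc)
qed

definition EB :: real where "EB = 4000000 * (1 + ln t)^2 * t ^ 22"

definition psum :: "complex \<Rightarrow> complex set \<Rightarrow> complex" where
  "psum h R = (\<Sum>p\<in>(primes_in R). ee (p * (h * c)))"

lemma finite_primes: "(\<And>z. z \<in> R \<Longrightarrow> cmod z \<le> B) \<Longrightarrow> finite (primes_in R)"
  by (rule finite_subset[OF _ finite_gball[of B]]) (auto simp: gball_def gauss_prime_def)

lemma psum_union:
  assumes "R1 \<inter> R2 = {}" "\<And>z. z \<in> R1 \<union> R2 \<Longrightarrow> cmod z \<le> B"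
  shows "psum h (R1 \<union> R2) = psum h R1 + psum h R2"
proof -
  have "(primes_in (R1 \<union> R2)) = (primes_in R1) \<union> (primes_in R2)"
    by auto
  moreover have "finite (primes_in R1)" "finite (primes_in R2)"
    using assms(2) by (auto intro!: finite_primes[of _ B])
  ultimately show ?thesis unfolding psum_def using assms(1) by (simp add: sum.union_disjoint disjoint_iff)
qed

lemma psum_sector:
  assumes h: "h \<in> ZI" "h \<noteq> 0" "cmod h \<le> t" and ab: "a < b" "b \<le> a + pi / 2" and P: "P \<le> t ^ 12"
  shows "cmod (psum h (polar_region 0 P a b)) \<le> EB"
proof -
  have h1: "1 \<le> cmod h" using h by (intro gauss_ints_norm_ge_1)
  interpret sum_setup "h * c" t "t ^ 3 / cmod h" "1 / (2 * t ^ 3)" "t ^ 12" "polar_region 0 P a b"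
  proof
    show "2 \<le> t" by (rule t)
    show "spaced (h * c) (t ^ 3 / cmod h) (1 / (2 * t ^ 3))" by (rule spaced_multiple[OF h(1,2)])
    have "t^2 * cmod h \<le> t^2 * t" using h by (intro mult_left_mono) auto
    also have "\<dots> = t ^ 3" by (simp add: power2_eq_square power3_eq_cube)
    finally have "t^2 * cmod h \<le> t ^ 3" .
    then show "t^2 \<le> t ^ 3 / cmod h" using h1 by (subst pos_le_divide_eq) auto
    have "t ^ 3 / cmod h \<le> t ^ 3 / 1" using h1 t by (intro divide_left_mono) auto
    then show "t ^ 3 / cmod h \<le> t ^ 3" by simp
    show "convex (polar_region 0 P a b)"
      unfolding polar_region_sector_eq[OF ab] by (intro convex_Int convex_Im_halfplanes convex_cball)
    show "z \<noteq> 0 \<and> cmod z \<le> t ^ 12" if "z \<in> polar_region 0 P a b" for z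
      using polar_region_norm[OF that] P by auto
  qed auto
  show ?thesis unfolding psum_def EB_def by (rule prime_exponential_sum)
qed

lemma EB_nonneg: "0 \<le> EB"
  using t by (simp add: EB_def)

text \<open>An annular sector need not be convex, but it is the difference of two sectors with
  vertex 0.\<close>

lemma psum_quarter:
  assumes h: "h \<in> ZI" "h \<noteq> 0" "cmod h \<le> t" and ab: "a < b" "b \<le> a + pi / 2" and P: "0 \<le> A" "A \<le> P" "P \<le> t ^ 12"
  shows "cmod (psum h (polar_region A P a b)) \<le> 2 * EB"
proof -
  have "psum h (polar_region 0 P a b) = psum h (polar_region 0 A a b) + psum h (polar_region A P a b)"
    unfolding polar_region_split_radius(1)[OF P(1,2)]
  proof (rule psum_union[OF polar_region_split_radius(2)[OF P(1,2)]])
    fix z assume "z \<in> polar_region 0 A a b \<union> polar_region A P a b"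
    then show "cmod z \<le> P" using P polar_region_norm[of z 0 A a b] polar_region_norm[of z A P a b] by auto
  qed
  then have "psum h (polar_region A P a b) = psum h (polar_region 0 P a b) - psum h (polar_region 0 A a b)" by simp
  also have "cmod \<dots> \<le> EB + EB"
    using P by (intro order_trans[OF norm_triangle_ineq4] add_mono psum_sector h ab) auto
  finally show ?thesis by simp
qed

lemma psum_bisect:
  assumes "a < b" "b \<le> a + 2 * W" "W \<le> pi" and A: "0 \<le> A"
    and bound: "\<And>a b. a < b \<Longrightarrow> b \<le> a + W \<Longrightarrow> cmod (psum h (polar_region A P a b)) \<le> X"
  shows "cmod (psum h (polar_region A P a b)) \<le> 2 * X"
proof -
  define m where "m = (a + b) / 2"
  have m: "a < m" "m < b" "m \<le> a + W" "b \<le> m + W" using assms by (auto simp: m_def field_simps)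
  have "b \<le> a + 2 * pi" using assms by linarith
  note split = polar_region_split_angle[OF A less_imp_le[OF m(1)] less_imp_le[OF m(2)] this, of P]
  have "psum h (polar_region A P a b) = psum h (polar_region A P a m) + psum h (polar_region A P m b)"
    unfolding split(1) by (rule psum_union[OF split(2), where B = P])
      (use A polar_region_norm[of _ A P a m] polar_region_norm[of _ A P m b] in auto)
  also have "cmod \<dots> \<le> X + X"
    using m by (intro order_trans[OF norm_triangle_ineq] add_mono bound)
  finally show ?thesis by simp
qed

text \<open>Two bisections lead to four quarters, each bounded by \<open>2 * EB\<close>.\<close>

lemma psum_full:
  assumes h: "h \<in> ZI" "h \<noteq> 0" "cmod h \<le> t" and ab: "a < b" "b \<le> a + 2 * pi" and P: "0 \<le> A" "A \<le> P" "P \<le> t ^ 12"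
  shows "cmod (psum h (polar_region A P a b)) \<le> 8 * EB"
proof -
  have 1: "cmod (psum h (polar_region A P a b)) \<le> 2 * (2 * EB)" if "a < b" "b \<le> a + pi" for a b
    by (rule psum_bisect[where W = "pi / 2"]) (use that P psum_quarter[OF h _ _ P] in auto)
  have "cmod (psum h (polar_region A P a b)) \<le> 2 * (2 * (2 * EB))"
    by (rule psum_bisect[where W = pi]) (use ab P 1 in auto)
  then show ?thesis by simp
qed

text \<open>Primes are counted as lattice points. This trivial bound suffices because the factors it
  meets later save a power of \<open>t\<close>.\<close>

lemma prime_count_le:
  assumes "0 \<le> A" "P \<le> t ^ 12"
  shows "finite (primes_in (polar_region A P a b))"
    and "real (card (primes_in (polar_region A P a b))) \<le> 9 * t ^ 24"
proof -
  have sub: "(primes_in (polar_region A P a b)) \<subseteq> gball (t ^ 12)"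
    using polar_region_norm[of _ A P a b] assms by (fastforce simp: gball_def gauss_prime_def)
  then show "finite (primes_in (polar_region A P a b))"
    by (rule finite_subset) simp
  have t1: "1 \<le> t ^ 12" using t by (intro one_le_power) auto
  have "real (card (primes_in (polar_region A P a b))) \<le> real (card (gball (t ^ 12)))"
    using sub by (simp add: card_mono)
  also have "\<dots> \<le> (2 * t ^ 12 + 1)^2" using t1 by (intro card_gball) auto
  also have "\<dots> \<le> (3 * t ^ 12)^2" using t1 by (intro power_mono) auto
  also have "\<dots> = 9 * t ^ 24" by (simp add: power_mult_distrib power_mult[symmetric])
  finally show "real (card (primes_in (polar_region A P a b))) \<le> 9 * t ^ 24" .
qed

lemma near_gauss_iff:
  "(\<exists>q\<in>ZI. max \<bar>Re (u - q)\<bar> \<bar>Im (u - q)\<bar> \<le> \<delta>) \<longleftrightarrow> near_int \<delta> (Re u) \<and> near_int \<delta> (Im u)"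
proof
  assume "\<exists>q\<in>ZI. max \<bar>Re (u - q)\<bar> \<bar>Im (u - q)\<bar> \<le> \<delta>"
  then obtain q where q: "q \<in> ZI" "\<bar>Re (u - q)\<bar> \<le> \<delta>" "\<bar>Im (u - q)\<bar> \<le> \<delta>" by auto
  obtain x y :: int where "q = Complex (of_int x) (of_int y)" using q(1) by (rule gauss_intsE)
  then show "near_int \<delta> (Re u) \<and> near_int \<delta> (Im u)" using q by (auto simp: near_int_def)
next
  assume "near_int \<delta> (Re u) \<and> near_int \<delta> (Im u)"
  then obtain x y :: int where "\<bar>Re u - of_int x\<bar> \<le> \<delta>" "\<bar>Im u - of_int y\<bar> \<le> \<delta>"
    by (auto simp: near_int_def)
  then show "\<exists>q\<in>ZI. max \<bar>Re (u - q)\<bar> \<bar>Im (u - q)\<bar> \<le> \<delta>"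
    by (intro bexI[of _ "Complex (of_int x) (of_int y)"]) auto
qed

lemma count_discrepancy:
  assumes P: "0 \<le> P1" "P1 < P2" "P2 \<le> t ^ 12" and w: "w1 < w2" "w2 \<le> w1 + 2 * pi"
    and \<delta>: "0 < \<delta>" "\<delta> \<le> 1/2" and \<Delta>: "0 < \<Delta>" "2 * \<Delta> \<le> \<delta>"
    and Hr: "1 \<le> H" "1 \<le> r" "2 * real (r * H) \<le> t"
    and \<tau>: "(real (r * H) + 1) / (2 * real H * \<Delta>) ^ (2 * r) \<le> \<tau>" "\<tau> \<le> 1"
  shows "\<bar>real (gprime_count_approx P1 P2 w1 w2 \<delta> c) - 4 * \<delta>^2 * real (gprime_count P1 P2 w1 w2)\<bar>
    \<le> (45 * (\<delta> * \<Delta>) + 2 * \<tau>) * (9 * t ^ 24) + 49 * \<delta>^2 * (real (r * H) + 1)^2 * (8 * EB)"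
proof -
  define Q where "Q = (primes_in (polar_region P1 P2 w1 w2))"
  have fin: "finite Q" and card: "real (card Q) \<le> 9 * t ^ 24"
    unfolding Q_def using prime_count_le P by auto
  have "0 \<le> (real (r * H) + 1) / (2 * real H * \<Delta>) ^ (2 * r)" using \<Delta> by simp
  then have \<tau>0: "0 \<le> \<tau>" using \<tau>(1) by linarith
  have "\<bar>real (card {p \<in> Q. near_int \<delta> (Re (p * c)) \<and> near_int \<delta> (Im (p * c))}) - 4 * \<delta>^2 * real (card Q)\<bar>
    \<le> (45 * (\<delta> * \<Delta>) + 2 * \<tau>) * real (card Q) + 49 * \<delta>^2 * (real (r * H) + 1)^2 * (8 * EB)"
  proof (rule box_count[OF fin _ Hr(1,2) \<delta> \<Delta> _ \<tau>])
    fix h assume "h \<in> ZI" "h \<noteq> 0" "cmod h \<le> 2 * real (r * H)"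
    then show "cmod (\<Sum>p\<in>Q. ee (p * (h * c))) \<le> 8 * EB"
      using psum_full[of h w1 w2 P1 P2] Hr P w unfolding psum_def Q_def by auto
  qed (use EB_nonneg in auto)
  also have "(45 * (\<delta> * \<Delta>) + 2 * \<tau>) * real (card Q) \<le> (45 * (\<delta> * \<Delta>) + 2 * \<tau>) * (9 * t ^ 24)"
    using card \<delta> \<Delta> \<tau>0 by (intro mult_left_mono) auto
  also have "{p \<in> Q. near_int \<delta> (Re (p * c)) \<and> near_int \<delta> (Im (p * c))} =
    {p. gauss_prime p \<and> p \<in> polar_region P1 P2 w1 w2 \<and> (\<exists>q\<in>ZI. max \<bar>Re (p * c - q)\<bar> \<bar>Im (p * c - q)\<bar> \<le> \<delta>)}"
    unfolding near_gauss_iff Q_def by auto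
  finally show ?thesis by (simp add: gprime_count_approx_def gprime_count_def Q_def)
qed

end

text \<open>The terms stem from the rim of the box, the tails of the kernel and the exponential
  sums. The constants are \<open>405 = 45 * 9\<close>, \<open>18 = 2 * 9\<close> and
  \<open>6272000000 = 49 * 8 * 4000000 * 4\<close>.\<close>

definition disc_rate :: "real \<Rightarrow> nat \<Rightarrow> real \<Rightarrow> real" where
  "disc_rate e r t = 405 * t powr (- e / 4) + 18 / t + 6272000000 * (real r + 1)^2 * (1 + ln t)^2 * t powr (- e)"

lemma disc_rate_tendsto:
  assumes "0 < e"
  shows "((\<lambda>t. disc_rate e r t * (12 * ln t)) \<longlongrightarrow> 0) at_top"
proof -
  define q where "q = 6272000000 * (real r + 1)^2"
  have "0 < q" by (simp add: q_def)
  have "((\<lambda>t. 405 * t powr (- e / 4) * (12 * ln t)) \<longlongrightarrow> 0) at_top"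
    "((\<lambda>t :: real. 18 / t * (12 * ln t)) \<longlongrightarrow> 0) at_top"
    "((\<lambda>t. q * (1 + ln t)^2 * t powr (- e) * (12 * ln t)) \<longlongrightarrow> 0) at_top"
    using assms \<open>0 < q\<close> by real_asymp+
  from tendsto_add[OF tendsto_add[OF this(1,2)] this(3)]
  have "((\<lambda>t. (405 * t powr (- e / 4) + 18 / t + q * (1 + ln t)^2 * t powr (- e)) * (12 * ln t)) \<longlongrightarrow> 0) at_top"
    by (simp only: distrib_right add_0)
  then show ?thesis by (simp only: disc_rate_def q_def)
qed

text \<open>The rim \<open>\<Delta> = \<delta> * t powr (- e / 4)\<close> is a vanishing fraction of
  the box. A degree \<open>H\<close> of about \<open>t powr (e / 2) / \<delta>\<close> makes
  \<open>H * \<Delta>\<close> at least \<open>t powr (e / 4)\<close>, so a fixed power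
  \<open>r\<close> kills the tails, while \<open>1 / \<delta> < t powr (1 - e)\<close> keeps all
  frequencies below \<open>t\<close>.\<close>

lemma (in good_scale) count_discrepancy_rate:
  assumes P: "0 \<le> P1" "P1 < P2" "P2 \<le> t ^ 12" and w: "w1 < w2" "w2 \<le> w1 + 2 * pi"
    and e: "0 < e" "e < 1" and \<delta>: "t powr (e - 1) < \<delta>" "\<delta> \<le> 1/2"
    and r: "8 \<le> e * real r" and t': "t powr (- e / 4) \<le> 1/2" "2 * real r * (t powr (1 - e / 2) + 1) + 1 \<le> t"
  shows "\<bar>real (gprime_count_approx P1 P2 w1 w2 \<delta> c) - 4 * \<delta>^2 * real (gprime_count P1 P2 w1 w2)\<bar>
    \<le> disc_rate e r t * (\<delta>^2 * t ^ 24)"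
proof -
  have t0: "0 < t" "1 \<le> t" using t by auto
  have \<delta>0: "0 < \<delta>" using \<delta>(1) by (rule le_less_trans[rotated]) simp
  have r1: "1 \<le> r" using r e by (cases r) auto
  define \<Delta> where "\<Delta> = \<delta> * t powr (- e / 4)"
  have \<Delta>: "0 < \<Delta>" "2 * \<Delta> \<le> \<delta>" using \<delta>0 t' t0 by (auto simp: \<Delta>_def)
  define H where "H = nat \<lceil>t powr (e / 2) / \<delta>\<rceil>"
  have Hpos: "0 < t powr (e / 2) / \<delta>" using \<delta>0 t0 by simp
  have H: "t powr (e / 2) / \<delta> \<le> real H" "real H \<le> t powr (e / 2) / \<delta> + 1" "1 \<le> H"
    unfolding H_def using Hpos by linarith+
  have "t powr (e / 2) / \<delta> \<le> t powr (e / 2) / t powr (e - 1)"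
    using \<delta> \<delta>0 t0 by (intro divide_left_mono) auto
  also have "\<dots> = t powr (1 - e / 2)" by (simp add: powr_diff[symmetric] algebra_simps)
  finally have "real H \<le> t powr (1 - e / 2) + 1" using H(2) by linarith
  then have "real r * real H \<le> real r * (t powr (1 - e / 2) + 1)" by (intro mult_left_mono) auto
  moreover define u where "u = real r * (t powr (1 - e / 2) + 1)"
  ultimately have "real (r * H) \<le> u" by simp
  moreover have "2 * u + 1 \<le> t" using t'(2) by (simp only: u_def mult.assoc)
  moreover have "0 \<le> u" by (simp add: u_def)
  ultimately have rH: "2 * real (r * H) \<le> t" "real (r * H) + 1 \<le> t" by linarith+
  have tail: "(real (r * H) + 1) / (2 * real H * \<Delta>) ^ (2 * r) \<le> 1 / t ^ 3"
  proof -
    have "t powr (e / 4) = t powr (e / 2) / \<delta> * \<Delta>"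
      using \<delta>0 by (simp add: \<Delta>_def powr_add[symmetric])
    also have "\<dots> \<le> 2 * real H * \<Delta>" using H \<Delta> by (intro mult_right_mono) auto
    finally have "(t powr (e / 4)) ^ (2 * r) \<le> (2 * real H * \<Delta>) ^ (2 * r)" by (intro power_mono) auto
    moreover have "(t powr (e / 4)) ^ (2 * r) = t powr (e * real r / 2)"
      using t0 by (simp add: powr_realpow[symmetric] powr_powr field_simps)
    \<comment> \<open>Here \<open>8 \<le> e * r\<close> enters; the tail falls to
      \<open>t / t ^ 4\<close>.\<close>
    moreover have "t powr 4 \<le> t powr (e * real r / 2)" using r t0 by (intro powr_mono) auto
    moreover have "t powr 4 = t ^ 4" using t0 by (simp add: powr_numeral)
    ultimately have "t ^ 4 \<le> (2 * real H * \<Delta>) ^ (2 * r)" by simp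
    then have "(real (r * H) + 1) / (2 * real H * \<Delta>) ^ (2 * r) \<le> t / t ^ 4"
      using rH t0 by (intro frac_le) auto
    also have "\<dots> = 1 / t ^ 3" using t0 by (simp add: power_diff[symmetric] field_simps power_numeral_reduce)
    finally show ?thesis .
  qed
  have t3: "1 / t ^ 3 \<le> 1" using t0 one_le_power[of t 3] by simp
  have "t powr (e - 1) * t powr (e - 1) \<le> \<delta> * \<delta>" using \<delta> \<delta>0 by (intro mult_mono) auto
  then have \<delta>2: "t powr (2 * e - 2) \<le> \<delta>^2" by (simp add: powr_add[symmetric] power2_eq_square)
  have "\<bar>real (gprime_count_approx P1 P2 w1 w2 \<delta> c) - 4 * \<delta>^2 * real (gprime_count P1 P2 w1 w2)\<bar>
    \<le> (45 * (\<delta> * \<Delta>) + 2 * (1 / t ^ 3)) * (9 * t ^ 24) + 49 * \<delta>^2 * (real (r * H) + 1)^2 * (8 * EB)"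
    by (rule count_discrepancy[OF P w \<delta>0 \<delta>(2) \<Delta> H(3) r1 rH(1) tail t3])
  also have "\<dots> = 405 * t powr (- e / 4) * (\<delta>^2 * t ^ 24) + 18 * t ^ 21 + 392 * ((\<delta> * (real (r * H) + 1))^2 * EB)"
  proof -
    have "2 * (1 / t ^ 3) * (9 * t ^ 24) = 18 * t ^ 21" using power_diff[of t 3 24] t0 by simp
    then show ?thesis by (simp add: \<Delta>_def power2_eq_square algebra_simps)
  qed
  \<comment> \<open>Absorbing \<open>t ^ 21\<close> takes
    \<open>\<delta>^2 \<ge> t powr (- 2)\<close>, a weak form of the lower bound for
    \<open>\<delta>\<close>.\<close>
  also have "18 * t ^ 21 \<le> 18 / t * (\<delta>^2 * t ^ 24)"
  proof -
    have "t powr (- 2) \<le> t powr (2 * e - 2)" using e t0 by (intro powr_mono) auto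
    then have "t powr (- 2) * t ^ 23 \<le> \<delta>^2 * t ^ 23" using \<delta>2 t0 by (intro mult_right_mono) auto
    moreover have "t powr (- 2) * t ^ 23 = t ^ 21" using t0
      by (simp add: powr_minus powr_numeral field_simps power_add[symmetric])
    moreover have "18 / t * (\<delta>^2 * t ^ 24) = 18 * (\<delta>^2 * t ^ 23)" using t0 by (simp add: power_numeral_reduce)
    ultimately show ?thesis by simp
  qed
  also have "392 * ((\<delta> * (real (r * H) + 1))^2 * EB) \<le> 6272000000 * (real r + 1)^2 * (1 + ln t)^2 * t powr (- e) * (\<delta>^2 * t ^ 24)"
  proof -
    have te: "1 \<le> t powr (e / 2)" using t0 e by (intro ge_one_powr_ge_zero) auto
    have "\<delta> * real H \<le> \<delta> * (t powr (e / 2) / \<delta> + 1)" using H \<delta>0 by (intro mult_left_mono) auto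
    also have "\<dots> = t powr (e / 2) + \<delta>" using \<delta>0 by (simp add: field_simps)
    also have "\<dots> \<le> 2 * t powr (e / 2)" using \<delta> te by linarith
    finally have "real r * (\<delta> * real H) \<le> real r * (2 * t powr (e / 2))" by (intro mult_left_mono) auto
    moreover have "\<delta> \<le> 2 * t powr (e / 2)" using \<delta> te by linarith
    ultimately have "\<delta> * (real (r * H) + 1) \<le> 2 * (real r + 1) * t powr (e / 2)" by (simp add: algebra_simps)
    then have "(\<delta> * (real (r * H) + 1))^2 \<le> (2 * (real r + 1) * t powr (e / 2))^2"
      using \<delta>0 by (intro power_mono) auto
    also have "\<dots> = 4 * (real r + 1)^2 * t powr e"
    proof -
      have "(t powr (e / 2))^2 = t powr e" by (simp add: power2_eq_square powr_add[symmetric])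
      then show ?thesis unfolding power_mult_distrib by simp
    qed
    finally have "392 * ((\<delta> * (real (r * H) + 1))^2 * EB) \<le> 392 * (4 * (real r + 1)^2 * t powr e * EB)"
      using EB_nonneg by (intro mult_left_mono mult_right_mono) auto
    also have "\<dots> = 6272000000 * (real r + 1)^2 * (1 + ln t)^2 * (t powr e * t ^ 22)"
      by (simp add: EB_def)
    \<comment> \<open>The kernel costs \<open>t powr e\<close> and the prime sum is of order
      \<open>t ^ 22\<close> up to logarithms, while \<open>\<delta>^2 * t ^ 24\<close> is at least
      \<open>t powr (22 + 2 * e)\<close>; the quotient is the saving
      \<open>t powr (- e)\<close>.\<close>
    also have "t powr e * t ^ 22 = t powr (- e) * (t powr (2 * e - 2) * t ^ 24)"
    proof -
      have "t ^ 22 = t powr 22" "t ^ 24 = t powr 24" using t0 by (simp_all add: powr_numeral)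
      then show ?thesis by (simp add: powr_add[symmetric])
    qed
    also have "6272000000 * (real r + 1)^2 * (1 + ln t)^2 * \<dots> \<le> 6272000000 * (real r + 1)^2 * (1 + ln t)^2 * (t powr (- e) * (\<delta>^2 * t ^ 24))"
      using \<delta>2 t0 by (intro mult_left_mono mult_right_mono) auto
    finally show ?thesis by (simp only: mult.assoc)
  qed
  finally show ?thesis by (simp add: disc_rate_def algebra_simps)
qed

text \<open>The o-term is uniform in the radii, the angles and \<open>\<delta>\<close>, so these are
  quantified inside \<open>eventually\<close>. The rate saves a power of \<open>t\<close>, which
  beats the logarithm.\<close>

theorem theorem6:
  fixes c :: complex
  assumes "\<not> (Re c \<in> \<rat> \<and> Im c \<in> \<rat>)"
  shows "\<exists>\<epsilon>0>0. \<forall>\<epsilon>. 0 < \<epsilon> \<and> \<epsilon> < \<epsilon>0 \<longrightarrow>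
    (\<exists>M :: nat \<Rightarrow> nat. strict_mono M \<and>
      (\<forall>\<eta>>0. \<forall>\<^sub>F k in sequentially.
        \<forall>P1 P2 w1 w2 \<delta>::real.
          0 \<le> P1 \<and> P1 < P2 \<and> P2 \<le> real (M k) \<and> w1 < w2 \<and> w2 \<le> w1 + 2 * pi \<and>
          real (M k) powr (\<epsilon> - 1/12) < \<delta> \<and> \<delta> \<le> 1/2 \<longrightarrow>
          \<bar>real (gprime_count_approx P1 P2 w1 w2 \<delta> c) - 4 * \<delta>^2 * real (gprime_count P1 P2 w1 w2)\<bar>
            \<le> \<eta> * (\<delta>^2 * real (M k)^2 / ln (real (M k)))))"
proof -
  let ?bound = "\<lambda>\<epsilon> (M :: nat \<Rightarrow> nat) \<eta> k. \<forall>P1 P2 w1 w2 \<delta>::real.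
    0 \<le> P1 \<and> P1 < P2 \<and> P2 \<le> real (M k) \<and> w1 < w2 \<and> w2 \<le> w1 + 2 * pi \<and>
    real (M k) powr (\<epsilon> - 1/12) < \<delta> \<and> \<delta> \<le> 1/2 \<longrightarrow>
    \<bar>real (gprime_count_approx P1 P2 w1 w2 \<delta> c) - 4 * \<delta>^2 * real (gprime_count P1 P2 w1 w2)\<bar>
    \<le> \<eta> * (\<delta>^2 * real (M k)^2 / ln (real (M k)))"
  define S where "S = {N :: nat. \<forall>j\<in>ZI. \<forall>z\<in>ZI. j \<noteq> 0 \<longrightarrow> (cmod j)^2 < real N \<longrightarrow>
    1 / (2 * sqrt (real N)) \<le> cmod (j * c - z)}"
  have "\<exists>N\<ge>B. N \<in> S" for B
  proof (rule badly_approximated_range[OF assms, of B])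
    fix N assume "B \<le> N" "\<And>j z. j \<in> ZI \<Longrightarrow> j \<noteq> 0 \<Longrightarrow> (cmod j)^2 < real N \<Longrightarrow>
      z \<in> ZI \<Longrightarrow> 1 / (2 * sqrt (real N)) \<le> cmod (j * c - z)"
    then show ?thesis unfolding S_def by blast
  qed
  then have infS: "infinite S" by (auto simp: infinite_nat_iff_unbounded_le)
  define M where "M k = (enumerate S k)^2" for k
  have sm: "strict_mono M"
  proof (rule strict_monoI)
    fix x y :: nat assume "x < y"
    then have "enumerate S x < enumerate S y" using strict_mono_enumerate[OF infS] by (simp add: strict_mono_def)
    then show "M x < M y" unfolding M_def by (intro power_strict_mono) auto
  qed
  define t where "t k = real (enumerate S k) powr (1/6)" for k
  have t_top: "filterlim t at_top sequentially"
  proof (rule filterlim_at_top_mono)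
    show "filterlim (\<lambda>k. real k powr (1/6)) at_top sequentially" by real_asymp
    show "\<forall>\<^sub>F k in sequentially. real k powr (1/6) \<le> t k"
      unfolding t_def using le_enumerate[OF infS] by (intro always_eventually allI powr_mono2) auto
  qed
  have tp: "t k ^ 6 = real (enumerate S k)" "t k ^ 12 = real (M k)" if "0 < t k" for k
  proof -
    have pos: "0 < real (enumerate S k)" using that by (auto simp: t_def intro!: Nat.gr0I)
    then show 6: "t k ^ 6 = real (enumerate S k)" by (simp add: t_def powr_power)
    have "t k ^ 12 = (t k ^ 6)^2" by (simp add: power_mult[symmetric])
    then show "t k ^ 12 = real (M k)" unfolding 6 M_def by simp
  qed
  show ?thesis
  \<comment> \<open>From \<open>\<epsilon> = 1/12\<close> on, the range of \<open>\<delta>\<close>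
    would be empty; below it, \<open>e = 12 * \<epsilon>\<close> is less than 1.\<close>
  proof (rule exI[of _ "1/12"], intro conjI allI impI)
    fix \<epsilon> :: real assume \<epsilon>: "0 < \<epsilon> \<and> \<epsilon> < 1/12"
    define e where "e = 12 * \<epsilon>"
    have e: "0 < e" "e < 1" using \<epsilon> by (auto simp: e_def)
    \<comment> \<open>\<open>r\<close> depends on \<open>\<epsilon>\<close> alone and is a constant
      in the limit.\<close>
    define r where "r = nat \<lceil>8 / e\<rceil>"
    have "8 / e \<le> real r" unfolding r_def by linarith
    then have r: "8 \<le> e * real r" using e by (simp add: field_simps)
    show "\<exists>M :: nat \<Rightarrow> nat. strict_mono M \<and> (\<forall>\<eta>>0. \<forall>\<^sub>F k in sequentially. ?bound \<epsilon> M \<eta> k)"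
    proof (rule exI[of _ M], intro conjI sm allI impI)
      fix \<eta> :: real assume \<eta>: "0 < \<eta>"
      have "\<forall>\<^sub>F x in at_top. disc_rate e r x * (12 * ln x) < \<eta>"
        using disc_rate_tendsto[OF e(1), of r] \<eta> by (rule order_tendstoD)
      moreover have "\<forall>\<^sub>F x in at_top. x powr (- e / 4) < 1/2"
      proof -
        have "((\<lambda>x. x powr (- e / 4)) \<longlongrightarrow> 0) at_top" using e by real_asymp
        then show ?thesis by (rule order_tendstoD) simp
      qed
      moreover have "\<forall>\<^sub>F x in at_top. 2 * real r * (x powr (1 - e / 2) + 1) + 1 \<le> x"
      proof -
        define q where "q = real r"
        have "0 < q" using r e by (cases r) (auto simp: q_def)
        have "((\<lambda>x. (2 * q * (x powr (1 - e / 2) + 1) + 1) / x) \<longlongrightarrow> 0) at_top" using e \<open>0 < q\<close> by real_asymp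
        then have "\<forall>\<^sub>F x in at_top. (2 * q * (x powr (1 - e / 2) + 1) + 1) / x < 1" by (rule order_tendstoD) simp
        then show ?thesis using eventually_gt_at_top[of 0]
          by eventually_elim (simp add: q_def field_simps)
      qed
      moreover have "\<forall>\<^sub>F x :: real in at_top. 2 \<le> x" by (rule eventually_ge_at_top)
      ultimately have "\<forall>\<^sub>F x in at_top. disc_rate e r x * (12 * ln x) < \<eta> \<and> x powr (- e / 4) < 1/2 \<and>
          2 * real r * (x powr (1 - e / 2) + 1) + 1 \<le> x \<and> 2 \<le> x"
        by eventually_elim auto
      then have "\<forall>\<^sub>F k in sequentially. disc_rate e r (t k) * (12 * ln (t k)) < \<eta> \<and> t k powr (- e / 4) < 1/2 \<and>
          2 * real r * (t k powr (1 - e / 2) + 1) + 1 \<le> t k \<and> 2 \<le> t k"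
        using t_top by (rule eventually_compose_filterlim)
      then show "\<forall>\<^sub>F k in sequentially. ?bound \<epsilon> M \<eta> k"
      proof (rule eventually_mono, intro allI impI, goal_cases)
        case (1 k P1 P2 w1 w2 \<delta>)
        then have k: "disc_rate e r (t k) * (12 * ln (t k)) < \<eta>" "t k powr (- e / 4) \<le> 1/2"
          "2 * real r * (t k powr (1 - e / 2) + 1) + 1 \<le> t k" "2 \<le> t k" by auto
        then have tk: "0 < t k" "t k ^ 6 = real (enumerate S k)" "t k ^ 12 = real (M k)" using tp[of k] by auto
        have "enumerate S k \<in> S" by (rule enumerate_in_set[OF infS])
        then interpret good_scale c "enumerate S k" "t k"
          by unfold_locales (use k tk in \<open>auto simp: S_def\<close>)
        have "real (M k) powr (\<epsilon> - 1/12) = t k powr (e - 1)"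
        proof -
          have "real (M k) = t k powr 12" using tk by (simp add: powr_numeral)
          then show ?thesis by (simp add: powr_powr e_def algebra_simps)
        qed
        then have "\<bar>real (gprime_count_approx P1 P2 w1 w2 \<delta> c) - 4 * \<delta>^2 * real (gprime_count P1 P2 w1 w2)\<bar>
            \<le> disc_rate e r (t k) * (\<delta>^2 * t k ^ 24)"
          using 1(3) tk by (intro count_discrepancy_rate e r k) auto
        also have "t k ^ 24 = real (M k)^2" unfolding tk(3)[symmetric] by (simp add: power_mult[symmetric])
        also have "disc_rate e r (t k) * (\<delta>^2 * real (M k)^2) \<le> \<eta> / ln (real (M k)) * (\<delta>^2 * real (M k)^2)"
        proof (rule mult_right_mono)
          have "ln (real (M k)) = 12 * ln (t k)" using ln_realpow[of "t k" 12] tk(1) unfolding tk(3) by simp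
          moreover have "0 < ln (t k)" using k by simp
          ultimately show "disc_rate e r (t k) \<le> \<eta> / ln (real (M k))" using k(1) by (simp add: field_simps)
        qed simp
        finally show ?case by simp
      qed
    qed
  qed simp
qed

end
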